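(* (Surfaces in $E^3$.) (a) Let $D\subset\mathbb R^2$ be open and simply connected with coordinates $(x,y)$, let $\varphi:D\to\mathbb R$ be smooth with $\sin\varphi\cos\varphi\neq0$, and let $(\kappa^1,s^1)$, $(\kappa^2,s^2)$ be two smooth solutions on $D$ of the linear system $\kappa_x=\tan\varphi\,s_x$, $\kappa_y=-\cot\varphi\,s_y$, with $s^1_x\ne0$, $s^1_y\neq0$. Let $A$ be a function on $D$ with $$dA=\kappa^1d\kappa^2+s^1ds^2,\qquad\text{and let}\qquad B=\tfrac12\big((\kappa^1)^2+(s^1)^2+1\big).$$ Put $${\bf r}=\begin{pmatrix}\kappa^2-\kappa^1A/B\\ s^2-s^1A/B\\ -A/B\end{pmatrix},\qquad {\bf n}=\begin{pmatrix}\kappa^1/B\\ s^1/B\\ 1/B-1\end{pmatrix}.$$ Then, wherever ${\bf r}$ is an immersion, it is the radius-vector of a surface $M^2\subset E^3$ with unit normal ${\bf n}$, parametrized by coordinates $x,y$ of the lines of curvature; moreover $${\bf r}_x=\rho^1{\bf n}_x,\qquad {\bf r}_y=\rho^2{\bf n}_y,\qquad \rho^1=\lambda^1B-A,\quad \rho^2=\lambda^2B-A,\qquad \lambda^1=\frac{s^2_x}{s^1_x},\quad \lambda^2=\frac{s^2_y}{s^1_y},$$ so that $\rho^1,\rho^2$ are the radii of principal curvature of $M^2$, and the third fundamental form is $$(d{\bf n},d{\bf n})=\frac{(d\kappa^1)^2+(ds^1)^2}{B^2}=\Big(\frac{s^1_x}{B}\Big)^2\frac{dx^2}{\cos^2\varphi}+\Big(\frac{s^1_y}{B}\Big)^2\frac{dy^2}{\sin^2\varphi}.$$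 Thus ${\bf n}$ and the third fundamental form depend only on the first solution $(\kappa^1,s^1)$. Varying $(\kappa^2,s^2)$ with $(\kappa^1,s^1)$ fixed, one obtains the full class of Combescure-equivalent surfaces; all of them have parallel normals and parallel tangents to the lines of curvature at corresponding points $x,y$, and hence one and the same spherical image of the lines of curvature. (b) Any surface in $E^3$ can be represented (locally) in this form in a neighbourhood of a nonumbilic point: there are coordinates $x,y$ of the lines of curvature, a function $\varphi$, two solutions $(\kappa^1,s^1),(\kappa^2,s^2)$ of the linear system $\kappa_x=\tan\varphi\,s_x$, $\kappa_y=-\cot\varphi\,s_y$, and a function $A$ with $dA=\kappa^1d\kappa^2+s^1ds^2$, such that, with $B=\tfrac12\big((\kappa^1)^2+(s^1)^2+1\big)$, the radius-vector ${\bf r}$ and the unit normal ${\bf n}$ of the surface are given by $${\bf r}=\begin{pmatrix}\kappa^2-\kappa^1A/B\\ s^2-s^1A/B\\ -A/B\end{pmatrix},\qquad {\bf n}=\begin{pmatrix}\kappa^1/B\\ s^1/B\\ 1/B-1\end{pmatrix}.$$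
   Context: All functions are smooth. The radii of principal curvature $\rho^1,\rho^2$ of a surface with radius-vector ${\bf r}$, unit normal ${\bf n}$ and coordinates $x,y$ of the lines of curvature are defined by the Weingarten equations ${\bf r}_x=\rho^1{\bf n}_x$, ${\bf r}_y=\rho^2{\bf n}_y$. Coordinates $x,y$ are coordinates of the lines of curvature if the first and second fundamental forms both contain no $dx\,dy$ term. Two surfaces parametrized by coordinates $x,y$ of their lines of curvature are Combescure-equivalent if at corresponding points (same $x,y$) they have parallel normals and parallel tangents to the lines of curvature.
   Formalization: In part (b) the representation of r and n is asserted after a suitable rotation of the Cartesian axes of E^3; in a prescribed frame it fails, e.g. for z = x^2 + 2y^2 at the origin. *)

theory Defs
  imports "HOL-Analysis.Analysis"
begin

text \<open>
  Parameter domains are open subsets of \<^typ>\<open>real \<times> real\<close> and Euclidean 3-space is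
  \<^typ>\<open>real^3\<close>. All notions below are meant for open sets, on which
  \<^const>\<open>frechet_derivative\<close> \<open>f (at p)\<close> only depends on the values of \<open>f\<close> on the set.
\<close>

primrec differentiable_times_on ::
    "nat \<Rightarrow> 'a::real_normed_vector set \<Rightarrow> ('a \<Rightarrow> 'b::real_normed_vector) \<Rightarrow> bool" where
  "differentiable_times_on 0 S f \<longleftrightarrow> continuous_on S f"
| "differentiable_times_on (Suc k) S f \<longleftrightarrow>
     (\<forall>p\<in>S. f differentiable (at p)) \<and>
     (\<forall>v. differentiable_times_on k S (\<lambda>p. frechet_derivative f (at p) v))"

definition smooth_on :: "'a::real_normed_vector set \<Rightarrow> ('a \<Rightarrow> 'b::real_normed_vector) \<Rightarrow> bool" where
  "smooth_on S f \<longleftrightarrow> (\<forall>k. differentiable_times_on k S f)"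

definition diffeomorphism_on ::
    "'a::real_normed_vector set \<Rightarrow> 'b::real_normed_vector set \<Rightarrow> ('a \<Rightarrow> 'b) \<Rightarrow> bool" where
  "diffeomorphism_on U V \<psi> \<longleftrightarrow>
     bij_betw \<psi> U V \<and> smooth_on U \<psi> \<and> smooth_on V (inv_into U \<psi>)"

definition partial_x :: "(real \<times> real \<Rightarrow> 'b::real_normed_vector) \<Rightarrow> real \<times> real \<Rightarrow> 'b" where
  "partial_x f p = frechet_derivative f (at p) (1, 0)"

definition partial_y :: "(real \<times> real \<Rightarrow> 'b::real_normed_vector) \<Rightarrow> real \<times> real \<Rightarrow> 'b" where
  "partial_y f p = frechet_derivative f (at p) (0, 1)"


subsection \<open>Parametrized surfaces\<close>

definition immersion_at :: "(real \<times> real \<Rightarrow> real^3) \<Rightarrow> real \<times> real \<Rightarrow> bool" where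
  "immersion_at r p \<longleftrightarrow> r differentiable (at p) \<and> inj (frechet_derivative r (at p))"

definition surface :: "(real \<times> real) set \<Rightarrow> (real \<times> real \<Rightarrow> real^3) \<Rightarrow> (real \<times> real \<Rightarrow> real^3) \<Rightarrow> bool" where
  "surface U r n \<longleftrightarrow>
     open U \<and> smooth_on U r \<and> smooth_on U n \<and>
     (\<forall>p\<in>U. immersion_at r p \<and> norm (n p) = 1 \<and>
            (\<forall>h. n p \<bullet> frechet_derivative r (at p) h = 0))"

definition first_form :: "(real \<times> real \<Rightarrow> real^3) \<Rightarrow> real \<times> real \<Rightarrow> real \<times> real \<Rightarrow> real \<times> real \<Rightarrow> real" where
  "first_form r p u v = frechet_derivative r (at p) u \<bullet> frechet_derivative r (at p) v"

text \<open>The second fundamental form is \<open>(d\<^sup>2r, n)\<close>.\<close>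

definition second_form ::
    "(real \<times> real \<Rightarrow> real^3) \<Rightarrow> (real \<times> real \<Rightarrow> real^3) \<Rightarrow> real \<times> real \<Rightarrow> real \<times> real \<Rightarrow> real \<times> real \<Rightarrow> real" where
  "second_form r n p u v =
     frechet_derivative (\<lambda>q. frechet_derivative r (at q) u) (at p) v \<bullet> n p"

definition third_form :: "(real \<times> real \<Rightarrow> real^3) \<Rightarrow> real \<times> real \<Rightarrow> real \<times> real \<Rightarrow> real \<times> real \<Rightarrow> real" where
  "third_form n p u v = frechet_derivative n (at p) u \<bullet> frechet_derivative n (at p) v"

definition umbilic_at ::
    "(real \<times> real \<Rightarrow> real^3) \<Rightarrow> (real \<times> real \<Rightarrow> real^3) \<Rightarrow> real \<times> real \<Rightarrow> bool" where
  "umbilic_at r n p \<longleftrightarrow> (\<exists>c. \<forall>u v. second_form r n p u v = c * first_form r p u v)"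

definition curvature_line_surface ::
    "(real \<times> real) set \<Rightarrow> (real \<times> real \<Rightarrow> real^3) \<Rightarrow> (real \<times> real \<Rightarrow> real^3) \<Rightarrow> bool" where
  "curvature_line_surface U r n \<longleftrightarrow>
     surface U r n \<and>
     (\<forall>p\<in>U. first_form r p (1, 0) (0, 1) = 0 \<and> second_form r n p (1, 0) (0, 1) = 0)"

text \<open>
  The radii of principal curvature are defined by the Weingarten equations
  \<open>r\<^sub>x = \<rho>1 n\<^sub>x\<close>, \<open>r\<^sub>y = \<rho>2 n\<^sub>y\<close>; this fixes their sign.
\<close>

definition principal_radii ::
    "(real \<times> real) set \<Rightarrow> (real \<times> real \<Rightarrow> real^3) \<Rightarrow> (real \<times> real \<Rightarrow> real^3) \<Rightarrow>
     (real \<times> real \<Rightarrow> real) \<Rightarrow> (real \<times> real \<Rightarrow> real) \<Rightarrow> bool" where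
  "principal_radii U r n \<rho>1 \<rho>2 \<longleftrightarrow>
     curvature_line_surface U r n \<and>
     (\<forall>p\<in>U. partial_x r p = \<rho>1 p *\<^sub>R partial_x n p \<and> partial_y r p = \<rho>2 p *\<^sub>R partial_y n p)"

definition parallel :: "'a::real_vector \<Rightarrow> 'a \<Rightarrow> bool" where
  "parallel v w \<longleftrightarrow> (\<exists>c. c \<noteq> 0 \<and> v = c *\<^sub>R w)"

definition combescure_equivalent ::
    "(real \<times> real) set \<Rightarrow> (real \<times> real \<Rightarrow> real^3) \<Rightarrow> (real \<times> real \<Rightarrow> real^3) \<Rightarrow>
     (real \<times> real \<Rightarrow> real^3) \<Rightarrow> (real \<times> real \<Rightarrow> real^3) \<Rightarrow> bool" where
  "combescure_equivalent U r n r' n' \<longleftrightarrow>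
     curvature_line_surface U r n \<and> curvature_line_surface U r' n' \<and>
     (\<forall>p\<in>U. parallel (n p) (n' p) \<and>
            parallel (partial_x r p) (partial_x r' p) \<and>
            parallel (partial_y r p) (partial_y r' p))"

text \<open>Arcs of lines of curvature, as sets of parameters, in curvature line coordinates.\<close>

definition curvature_line_arc :: "(real \<times> real) set \<Rightarrow> (real \<times> real) set \<Rightarrow> bool" where
  "curvature_line_arc U L \<longleftrightarrow>
     L \<subseteq> U \<and> connected L \<and> (\<exists>c. (\<forall>p\<in>L. fst p = c) \<or> (\<forall>p\<in>L. snd p = c))"


subsection \<open>The linear system and the representation formula\<close>

definition solves_system ::
    "(real \<times> real) set \<Rightarrow> (real \<times> real \<Rightarrow> real) \<Rightarrow> (real \<times> real \<Rightarrow> real) \<Rightarrow> (real \<times> real \<Rightarrow> real) \<Rightarrow> bool" where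
  "solves_system D \<phi> \<kappa> s \<longleftrightarrow>
     smooth_on D \<kappa> \<and> smooth_on D s \<and>
     (\<forall>p\<in>D. partial_x \<kappa> p = tan (\<phi> p) * partial_x s p \<and>
            partial_y \<kappa> p = - cot (\<phi> p) * partial_y s p)"

text \<open>\<open>dA = \<kappa>1 d\<kappa>2 + s1 ds2\<close> on \<open>D\<close>.\<close>

definition is_potential ::
    "(real \<times> real) set \<Rightarrow> (real \<times> real \<Rightarrow> real) \<Rightarrow> (real \<times> real \<Rightarrow> real) \<Rightarrow>
     (real \<times> real \<Rightarrow> real) \<Rightarrow> (real \<times> real \<Rightarrow> real) \<Rightarrow> (real \<times> real \<Rightarrow> real) \<Rightarrow> bool" where
  "is_potential D \<kappa>1 s1 \<kappa>2 s2 A \<longleftrightarrow>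
     (\<forall>p\<in>D. (A has_derivative
        (\<lambda>h. \<kappa>1 p * frechet_derivative \<kappa>2 (at p) h + s1 p * frechet_derivative s2 (at p) h)) (at p))"

definition B_fun :: "(real \<times> real \<Rightarrow> real) \<Rightarrow> (real \<times> real \<Rightarrow> real) \<Rightarrow> real \<times> real \<Rightarrow> real" where
  "B_fun \<kappa>1 s1 p = ((\<kappa>1 p)\<^sup>2 + (s1 p)\<^sup>2 + 1) / 2"

definition radius_vector ::
    "(real \<times> real \<Rightarrow> real) \<Rightarrow> (real \<times> real \<Rightarrow> real) \<Rightarrow> (real \<times> real \<Rightarrow> real) \<Rightarrow>
     (real \<times> real \<Rightarrow> real) \<Rightarrow> (real \<times> real \<Rightarrow> real) \<Rightarrow> real \<times> real \<Rightarrow> real^3" where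
  "radius_vector \<kappa>1 s1 \<kappa>2 s2 A p =
     vector [\<kappa>2 p - \<kappa>1 p * A p / B_fun \<kappa>1 s1 p,
             s2 p - s1 p * A p / B_fun \<kappa>1 s1 p,
             - A p / B_fun \<kappa>1 s1 p]"

definition normal_vector :: "(real \<times> real \<Rightarrow> real) \<Rightarrow> (real \<times> real \<Rightarrow> real) \<Rightarrow> real \<times> real \<Rightarrow> real^3" where
  "normal_vector \<kappa>1 s1 p =
     vector [\<kappa>1 p / B_fun \<kappa>1 s1 p, s1 p / B_fun \<kappa>1 s1 p, 1 / B_fun \<kappa>1 s1 p - 1]"

end

theory Submission
  imports Defs
begin

text \<open>
  (a) Writing \<open>r = (\<kappa>2, s2, 0) - A (n + e3)\<close> with \<open>B (n + e3) = (\<kappa>1, s1, 1)\<close>, every direction along which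
  \<open>(d\<kappa>2, ds2) = \<lambda> (d\<kappa>1, ds1)\<close> satisfies \<open>dr = (\<lambda> B - A) dn\<close>; the linear system says that the two
  coordinate directions are of this kind. Conversely, a surface \<open>r\<close> with normal \<open>n\<close> determines
  \<open>A = - B r3\<close>, \<open>\<kappa>2 = r1 - \<kappa>1 r3\<close>, \<open>s2 = r2 - s1 r3\<close>, and tangency of \<open>r\<close> is exactly \<open>dA = \<kappa>1 d\<kappa>2 + s1 ds2\<close>.

  (b) Near a nonumbilic point the two principal direction fields are smooth and transversal. Each has a
  smooth first integral, and the two first integrals are curvature line coordinates. A first integral comes
  from the flow of a scalar equation \<open>y' = f (x, y)\<close>: the solution \<open>Y (x, a)\<close> with \<open>Y (0, a) = a\<close> is a fixed
  point of a contraction, its \<open>a\<close>-derivative is \<open>exp\<close> of the integral of \<open>f\<^sub>y\<close> along the solution, and this formula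
  bootstraps smoothness. After a rotation the stereographic image of the normal gives \<open>(\<kappa>1, s1)\<close>; the
  projection \<open>x \<mapsto> (x1 - \<kappa>1 x3, x2 - s1 x3)\<close> is isometric on tangent planes, so orthogonality of the principal
  directions becomes the linear system with \<open>tan \<phi> = \<kappa>1\<^sub>x / s1\<^sub>x\<close>.
\<close>

subsection \<open>Calculus of smooth functions\<close>

text \<open>Two features of the formula shape part (b). The vector \<open>n\<close> never takes the
  value (0, 0, -1), and the system with \<open>sin \<phi> cos \<phi> \<noteq> 0\<close> lets
  \<open>\<kappa>1_x\<close> and \<open>s1_x\<close> vanish only together. A surface may violate
  either, hence the rotation \<open>Q\<close>: it puts \<open>n\<close> at (0, 0, 1) and turns
  \<open>n_x\<close> onto the diagonal of the horizontal plane, where both components are nonzero.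
  This presupposes \<open>n_x \<noteq> 0\<close>; at a nonumbilic point at most one principal
  curvature vanishes, so the two principal directions are exchanged if necessary. \<open>n_y\<close>
  may still be zero, as on a developable surface.

  For the flow, the obstacle is differentiability in the initial value. The difference of two
  solutions solves a linear equation whose coefficient is a mean value of \<open>f_y\<close>, so it
  is found exactly before anything is known about derivatives in \<open>a\<close>. Integrals over
  [0, x] are written as \<open>x\<close> times an integral over [0, 1]: this suits both signs of
  \<open>x\<close> and allows differentiation under the integral with fixed limits.\<close>

abbreviation deriv_at :: "('a::real_normed_vector \<Rightarrow> 'b::real_normed_vector) \<Rightarrow> 'a \<Rightarrow> 'a \<Rightarrow> 'b" where
  "deriv_at f p \<equiv> frechet_derivative f (at p)"

lemma differentiable_times_on_cong:
  assumes "open S" "\<And>p. p \<in> S \<Longrightarrow> f p = g p" "differentiable_times_on k S f"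
  shows "differentiable_times_on k S g"
  using assms(2,3)
proof (induction k arbitrary: f g)
  case 0
  then show ?case by (simp cong: continuous_on_cong)
next
  case (Suc k)
  have d: "(g has_derivative deriv_at f p) (at p)" if "p \<in> S" for p
    using Suc.prems that assms(1)
    by (metis differentiable_times_on.simps(2) frechet_derivative_works has_derivative_transform_within_open)
  then have eq: "deriv_at f p = deriv_at g p" if "p \<in> S" for p
    using that frechet_derivative_at by blast
  have "differentiable_times_on k S (\<lambda>p. deriv_at g p v)" for v
    by (rule Suc.IH[of "\<lambda>p. deriv_at f p v"]) (use Suc.prems eq in auto)
  then show ?case using d by (auto simp: differentiable_def)
qed

text \<open>\<open>frechet_derivative\<close> is a choice and carries no formula. This rule lets an
  explicit derivative \<open>f' p\<close> take its place, which turns smoothness proofs into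
  inductions on the order: it is enough that the formula for \<open>f'\<close> is built from maps of
  order \<open>k\<close>.\<close>

lemma differentiable_times_on_SucI:
  assumes "open S" "\<And>p. p \<in> S \<Longrightarrow> (f has_derivative f' p) (at p)"
    and "\<And>v. differentiable_times_on k S (\<lambda>p. f' p v)"
  shows "differentiable_times_on (Suc k) S f"
proof -
  have "f' p = deriv_at f p" if "p \<in> S" for p
    using frechet_derivative_at assms(2) that by blast
  then have "differentiable_times_on k S (\<lambda>p. deriv_at f p v)" for v
    by (intro differentiable_times_on_cong[OF assms(1) _ assms(3)[of v]]) auto
  then show ?thesis using assms(2) by (auto simp: differentiable_def)
qed

lemma differentiable_times_on_has_derivative:
  "differentiable_times_on (Suc k) S f \<Longrightarrow> p \<in> S \<Longrightarrow>
     (f has_derivative deriv_at f p) (at p)"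
  by (simp add: frechet_derivative_works)

lemma differentiable_times_on_SucD:
  "differentiable_times_on (Suc k) S f \<Longrightarrow> differentiable_times_on k S f"
proof (induction k arbitrary: f)
  case 0
  then show ?case
    by (auto intro!: continuous_at_imp_continuous_on differentiable_imp_continuous_within)
next
  case (Suc k)
  then show ?case by (simp (no_asm_use)) blast
qed

lemma differentiable_times_on_subset:
  "differentiable_times_on k S f \<Longrightarrow> T \<subseteq> S \<Longrightarrow> differentiable_times_on k T f"
  by (induction k arbitrary: f) (auto intro: continuous_on_subset)

lemma differentiable_times_on_const: "differentiable_times_on k S (\<lambda>_. c)"
  by (induction k arbitrary: c) (auto simp: frechet_derivative_const)

lemma differentiable_times_on_bounded_linear:
  assumes "open S" "bounded_linear L"
  shows "differentiable_times_on k S L"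
proof (cases k)
  case 0
  then show ?thesis using assms(2) by (simp add: linear_continuous_on)
next
  case (Suc j)
  then show ?thesis
    using differentiable_times_on_SucI[OF assms(1) bounded_linear_imp_has_derivative[OF assms(2)]]
      differentiable_times_on_const by blast
qed

lemma differentiable_times_on_compose_bounded_linear:
  assumes "open S" "bounded_linear L" "differentiable_times_on k S f"
  shows "differentiable_times_on k S (\<lambda>p. L (f p))"
  using assms(3)
proof (induction k arbitrary: f)
  case 0
  then show ?case
    using assms(2) by (simp add: bounded_linear.continuous_on)
next
  case (Suc k)
  have "((\<lambda>p. L (f p)) has_derivative (\<lambda>v. L (deriv_at f p v))) (at p)"
    if "p \<in> S" for p
    using bounded_linear.has_derivative[OF assms(2)] differentiable_times_on_has_derivative[OF Suc.prems that]
    by blast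
  then show ?case
    by (rule differentiable_times_on_SucI[OF assms(1)]) (use Suc in auto)
qed

lemma differentiable_times_on_add:
  assumes "open S" "differentiable_times_on k S f" "differentiable_times_on k S g"
  shows "differentiable_times_on k S (\<lambda>p. f p + g p)"
  using assms(2,3)
proof (induction k arbitrary: f g)
  case 0
  then show ?case by (simp add: continuous_on_add)
next
  case (Suc k)
  show ?case
    by (rule differentiable_times_on_SucI[OF assms(1)
          has_derivative_add[OF differentiable_times_on_has_derivative[OF Suc.prems(1)]
            differentiable_times_on_has_derivative[OF Suc.prems(2)]]])
      (use Suc in auto)
qed

lemma differentiable_times_on_sum:
  assumes "open S" "finite I" "\<And>i. i \<in> I \<Longrightarrow> differentiable_times_on k S (f i)"
  shows "differentiable_times_on k S (\<lambda>p. \<Sum>i\<in>I. f i p)"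
  using assms(2,3)
  by (induction I rule: finite_induct)
    (auto intro: differentiable_times_on_const differentiable_times_on_add[OF assms(1)])

lemma differentiable_times_on_bilinear:
  assumes "open S" "bounded_bilinear b"
    and "differentiable_times_on k S f" "differentiable_times_on k S g"
  shows "differentiable_times_on k S (\<lambda>p. b (f p) (g p))"
  using assms(3,4)
proof (induction k arbitrary: f g)
  case 0
  then show ?case using bounded_bilinear.continuous_on[OF assms(2)] by simp
next
  case (Suc k)
  show ?case
  proof (rule differentiable_times_on_SucI[OF assms(1)
          bounded_bilinear.FDERIV[OF assms(2) differentiable_times_on_has_derivative[OF Suc.prems(1)]
            differentiable_times_on_has_derivative[OF Suc.prems(2)]]])
    fix v
    have "differentiable_times_on k S f" "differentiable_times_on k S g"
      using Suc.prems differentiable_times_on_SucD by blast+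
    then show "differentiable_times_on k S (\<lambda>p. b (f p) (deriv_at g p v) +
        b (deriv_at f p v) (g p))"
      using Suc by (intro differentiable_times_on_add[OF assms(1)] Suc.IH) auto
  qed
qed

text \<open>The chain rule yields \<open>deriv_at g (f p)\<close> applied to a vector that itself
  moves with \<open>p\<close>, which the induction hypothesis does not cover. Expanding that vector
  in \<open>Basis\<close> leaves a finite sum of products of
  \<open>deriv_at f p v \<bullet> b\<close> with \<open>deriv_at g (f p) b\<close>, and the latter
  is a composite of \<open>f\<close> with a map of order \<open>k\<close>.\<close>

lemma differentiable_times_on_compose:
  fixes f :: "'a::real_normed_vector \<Rightarrow> 'b::euclidean_space"
    and g :: "'b \<Rightarrow> 'c::real_normed_vector"
  assumes "open S" "differentiable_times_on k T g" "differentiable_times_on k S f" "f ` S \<subseteq> T"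
  shows "differentiable_times_on k S (\<lambda>p. g (f p))"
  using assms(2,3)
proof (induction k arbitrary: g)
  case 0
  then show ?case
    using assms(4) by (auto intro: continuous_on_compose2)
next
  case (Suc k)
  have "((\<lambda>p. g (f p)) has_derivative
      (\<lambda>v. \<Sum>b\<in>Basis. (deriv_at f p v \<bullet> b) *\<^sub>R deriv_at g (f p) b)) (at p)"
    if p: "p \<in> S" for p
  proof -
    have gd: "(g has_derivative deriv_at g (f p)) (at (f p))"
      using assms(4) p by (intro differentiable_times_on_has_derivative[OF Suc.prems(1)]) auto
    have "deriv_at g (f p) w = (\<Sum>b\<in>Basis. (w \<bullet> b) *\<^sub>R deriv_at g (f p) b)" for w
    proof -
      have "deriv_at g (f p) w = deriv_at g (f p) (\<Sum>b\<in>Basis. (w \<bullet> b) *\<^sub>R b)"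
        by (simp add: euclidean_representation)
      also have "\<dots> = (\<Sum>b\<in>Basis. (w \<bullet> b) *\<^sub>R deriv_at g (f p) b)"
        by (simp only: linear_sum[OF has_derivative_linear[OF gd]] linear_cmul[OF has_derivative_linear[OF gd]])
      finally show ?thesis .
    qed
    then have "(\<lambda>v. deriv_at g (f p) (deriv_at f p v)) =
        (\<lambda>v. \<Sum>b\<in>Basis. (deriv_at f p v \<bullet> b) *\<^sub>R deriv_at g (f p) b)"
      by (rule ext)
    then show ?thesis
      by (rule has_derivative_eq_rhs
          [OF has_derivative_compose[OF differentiable_times_on_has_derivative[OF Suc.prems(2) p] gd]])
  qed
  then show ?case
  proof (rule differentiable_times_on_SucI[OF assms(1)])
    fix v
    have "differentiable_times_on k S f"
      using Suc.prems differentiable_times_on_SucD by blast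
    then have "differentiable_times_on k S (\<lambda>p. deriv_at g (f p) b)" for b
      using Suc.IH[of "\<lambda>q. deriv_at g q b"] Suc.prems by simp
    moreover have "differentiable_times_on k S (\<lambda>p. deriv_at f p v \<bullet> b)" for b
      using Suc.prems
      by (intro differentiable_times_on_compose_bounded_linear[OF assms(1) bounded_linear_inner_left]) auto
    ultimately show "differentiable_times_on k S (\<lambda>p. \<Sum>b\<in>Basis. (deriv_at f p v \<bullet> b) *\<^sub>R
         deriv_at g (f p) b)"
      by (intro differentiable_times_on_sum[OF assms(1)]
          differentiable_times_on_bilinear[OF assms(1) bounded_bilinear_scaleR] finite_Basis)
  qed
qed

lemma differentiable_times_on_SucI_real:
  fixes f f' :: "real \<Rightarrow> real"
  assumes "open S" "\<And>x. x \<in> S \<Longrightarrow> (f has_real_derivative f' x) (at x)"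
    and "differentiable_times_on k S f'"
  shows "differentiable_times_on (Suc k) S f"
proof (rule differentiable_times_on_SucI[OF assms(1)])
  show "(f has_derivative (\<lambda>h. f' x * h)) (at x)" if "x \<in> S" for x
    using assms(2)[OF that] by (simp add: has_field_derivative_def)
  show "differentiable_times_on k S (\<lambda>x. f' x * h)" for h
    by (intro differentiable_times_on_compose_bounded_linear[OF assms(1) bounded_linear_mult_left] assms)
qed

text \<open>The derivative is an expression in the function itself, so order \<open>k\<close> of the
  function gives order \<open>k\<close> of the derivative and hence order \<open>k + 1\<close>.
  \<open>exp\<close> and \<open>sqrt\<close> bootstrap in the same way.\<close>

lemma smooth_on_inverse_real: "smooth_on (- {0}) (inverse :: real \<Rightarrow> real)"
proof -
  have "differentiable_times_on k (- {0}) (inverse :: real \<Rightarrow> real)" for k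
  proof (induction k)
    case 0
    then show ?case by (auto intro!: continuous_intros)
  next
    case (Suc k)
    show ?case
    proof (rule differentiable_times_on_SucI_real)
      show "(inverse has_real_derivative (- (inverse x * inverse x))) (at x)" if "x \<in> - {0}" for x
        using that DERIV_inverse[of x] by (simp add: power2_eq_square)
      show "differentiable_times_on k (- {0::real}) (\<lambda>x. - (inverse x * inverse x))"
        by (intro differentiable_times_on_compose_bounded_linear[OF _ bounded_linear_minus[OF bounded_linear_ident]]
          differentiable_times_on_bilinear[OF _ bounded_bilinear_mult] Suc) auto
    qed auto
  qed
  then show ?thesis by (simp add: smooth_on_def)
qed

lemma differentiable_times_on_inverse:
  fixes f :: "'a::real_normed_vector \<Rightarrow> real"
  assumes "open S" "differentiable_times_on k S f" "\<And>p. p \<in> S \<Longrightarrow> f p \<noteq> 0"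
  shows "differentiable_times_on k S (\<lambda>p. inverse (f p))"
  using assms smooth_on_inverse_real
  by (intro differentiable_times_on_compose[of S k "- {0}" inverse f]) (auto simp: smooth_on_def)

lemma smooth_on_exp_real: "smooth_on UNIV (exp :: real \<Rightarrow> real)"
proof -
  have "differentiable_times_on k UNIV (exp :: real \<Rightarrow> real)" for k
  proof (induction k)
    case (Suc k)
    show ?case by (rule differentiable_times_on_SucI_real[OF _ _ Suc]) auto
  qed (auto intro!: continuous_intros)
  then show ?thesis by (simp add: smooth_on_def)
qed

lemma smooth_on_sqrt: "smooth_on {0<..} sqrt"
proof -
  have "differentiable_times_on k {0<..} sqrt" for k
  proof (induction k)
    case (Suc k)
    show ?case
    proof (rule differentiable_times_on_SucI_real)
      show "(sqrt has_real_derivative (inverse (sqrt x) / 2)) (at x)" if "x \<in> {0<..}" for x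
        using that DERIV_real_sqrt by auto
      show "differentiable_times_on k {0<..} (\<lambda>x. inverse (sqrt x) / 2)"
        by (intro differentiable_times_on_compose_bounded_linear[OF _ bounded_linear_divide]
            differentiable_times_on_inverse Suc) auto
    qed auto
  qed (auto intro!: continuous_intros)
  then show ?thesis by (simp add: smooth_on_def)
qed

lemma smooth_on_arctan: "smooth_on UNIV arctan"
proof -
  have "differentiable_times_on k UNIV arctan" for k
  proof (cases k)
    case 0
    then show ?thesis by (auto intro!: continuous_intros)
  next
    case (Suc j)
    have nz: "1 + x * x \<noteq> 0" for x :: real
      by (metis add_pos_nonneg less_irrefl zero_le_square zero_less_one)
    have "differentiable_times_on j UNIV (\<lambda>x::real. inverse (1 + x * x))"
      by (intro differentiable_times_on_inverse differentiable_times_on_add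
          differentiable_times_on_bilinear[OF _ bounded_bilinear_mult] differentiable_times_on_const
          differentiable_times_on_bounded_linear[OF _ bounded_linear_ident])
       (use nz in \<open>auto simp: smooth_on_def\<close>)
    then show ?thesis
      unfolding Suc using DERIV_arctan
      by (intro differentiable_times_on_SucI_real[where f' = "\<lambda>x. inverse (1 + x * x)"])
       (auto simp: power2_eq_square)
  qed
  then show ?thesis by (simp add: smooth_on_def)
qed

lemma differentiable_times_on_uminus:
  "open S \<Longrightarrow> differentiable_times_on k S f \<Longrightarrow> differentiable_times_on k S (\<lambda>p. - f p)"
  by (rule differentiable_times_on_compose_bounded_linear[OF _ bounded_linear_minus[OF bounded_linear_ident]])

lemma differentiable_times_on_diff:
  "open S \<Longrightarrow> differentiable_times_on k S f \<Longrightarrow> differentiable_times_on k S g \<Longrightarrow>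
     differentiable_times_on k S (\<lambda>p. f p - g p)"
  using differentiable_times_on_add[of S k f "\<lambda>p. - g p"] differentiable_times_on_uminus[of S k g] by simp

lemma differentiable_times_on_divide:
  fixes f g :: "'a::real_normed_vector \<Rightarrow> real"
  shows "open S \<Longrightarrow> differentiable_times_on k S f \<Longrightarrow> differentiable_times_on k S g \<Longrightarrow>
     (\<And>p. p \<in> S \<Longrightarrow> g p \<noteq> 0) \<Longrightarrow> differentiable_times_on k S (\<lambda>p. f p / g p)"
  unfolding divide_inverse
  by (rule differentiable_times_on_bilinear[OF _ bounded_bilinear_mult]) (auto intro: differentiable_times_on_inverse)

lemma differentiable_times_on_power2:
  fixes f :: "'a::real_normed_vector \<Rightarrow> real"
  shows "open S \<Longrightarrow> differentiable_times_on k S f \<Longrightarrow> differentiable_times_on k S (\<lambda>p. (f p)\<^sup>2)"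
  unfolding power2_eq_square by (rule differentiable_times_on_bilinear[OF _ bounded_bilinear_mult])

lemma differentiable_times_on_Pair:
  assumes "open S" "differentiable_times_on k S f" "differentiable_times_on k S g"
  shows "differentiable_times_on k S (\<lambda>p. (f p, g p))"
proof -
  have l: "bounded_linear (\<lambda>x. (x, 0))" "bounded_linear (\<lambda>x. (0, x))"
    by (auto intro!: bounded_linear_Pair bounded_linear_ident bounded_linear_zero)
  show ?thesis
    using differentiable_times_on_add[OF assms(1)
        differentiable_times_on_compose_bounded_linear[OF assms(1) l(1) assms(2)]
        differentiable_times_on_compose_bounded_linear[OF assms(1) l(2) assms(3)]] by simp
qed

lemma differentiable_times_on_vec_nth:
  fixes f :: "'a::real_normed_vector \<Rightarrow> real ^ 'n::finite"
  shows "open S \<Longrightarrow> differentiable_times_on k S f \<Longrightarrow> differentiable_times_on k S (\<lambda>p. f p $ i)"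
  by (rule differentiable_times_on_compose_bounded_linear[OF _ bounded_linear_vec_nth])

lemma vector_3_eq_axis:
  "(vector [a, b, c] :: real^3) = a *\<^sub>R axis 1 1 + b *\<^sub>R axis 2 1 + c *\<^sub>R axis 3 1"
  by (simp add: vec_eq_iff forall_3 axis_def)

lemmas differentiable_times_on_mult = differentiable_times_on_bilinear[OF _ bounded_bilinear_mult]
lemmas differentiable_times_on_scaleR = differentiable_times_on_bilinear[OF _ bounded_bilinear_scaleR]
lemmas differentiable_times_on_inner = differentiable_times_on_bilinear[OF _ bounded_bilinear_inner]
lemmas differentiable_times_on_fst = differentiable_times_on_compose_bounded_linear[OF _ bounded_linear_fst]
lemmas differentiable_times_on_snd = differentiable_times_on_compose_bounded_linear[OF _ bounded_linear_snd]
lemmas differentiable_times_on_ident = differentiable_times_on_bounded_linear[OF _ bounded_linear_ident]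

lemma differentiable_times_on_vector_3:
  assumes "open S" "differentiable_times_on k S f" "differentiable_times_on k S g" "differentiable_times_on k S h"
  shows "differentiable_times_on k S (\<lambda>p. vector [f p, g p, h p] :: real^3)"
  unfolding vector_3_eq_axis
  by (intro differentiable_times_on_add differentiable_times_on_scaleR differentiable_times_on_const assms)

lemmas differentiable_times_on_intros =
  differentiable_times_on_add differentiable_times_on_diff differentiable_times_on_uminus
  differentiable_times_on_mult differentiable_times_on_divide differentiable_times_on_inverse
  differentiable_times_on_power2 differentiable_times_on_scaleR differentiable_times_on_inner
  differentiable_times_on_Pair differentiable_times_on_vector_3 differentiable_times_on_vec_nth
  differentiable_times_on_const differentiable_times_on_ident
  differentiable_times_on_fst differentiable_times_on_snd

lemma smooth_onD: "smooth_on S f \<Longrightarrow> differentiable_times_on k S f"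
  by (simp add: smooth_on_def)

lemma smooth_on_cong: "open S \<Longrightarrow> (\<And>p. p \<in> S \<Longrightarrow> f p = g p) \<Longrightarrow> smooth_on S f \<Longrightarrow> smooth_on S g"
  unfolding smooth_on_def using differentiable_times_on_cong[of S f g] by auto

lemma smooth_on_subset: "smooth_on S f \<Longrightarrow> T \<subseteq> S \<Longrightarrow> smooth_on T f"
  unfolding smooth_on_def using differentiable_times_on_subset[of _ S f T] by auto

lemma smooth_on_compose:
  fixes f :: "'a::real_normed_vector \<Rightarrow> 'b::euclidean_space"
    and g :: "'b \<Rightarrow> 'c::real_normed_vector"
  shows "open S \<Longrightarrow> smooth_on T g \<Longrightarrow> smooth_on S f \<Longrightarrow> f ` S \<subseteq> T \<Longrightarrow> smooth_on S (\<lambda>p. g (f p))"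
  unfolding smooth_on_def using differentiable_times_on_compose[of S _ T g f] by auto

lemma smooth_on_frechet_derivative:
  "smooth_on S f \<Longrightarrow> smooth_on S (\<lambda>p. deriv_at f p v)"
  using smooth_onD[of S f "Suc k" for k]
  unfolding differentiable_times_on.simps smooth_on_def by blast

lemma smooth_on_partial_x: "smooth_on S f \<Longrightarrow> smooth_on S (partial_x f)"
  using smooth_on_frechet_derivative[of S f "(1, 0)"] unfolding partial_x_def[abs_def] .

lemma smooth_on_partial_y: "smooth_on S f \<Longrightarrow> smooth_on S (partial_y f)"
  using smooth_on_frechet_derivative[of S f "(0, 1)"] unfolding partial_y_def[abs_def] .

lemma smooth_on_has_derivative:
  "smooth_on S f \<Longrightarrow> p \<in> S \<Longrightarrow> (f has_derivative deriv_at f p) (at p)"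
  using differentiable_times_on_has_derivative[of 0] smooth_onD[of S f "Suc 0"] by simp

lemma smooth_on_imp_continuous_on: "smooth_on S f \<Longrightarrow> continuous_on S f"
  using smooth_onD[of S f 0] by simp

lemma smooth_on_bounded_linear_compose:
  "open S \<Longrightarrow> bounded_linear L \<Longrightarrow> smooth_on S f \<Longrightarrow> smooth_on S (\<lambda>p. L (f p))"
  unfolding smooth_on_def using differentiable_times_on_compose_bounded_linear[of S L _ f] by auto

lemma smooth_on_smooth_derivative:
  assumes "open S" "\<And>p. p \<in> S \<Longrightarrow> (f has_derivative f' p) (at p)" "\<And>v. smooth_on S (\<lambda>p. f' p v)"
  shows "smooth_on S f"
  unfolding smooth_on_def
proof
  fix k
  have "differentiable_times_on (Suc k) S f"
    using assms by (intro differentiable_times_on_SucI[OF assms(1,2)] smooth_onD) auto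
  then show "differentiable_times_on k S f" by (rule differentiable_times_on_SucD)
qed

lemma has_derivative_plane:
  fixes f :: "real \<times> real \<Rightarrow> 'b::real_normed_vector"
  assumes "(f has_derivative f') (at p)"
  shows "f' = (\<lambda>h. fst h *\<^sub>R partial_x f p + snd h *\<^sub>R partial_y f p)"
proof
  fix h :: "real \<times> real"
  have lin: "linear f'" using assms has_derivative_linear by blast
  have "h = fst h *\<^sub>R (1, 0) + snd h *\<^sub>R (0, 1)" by (simp add: prod_eq_iff)
  then have "f' h = fst h *\<^sub>R f' (1, 0) + snd h *\<^sub>R f' (0, 1)"
    by (metis (no_types) lin linear_add linear_cmul)
  then show "f' h = fst h *\<^sub>R partial_x f p + snd h *\<^sub>R partial_y f p"
    by (simp add: partial_x_def partial_y_def frechet_derivative_at[OF assms, symmetric])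
qed

lemma smooth_on_has_derivative_plane:
  fixes f :: "real \<times> real \<Rightarrow> 'b::real_normed_vector"
  assumes "smooth_on S f" "p \<in> S"
  shows "(f has_derivative (\<lambda>h. fst h *\<^sub>R partial_x f p + snd h *\<^sub>R partial_y f p)) (at p)"
  using smooth_on_has_derivative[OF assms] has_derivative_plane[OF smooth_on_has_derivative[OF assms]] by simp

lemma frechet_derivative_plane:
  fixes f :: "real \<times> real \<Rightarrow> 'b::real_normed_vector"
  assumes "smooth_on S f" "p \<in> S"
  shows "deriv_at f p h = fst h *\<^sub>R partial_x f p + snd h *\<^sub>R partial_y f p"
  using fun_cong[OF has_derivative_plane[OF smooth_on_has_derivative[OF assms]]] .

lemma differentiable_times_on_SucI_plane:
  fixes f :: "real \<times> real \<Rightarrow> 'b::real_normed_vector"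
  assumes "open S" "\<And>p. p \<in> S \<Longrightarrow> (f has_derivative (\<lambda>h. fst h *\<^sub>R fx p + snd h *\<^sub>R fy p)) (at p)"
    and "differentiable_times_on k S fx" "differentiable_times_on k S fy"
  shows "differentiable_times_on (Suc k) S f"
proof (rule differentiable_times_on_SucI[OF assms(1,2)])
  show "differentiable_times_on k S (\<lambda>p. fst v *\<^sub>R fx p + snd v *\<^sub>R fy p)" for v
    by (intro differentiable_times_on_add differentiable_times_on_scaleR differentiable_times_on_const assms)
qed

section \<open>Smooth local inverses of plane maps\<close>

text \<open>Cramer's rule, kept explicit so that the derivative of a local inverse becomes a
  rational expression in partial derivatives.\<close>

lemma linear_plane_inverse:
  fixes a b c d :: real
  assumes "a * d - b * c \<noteq> 0"
  shows "inv (\<lambda>h::real\<times>real. fst h *\<^sub>R (a, b) + snd h *\<^sub>R (c, d)) =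
    (\<lambda>w. ((d * fst w - c * snd w) / (a * d - b * c), (a * snd w - b * fst w) / (a * d - b * c)))"
proof (rule inv_equality)
  fix h :: "real \<times> real"
  have "d * (fst h * a + snd h * c) - c * (fst h * b + snd h * d) = fst h * (a * d - b * c)"
    "a * (fst h * b + snd h * d) - b * (fst h * a + snd h * c) = snd h * (a * d - b * c)"
    by (auto simp: algebra_simps)
  then show "((d * fst (fst h *\<^sub>R (a, b) + snd h *\<^sub>R (c, d)) - c * snd (fst h *\<^sub>R (a, b) + snd h *\<^sub>R (c, d))) / (a * d - b * c),
        (a * snd (fst h *\<^sub>R (a, b) + snd h *\<^sub>R (c, d)) - b * fst (fst h *\<^sub>R (a, b) + snd h *\<^sub>R (c, d))) / (a * d - b * c)) = h"
    using assms by (simp add: prod_eq_iff)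
next
  fix w :: "real \<times> real"
  have "(d * fst w - c * snd w) * a + (a * snd w - b * fst w) * c = fst w * (a * d - b * c)"
    "(d * fst w - c * snd w) * b + (a * snd w - b * fst w) * d = snd w * (a * d - b * c)"
    by (auto simp: algebra_simps)
  then show "fst ((d * fst w - c * snd w) / (a * d - b * c), (a * snd w - b * fst w) / (a * d - b * c)) *\<^sub>R (a, b) +
    snd ((d * fst w - c * snd w) / (a * d - b * c), (a * snd w - b * fst w) / (a * d - b * c)) *\<^sub>R (c, d) = w"
    using assms by (simp add: prod_eq_iff add_divide_distrib[symmetric])
qed

text \<open>From a once differentiable inverse to a smooth one: \<open>g' y\<close> is the inverse
  of the derivative of \<open>f\<close> at \<open>g y\<close>, by Cramer's rule a rational
  expression in the partial derivatives of \<open>f\<close> composed with \<open>g\<close>. If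
  \<open>g\<close> has order \<open>k\<close>, so has this expression, and \<open>g\<close> has
  order \<open>k + 1\<close>.\<close>

lemma smooth_local_inverse_plane:
  fixes f :: "real \<times> real \<Rightarrow> real \<times> real"
  assumes U: "open U" and f: "smooth_on U f" and x0: "x0 \<in> U"
    and J: "fst (partial_x f x0) * snd (partial_y f x0) - snd (partial_x f x0) * fst (partial_y f x0) \<noteq> 0"
  obtains U' V g where "open U'" "U' \<subseteq> U" "x0 \<in> U'" "open V" "f x0 \<in> V" "homeomorphism U' V f g"
    "smooth_on V g"
proof -
  define J where "J p = fst (partial_x f p) * snd (partial_y f p) - snd (partial_x f p) * fst (partial_y f p)" for p
  have J_smooth: "smooth_on U J"
    unfolding J_def smooth_on_def
    by (intro allI differentiable_times_on_intros U smooth_onD smooth_on_partial_x smooth_on_partial_y f)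
  \<comment> \<open>On \<open>U0\<close> the Jacobian has no zero, so the quotients by
    \<open>J (g y)\<close> in the induction are legitimate on all of \<open>V\<close>.\<close>
  define U0 where "U0 = {p \<in> U. J p \<noteq> 0}"
  have U0: "open U0" "x0 \<in> U0" "U0 \<subseteq> U"
    using continuous_open_preimage[OF smooth_on_imp_continuous_on[OF J_smooth] U, of "- {0}"] x0 J
    by (auto simp: U0_def J_def vimage_def Int_def)
  have f0: "smooth_on U0 f" using f U0(3) smooth_on_subset by blast
  define f' where "f' p = Blinfun (deriv_at f p)" for p
  have app: "blinfun_apply (f' p) = (\<lambda>h. fst h *\<^sub>R partial_x f p + snd h *\<^sub>R partial_y f p)" if "p \<in> U0" for p
    unfolding f'_def
    using frechet_derivative_plane[OF f0 that]
      has_derivative_bounded_linear[OF smooth_on_has_derivative[OF f0 that]]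
    by (auto simp: bounded_linear_Blinfun_apply)
  have inv_f': "inv (blinfun_apply (f' p)) = (\<lambda>w. ((snd (partial_y f p) * fst w - fst (partial_y f p) * snd w) / J p,
     (fst (partial_x f p) * snd w - snd (partial_x f p) * fst w) / J p))" if "p \<in> U0" for p
    using linear_plane_inverse[of "fst (partial_x f p)" "snd (partial_y f p)" "snd (partial_x f p)" "fst (partial_y f p)"] that
    by (simp add: app J_def[symmetric] U0_def)
  have bij_f': "bij (blinfun_apply (f' p))" if "p \<in> U0" for p
  proof -
    have "linear (blinfun_apply (f' p))" by (simp add: blinfun.bounded_linear_right bounded_linear.linear)
    moreover have "inj (blinfun_apply (f' p))"
    proof (subst linear_injective_0[OF \<open>linear (blinfun_apply (f' p))\<close>], intro allI impI)
      fix v :: "real \<times> real" assume z: "blinfun_apply (f' p) v = 0"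
      then have e: "fst v * fst (partial_x f p) + snd v * fst (partial_y f p) = 0"
        "fst v * snd (partial_x f p) + snd v * snd (partial_y f p) = 0"
        by (auto simp: app[OF that] prod_eq_iff)
      \<comment> \<open>Each coordinate of \<open>v\<close> times \<open>J p\<close> is a
        combination of the two components that vanish.\<close>
      have "fst v * J p = snd (partial_y f p) * (fst v * fst (partial_x f p) + snd v * fst (partial_y f p))
          - fst (partial_y f p) * (fst v * snd (partial_x f p) + snd v * snd (partial_y f p))"
        "snd v * J p = fst (partial_x f p) * (fst v * snd (partial_x f p) + snd v * snd (partial_y f p))
          - snd (partial_x f p) * (fst v * fst (partial_x f p) + snd v * fst (partial_y f p))"
        by (auto simp: J_def algebra_simps)
      then show "v = 0" using e that by (simp add: U0_def prod_eq_iff)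
    qed
    ultimately show ?thesis
      using linear_injective_imp_surjective by (auto simp: bij_def)
  qed
  have der: "(f has_derivative blinfun_apply (f' p)) (at p)" if "p \<in> U0" for p
    using smooth_on_has_derivative_plane[OF f0 that] app[OF that] by simp
  have cont: "continuous_on U0 f'"
  proof (rule continuous_on_blinfun_componentwise)
    fix i :: "real \<times> real"
    have "continuous_on U0 (\<lambda>p. fst i *\<^sub>R partial_x f p + snd i *\<^sub>R partial_y f p)"
      by (intro continuous_intros smooth_on_imp_continuous_on smooth_on_partial_x smooth_on_partial_y f0)
    then show "continuous_on U0 (\<lambda>x. blinfun_apply (f' x) i)"
      by (simp add: app cong: continuous_on_cong)
  qed
  have bl: "bounded_linear (inv (blinfun_apply (f' x0)))"
    using linear_conv_bounded_linear bij_f'[OF U0(2)] inj_linear_imp_inv_bounded_linear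
      blinfun.bounded_linear_right bij_def by metis
  have inv: "Blinfun (inv (blinfun_apply (f' x0))) o\<^sub>L f' x0 = id_blinfun"
    using bij_f'[OF U0(2)]
    by (intro blinfun_eqI) (simp add: bounded_linear_Blinfun_apply[OF bl] bij_def)
  obtain U' V g g' where g: "open U'" "U' \<subseteq> U0" "x0 \<in> U'" "open V" "f x0 \<in> V" "homeomorphism U' V f g"
    and g': "\<And>y. y \<in> V \<Longrightarrow> (g has_derivative (g' y)) (at y)"
      "\<And>y. y \<in> V \<Longrightarrow> g' y = inv (blinfun_apply (f'(g y)))"
    using inverse_function_theorem[OF U0(1) der cont U0(2) inv] by metis
  have gV: "g ` V \<subseteq> U0" using g(2,6) by (auto simp: homeomorphism_def)
  have "differentiable_times_on k V g" for k
  proof (induction k)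
    case 0
    then show ?case using g(6) by (simp add: homeomorphism_def)
  next
    case (Suc k)
    have comp: "differentiable_times_on k V (\<lambda>y. h (g y))" if "smooth_on U h" for h :: "real \<times> real \<Rightarrow> 'z::real_normed_vector"
      using differentiable_times_on_compose[OF g(4) smooth_onD[OF smooth_on_subset[OF that U0(3)]] Suc gV] .
    show ?case
    proof (rule differentiable_times_on_SucI[OF g(4) g'(1)])
      fix v
      have "differentiable_times_on k V (\<lambda>y. ((snd (partial_y f (g y)) * fst v - fst (partial_y f (g y)) * snd v) / J (g y),
         (fst (partial_x f (g y)) * snd v - snd (partial_x f (g y)) * fst v) / J (g y)))"
        by (intro differentiable_times_on_intros comp smooth_on_partial_x smooth_on_partial_y f J_smooth g(4))
          (use gV U0_def in auto)
      moreover have "g' y v = ((snd (partial_y f (g y)) * fst v - fst (partial_y f (g y)) * snd v) / J (g y),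
         (fst (partial_x f (g y)) * snd v - snd (partial_x f (g y)) * fst v) / J (g y))" if "y \<in> V" for y
        using gV that by (simp add: g'(2)[OF that] inv_f' image_subset_iff)
      ultimately show "differentiable_times_on k V (\<lambda>y. g' y v)"
        by (auto intro: differentiable_times_on_cong[OF g(4), rotated])
    qed
  qed
  then have "smooth_on V g" by (simp add: smooth_on_def)
  then show thesis using that g U0(3) by blast
qed

subsection \<open>Mixed partials and parameter integrals\<close>

lemma has_real_derivative_partial_x:
  fixes f :: "real \<times> real \<Rightarrow> real"
  assumes "smooth_on S f" "(x, y) \<in> S"
  shows "((\<lambda>t. f (t, y)) has_real_derivative partial_x f (x, y)) (at x)"
proof -
  have l: "((\<lambda>t. (t, y)) has_derivative (\<lambda>t. (t, 0))) (at x)"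
    by (auto intro!: derivative_eq_intros)
  show ?thesis
    unfolding has_field_derivative_def
    by (rule has_derivative_eq_rhs[OF has_derivative_compose[OF l smooth_on_has_derivative_plane[OF assms]]])
      (auto simp: mult.commute)
qed

lemma has_real_derivative_partial_y:
  fixes f :: "real \<times> real \<Rightarrow> real"
  assumes "smooth_on S f" "(x, y) \<in> S"
  shows "((\<lambda>t. f (x, t)) has_real_derivative partial_y f (x, y)) (at y)"
proof -
  have l: "((\<lambda>t. (x, t)) has_derivative (\<lambda>t. (0, t))) (at y)"
    by (auto intro!: derivative_eq_intros)
  show ?thesis
    unfolding has_field_derivative_def
    by (rule has_derivative_eq_rhs[OF has_derivative_compose[OF l smooth_on_has_derivative_plane[OF assms]]])
      (auto simp: mult.commute)
qed

text \<open>The mean value theorem is applied in \<open>x\<close> to the difference of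
  \<open>f\<close> at heights \<open>b + h\<close> and \<open>b\<close>, and in \<open>y\<close> to
  \<open>fx \<xi>\<close>. The second difference on the left does not depend on which variable is
  treated first; this is what forces mixed partial derivatives to agree.\<close>

lemma second_difference_mean_value:
  fixes f fx fxy :: "real \<Rightarrow> real \<Rightarrow> real"
  assumes "h > 0"
    and fx: "\<And>x y. x \<in> {a..a+h} \<Longrightarrow> y \<in> {b..b+h} \<Longrightarrow> ((\<lambda>x. f x y) has_real_derivative fx x y) (at x)"
    and fxy: "\<And>x y. x \<in> {a..a+h} \<Longrightarrow> y \<in> {b..b+h} \<Longrightarrow> ((\<lambda>y. fx x y) has_real_derivative fxy x y) (at y)"
  shows "\<exists>\<xi>\<in>{a..a+h}. \<exists>\<eta>\<in>{b..b+h}. f (a+h) (b+h) - f (a+h) b - f a (b+h) + f a b = h * (h * fxy \<xi> \<eta>)"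
proof -
  have "\<exists>\<xi>. a < \<xi> \<and> \<xi> < a + h \<and>
      (f (a+h) (b+h) - f (a+h) b) - (f a (b+h) - f a b) = ((a + h) - a) * (fx \<xi> (b+h) - fx \<xi> b)"
    using assms(1) by (intro MVT2) (auto intro!: DERIV_diff fx)
  then obtain \<xi> where \<xi>: "a < \<xi>" "\<xi> < a + h"
    "(f (a+h) (b+h) - f (a+h) b) - (f a (b+h) - f a b) = h * (fx \<xi> (b+h) - fx \<xi> b)" by auto
  have "\<exists>\<eta>. b < \<eta> \<and> \<eta> < b + h \<and> fx \<xi> (b+h) - fx \<xi> b = ((b + h) - b) * fxy \<xi> \<eta>"
    using assms(1) \<xi> by (intro MVT2) (auto intro!: fxy)
  then obtain \<eta> where "b < \<eta>" "\<eta> < b + h" "fx \<xi> (b+h) - fx \<xi> b = h * fxy \<xi> \<eta>" by auto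
  with \<xi> show ?thesis by (intro bexI[of _ \<xi>] bexI[of _ \<eta>]) auto
qed

lemma mixed_partials_commute:
  fixes f :: "real \<times> real \<Rightarrow> real"
  assumes S: "open S" and f: "smooth_on S f" and p: "p \<in> S"
  shows "partial_y (partial_x f) p = partial_x (partial_y f) p"
proof (rule ccontr)
  define F where "F = partial_y (partial_x f)"
  define G where "G = partial_x (partial_y f)"
  assume "\<not> ?thesis"
  then have ne: "F p \<noteq> G p" by (simp add: F_def G_def)
  \<comment> \<open>Half of the supposed gap: a value within \<open>e\<close> of \<open>F p\<close>
    cannot equal a value within \<open>e\<close> of \<open>G p\<close>.\<close>
  define e where "e = \<bar>F p - G p\<bar> / 2"
  have e: "e > 0" using ne by (simp add: e_def)
  have "continuous_on S F" "continuous_on S G"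
    unfolding F_def G_def
    using f by (auto intro!: smooth_on_imp_continuous_on smooth_on_partial_x smooth_on_partial_y)
  then have "isCont F p" "isCont G p"
    using S p continuous_on_eq_continuous_at by blast+
  then obtain d1 d2 where d: "d1 > 0" "\<And>q. dist q p < d1 \<Longrightarrow> \<bar>F q - F p\<bar> < e"
    "d2 > 0" "\<And>q. dist q p < d2 \<Longrightarrow> \<bar>G q - G p\<bar> < e"
    using e unfolding continuous_at_eps_delta by (metis dist_real_def)
  obtain d3 where d3: "d3 > 0" "\<And>q. dist q p < d3 \<Longrightarrow> q \<in> S"
    using S p unfolding open_dist by blast
  \<comment> \<open>Points of the square of side \<open>h\<close> with corner \<open>p\<close> are
    at distance at most \<open>2 h < 3 h\<close> from \<open>p\<close>, hence the divisor 3.\<close>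
  define h where "h = min d1 (min d2 d3) / 3"
  have h: "h > 0" "3 * h \<le> d1" "3 * h \<le> d2" "3 * h \<le> d3" using d d3 by (auto simp: h_def)
  obtain a b where ab: "p = (a, b)" by force
  have near: "dist (x, y) p < 3 * h" if "x \<in> {a..a+h}" "y \<in> {b..b+h}" for x y
  proof -
    have "dist (x, y) p \<le> \<bar>x - a\<bar> + \<bar>y - b\<bar>"
      unfolding ab dist_Pair_Pair dist_real_def
      using sqrt_sum_squares_le_sum_abs[of "\<bar>x - a\<bar>" "\<bar>y - b\<bar>"] by simp
    then show ?thesis using that h(1) by auto
  qed
  have inS: "(x, y) \<in> S" if "x \<in> {a..a+h}" "y \<in> {b..b+h}" for x y
    using near[OF that] h d3 by force
  note sx = smooth_on_partial_x[OF f] and sy = smooth_on_partial_y[OF f]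
  have "\<exists>\<xi>\<in>{a..a+h}. \<exists>\<eta>\<in>{b..b+h}.
      f (a+h, b+h) - f (a+h, b) - f (a, b+h) + f (a, b) = h * (h * F (\<xi>, \<eta>))"
    unfolding F_def
    by (rule second_difference_mean_value[OF h(1), where fx = "\<lambda>x y. partial_x f (x, y)" and f = "\<lambda>x y. f (x, y)"])
      (auto intro!: has_real_derivative_partial_x[OF f] has_real_derivative_partial_y[OF sx] inS)
  then obtain \<xi> \<eta> where 1: "\<xi> \<in> {a..a+h}" "\<eta> \<in> {b..b+h}"
    "f (a+h, b+h) - f (a+h, b) - f (a, b+h) + f (a, b) = h * (h * F (\<xi>, \<eta>))" by blast
  \<comment> \<open>The same second difference, with the roles of the variables exchanged.\<close>
  have "\<exists>\<eta>\<in>{b..b+h}. \<exists>\<xi>\<in>{a..a+h}.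
      f (a+h, b+h) - f (a, b+h) - f (a+h, b) + f (a, b) = h * (h * G (\<xi>, \<eta>))"
    unfolding G_def
    by (rule second_difference_mean_value[OF h(1), where fx = "\<lambda>y x. partial_y f (x, y)" and f = "\<lambda>y x. f (x, y)"
          and fxy = "\<lambda>y x. partial_x (partial_y f) (x, y)"])
      (auto intro!: has_real_derivative_partial_y[OF f] has_real_derivative_partial_x[OF sy] inS)
  then obtain \<xi>' \<eta>' where 2: "\<xi>' \<in> {a..a+h}" "\<eta>' \<in> {b..b+h}"
    "f (a+h, b+h) - f (a, b+h) - f (a+h, b) + f (a, b) = h * (h * G (\<xi>', \<eta>'))" by blast
  have "h * (h * F (\<xi>, \<eta>)) = h * (h * G (\<xi>', \<eta>'))" using 1(3) 2(3) by linarith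
  then have "F (\<xi>, \<eta>) = G (\<xi>', \<eta>')" using h(1) by simp
  moreover have "\<bar>F (\<xi>, \<eta>) - F p\<bar> < e" using near[OF 1(1,2)] h by (intro d) linarith
  moreover have "\<bar>G (\<xi>', \<eta>') - G p\<bar> < e" using near[OF 2(1,2)] h by (intro d) linarith
  ultimately have "\<bar>F p - G p\<bar> < e + e" by linarith
  then show False by (simp add: e_def)
qed

abbreviation square :: "real \<Rightarrow> (real \<times> real) set" where
  "square h \<equiv> {-h<..<h} \<times> {-h<..<h}"

lemma scaled_in_interval:
  fixes t x h :: real
  assumes "t \<in> {0..1}"
  shows "\<bar>x\<bar> \<le> h \<Longrightarrow> \<bar>t * x\<bar> \<le> h" "\<bar>x\<bar> < h \<Longrightarrow> \<bar>t * x\<bar> < h"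
proof -
  have "\<bar>t * x\<bar> \<le> 1 * \<bar>x\<bar>"
    unfolding abs_mult using assms by (intro mult_right_mono) auto
  then show "\<bar>x\<bar> \<le> h \<Longrightarrow> \<bar>t * x\<bar> \<le> h" "\<bar>x\<bar> < h \<Longrightarrow> \<bar>t * x\<bar> < h" by auto
qed

text \<open>Differentiating \<open>g (t x, y)\<close> in \<open>x\<close> brings out a factor
  \<open>t\<close>. The free weight \<open>w\<close> absorbs it, so both partial derivatives of the
  integral are again integrals of this kind and the induction closes.\<close>

lemma differentiable_times_on_scaled_integral:
  fixes g :: "real \<times> real \<Rightarrow> real"
  assumes "differentiable_times_on k (square h) g" "continuous_on {0..1} w"
  shows "differentiable_times_on k (square h) (\<lambda>p. integral {0..1} (\<lambda>t. w t * g (t * fst p, snd p)))"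
  using assms
proof (induction k arbitrary: g w)
  have mem: "(t * fst p, snd p) \<in> square h" if "p \<in> square h" "t \<in> {0..1}" for p t
    using scaled_in_interval(2)[OF that(2), of "fst p" h] that(1) by (auto simp: abs_less_iff)
  have cont: "continuous_on (square h \<times> {0..1}) (\<lambda>z. w (snd z) * g (snd z * fst (fst z), snd (fst z)))"
    if "continuous_on (square h) g" "continuous_on {0..1} w" for w and g :: "real \<times> real \<Rightarrow> real"
  proof (rule continuous_on_mult)
    show "continuous_on (square h \<times> {0..1}) (\<lambda>z. w (snd z))"
      by (rule continuous_on_compose2[OF that(2)]) (auto intro!: continuous_intros)
    show "continuous_on (square h \<times> {0..1}) (\<lambda>z. g (snd z * fst (fst z), snd (fst z)))"
      by (rule continuous_on_compose2[OF that(1)]) (use mem in \<open>force intro!: continuous_intros\<close>)+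
  qed
  {
    case 0
    then show ?case
      using integral_continuous_on_param[of "square h" 0 1 "\<lambda>p t. w t * g (t * fst p, snd p)"] cont[of g w]
      by (simp add: case_prod_beta)
  next
    case (Suc k)
    let ?gx = "partial_x g" and ?gy = "partial_y g"
    have dk: "differentiable_times_on k (square h) ?gx" "differentiable_times_on k (square h) ?gy"
      using Suc.prems(1) by (auto simp: partial_x_def[abs_def] partial_y_def[abs_def])
    have d0: "differentiable_times_on 0 (square h) f" if "differentiable_times_on k (square h) f" for f :: "real \<times> real \<Rightarrow> real" and k
      using that by (induction k) (use differentiable_times_on_SucD in blast)+
    have cg: "continuous_on (square h) g" "continuous_on (square h) ?gx" "continuous_on (square h) ?gy"
      using d0 Suc.prems(1) dk by (metis differentiable_times_on.simps(1))+
    \<comment> \<open>The derivative of the integrand in \<open>p\<close>, packed as a bounded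
      linear map because the Leibniz rule integrates such maps in \<open>t\<close>.\<close>
    define D where "D p t = (w t * t * ?gx (t * fst p, snd p)) *\<^sub>R fst_blinfun
       + (w t * ?gy (t * fst p, snd p)) *\<^sub>R (snd_blinfun :: (real \<times> real) \<Rightarrow>\<^sub>L real)" for p t
    have cw: "continuous_on {0..1} (\<lambda>t. w t * t)" using Suc.prems(2) by (intro continuous_intros)
    have contD: "continuous_on (square h \<times> cbox 0 1) (\<lambda>(p, t). D p t)"
      unfolding D_def case_prod_beta
      using cont[OF cg(2) cw] cont[OF cg(3) Suc.prems(2)] by (auto intro!: continuous_intros)
    have sect: "continuous_on {0..1} (\<lambda>t. F p t)" if "p \<in> square h" "continuous_on (square h \<times> {0..1}) (\<lambda>z. F (fst z) (snd z))"
      for F :: "real \<times> real \<Rightarrow> real \<Rightarrow> 'z::topological_space" and p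
    proof -
      have "continuous_on {0..1::real} (\<lambda>t. (p, t))" by (intro continuous_intros)
      from continuous_on_compose2[OF that(2) this] show ?thesis using that(1) by auto
    qed
    have der: "((\<lambda>p. integral {0..1} (\<lambda>t. w t * g (t * fst p, snd p))) has_derivative
         blinfun_apply (integral {0..1} (D p))) (at p)" if p: "p \<in> square h" for p
    proof -
      have "((\<lambda>p. integral (cbox 0 1) (\<lambda>t. w t * g (t * fst p, snd p))) has_derivative
         blinfun_apply (integral (cbox 0 1) (D p))) (at p within square h)"
      proof (rule leibniz_rule[OF _ _ contD p])
        show "convex (square h)" by (intro convex_Times convex_real_interval)
      next
        fix q assume q: "q \<in> square h"
        show "(\<lambda>t. w t * g (t * fst q, snd q)) integrable_on cbox 0 1"
          using sect[OF q, of "\<lambda>q t. w t * g (t * fst q, snd q)"] cont[OF cg(1) Suc.prems(2)]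
          by (simp add: integrable_continuous_interval)
        fix t :: real assume t: "t \<in> cbox 0 1"
        have l: "((\<lambda>q. (t * fst q, snd q)) has_derivative (\<lambda>v. (t * fst v, snd v))) (at q)"
          by (auto intro!: derivative_eq_intros)
        have "(t * fst q, snd q) \<in> square h" using mem[OF q] t by simp
        note hd = differentiable_times_on_has_derivative[OF Suc.prems(1) this]
        note gd = has_derivative_eq_rhs[OF hd has_derivative_plane[OF hd]]
        have "((\<lambda>q. w t * g (t * fst q, snd q)) has_derivative blinfun_apply (D q t)) (at q)"
          by (rule has_derivative_eq_rhs[OF has_derivative_mult_right[OF has_derivative_compose[OF l gd]]])
            (auto simp: D_def blinfun.bilinear_simps algebra_simps)
        then show "((\<lambda>q. w t * g (t * fst q, snd q)) has_derivative blinfun_apply (D q t)) (at q within square h)"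
          by (rule has_derivative_at_withinI)
      qed
      then show ?thesis
        using p at_within_open[OF p] by (simp add: open_Times)
    qed
    show ?case
    proof (rule differentiable_times_on_SucI[OF _ der])
      show "open (square h)" by (intro open_Times) auto
      fix v :: "real \<times> real"
      have "differentiable_times_on k (square h) (\<lambda>p.
         integral {0..1} (\<lambda>t. (w t * t * fst v) * ?gx (t * fst p, snd p)) +
         integral {0..1} (\<lambda>t. (w t * snd v) * ?gy (t * fst p, snd p)))"
        by (intro differentiable_times_on_add Suc.IH dk continuous_intros Suc.prems(2) open_Times)
      moreover have "integral {0..1} (\<lambda>t. (w t * t * fst v) * ?gx (t * fst p, snd p)) +
         integral {0..1} (\<lambda>t. (w t * snd v) * ?gy (t * fst p, snd p)) = blinfun_apply (integral {0..1} (D p)) v"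
        if p: "p \<in> square h" for p
      proof -
        have i: "D p integrable_on {0..1}"
          using sect[OF p, of D] contD by (auto simp: case_prod_beta intro!: integrable_continuous_interval)
        have "continuous_on {0..1} (\<lambda>t. w t * t * fst v)" "continuous_on {0..1} (\<lambda>t. w t * snd v)"
          using Suc.prems(2) by (auto intro!: continuous_intros)
        note c = cont[OF cg(2) this(1)] cont[OF cg(3) this(2)]
        have c1: "continuous_on {0..1} (\<lambda>t. (w t * t * fst v) * ?gx (t * fst p, snd p))"
          by (rule sect[OF p, of "\<lambda>p t. (w t * t * fst v) * ?gx (t * fst p, snd p)"]) (rule c)
        have c2: "continuous_on {0..1} (\<lambda>t. (w t * snd v) * ?gy (t * fst p, snd p))"
          by (rule sect[OF p, of "\<lambda>p t. (w t * snd v) * ?gy (t * fst p, snd p)"]) (rule c)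
        have "blinfun_apply (integral {0..1} (D p)) v = integral {0..1} (\<lambda>t. blinfun_apply (D p t) v)"
          by (rule blinfun_apply_integral[OF i])
        also have "\<dots> = integral {0..1} (\<lambda>t. (w t * t * fst v) * ?gx (t * fst p, snd p) + (w t * snd v) * ?gy (t * fst p, snd p))"
          by (simp add: D_def blinfun.bilinear_simps mult_ac)
        also have "\<dots> = integral {0..1} (\<lambda>t. (w t * t * fst v) * ?gx (t * fst p, snd p)) +
            integral {0..1} (\<lambda>t. (w t * snd v) * ?gy (t * fst p, snd p))"
          by (intro integral_add integrable_continuous_interval c1 c2)
        finally show ?thesis by simp
      qed
      ultimately show "differentiable_times_on k (square h) (\<lambda>p. blinfun_apply (integral {0..1} (D p)) v)"
        by (intro differentiable_times_on_cong[of "square h" _ "\<lambda>p. blinfun_apply (integral {0..1} (D p)) v"])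
          (auto intro: open_Times)
    qed
  }
qed

text \<open>The fundamental theorem along \<open>t \<mapsto> K (t y)\<close>. The form with fixed
  limits treats \<open>y\<close> of either sign and \<open>y = 0\<close> at once.\<close>

lemma scaled_integral_eq_antiderivative:
  fixes g K :: "real \<Rightarrow> real"
  assumes K: "\<And>x. x \<in> {-h..h} \<Longrightarrow> (K has_real_derivative g x) (at x within {-h..h})" and y: "\<bar>y\<bar> \<le> h"
  shows "y * integral {0..1} (\<lambda>t. g (t * y)) = K y - K 0"
proof -
  have im: "(\<lambda>t. t * y) ` {0..1} \<subseteq> {-h..h}"
    using scaled_in_interval(1)[OF _ y] by (fastforce simp: abs_le_iff)
  have "((\<lambda>t. K (t * y)) has_real_derivative g (t * y) * y) (at t within {0..1})" if "t \<in> {0..1}" for t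
  proof -
    have "t * y \<in> {-h..h}" using im that by blast
    moreover have "((\<lambda>t. t * y) has_real_derivative y) (at t within {0..1})"
      by (auto intro!: derivative_eq_intros)
    ultimately show ?thesis
      using DERIV_image_chain[OF has_field_derivative_subset[OF K im]] by (simp add: o_def)
  qed
  then have "((\<lambda>t. g (t * y) * y) has_integral (K (1 * y) - K (0 * y))) {0..1}"
    by (intro fundamental_theorem_of_calculus) (auto simp: has_real_derivative_iff_has_vector_derivative)
  then have "integral {0..1} (\<lambda>t. g (t * y) * y) = K (1 * y) - K (0 * y)" by (rule integral_unique)
  then show ?thesis by (simp add: mult.commute)
qed

lemma scaled_integral_has_derivative:
  fixes g :: "real \<Rightarrow> real"
  assumes g: "continuous_on {-h..h} g" and x: "\<bar>x\<bar> < h"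
  shows "((\<lambda>x. x * integral {0..1} (\<lambda>t. g (t * x))) has_real_derivative g x) (at x)"
proof -
  obtain K where K: "\<And>x. x \<in> {-h..h} \<Longrightarrow> (K has_real_derivative g x) (at x within {-h..h})"
    using antiderivative_continuous[OF g] by (metis has_real_derivative_iff_has_vector_derivative)
  have "(K has_real_derivative g x) (at x within {-h<..<h})"
    by (rule has_field_derivative_subset[OF K]) (use x in auto)
  then have "(K has_real_derivative g x) (at x)"
    using x at_within_open[of x "{-h<..<h}"] by (simp add: abs_less_iff)
  then have d: "((\<lambda>x. K x - K 0) has_real_derivative g x) (at x)"
    by (auto intro!: derivative_eq_intros)
  show ?thesis
    by (rule has_field_derivative_transform_within_open[OF d, of "{-h<..<h}"])
      (use x scaled_integral_eq_antiderivative[OF K] in auto)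
qed

subsection \<open>Scalar ordinary differential equations and first integrals\<close>

text \<open>Picard's operator with clamped arguments. Clamping \<open>x\<close> and \<open>a\<close>
  to \<open>[-h, h]\<close> and the values of the candidate to \<open>[-r, r]\<close> makes it a
  self-map of the complete space of all bounded continuous functions on the plane. On the range that
  matters the clamps do nothing, since every value of the operator is bounded by
  \<open>r\<close>.\<close>

lemma scaled_ode_exists:
  fixes f :: "real \<times> real \<Rightarrow> real"
  assumes r: "r > 0" and W: "{-r..r} \<times> {-r..r} \<subseteq> W" and f: "smooth_on W f"
  obtains h Y where "0 < h" "h \<le> r" "continuous_on UNIV Y"
    "\<And>x a. \<bar>x\<bar> \<le> h \<Longrightarrow> \<bar>a\<bar> \<le> h \<Longrightarrow>
       \<bar>Y (x, a)\<bar> \<le> r \<and> Y (x, a) = a + x * integral {0..1} (\<lambda>t. f (t * x, Y (t * x, a)))"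
proof -
  let ?Q = "{-r..r} \<times> {-r..r}"
  have cQ: "compact ?Q" by (intro compact_Times compact_Icc)
  have cf: "continuous_on ?Q f" "continuous_on ?Q (partial_y f)"
    using W f by (meson continuous_on_subset smooth_on_imp_continuous_on smooth_on_partial_y)+
  obtain K where K: "\<And>q. q \<in> ?Q \<Longrightarrow> \<bar>f q\<bar> \<le> K" "K > 0"
    using compact_imp_bounded[OF compact_continuous_image[OF cf(1) cQ]] unfolding bounded_pos by fastforce
  obtain L where L: "\<And>q. q \<in> ?Q \<Longrightarrow> \<bar>partial_y f q\<bar> \<le> L" "L > 0"
    using compact_imp_bounded[OF compact_continuous_image[OF cf(2) cQ]] unfolding bounded_pos by fastforce
  have lip: "\<bar>f (x, y) - f (x, z)\<bar> \<le> L * \<bar>y - z\<bar>" if "\<bar>x\<bar> \<le> r" "\<bar>y\<bar> \<le> r" "\<bar>z\<bar> \<le> r" for x y z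
  proof -
    have "norm (f (x, y) - f (x, z)) \<le> L * norm (y - z)"
    proof (rule field_differentiable_bound[where S = "{-r..r}"])
      fix u assume u: "u \<in> {-r..r}"
      have xu: "(x, u) \<in> ?Q" using u that by (auto simp: abs_le_iff)
      show "((\<lambda>y. f (x, y)) has_real_derivative partial_y f (x, u)) (at u within {-r..r})"
        using has_real_derivative_partial_y[OF f] W xu by (blast intro: has_field_derivative_at_within)
      show "norm (partial_y f (x, u)) \<le> L" using L(1)[OF xu] by simp
    qed (use that in \<open>auto simp: abs_le_iff\<close>)
    then show ?thesis by simp
  qed
  \<comment> \<open>\<open>h (1 + K) \<le> r\<close> keeps the operator within the bound
    \<open>r\<close>, and \<open>h L \<le> 1 / 2\<close> makes it a contraction with constant
    1/2.\<close>
  define h where "h = min (r / (1 + K)) (1 / (2 * L))"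
  have "h \<le> r / (1 + K)" "h \<le> 1 / (2 * L)" by (auto simp: h_def)
  then have h: "h > 0" "h * (1 + K) \<le> r" "h * L \<le> 1 / 2"
    using r K(2) L(2) by (simp add: h_def, simp_all add: pos_le_divide_eq)
  have hr: "h \<le> r"
  proof -
    have "h * 1 \<le> h * (1 + K)" using h(1) K(2) by (intro mult_left_mono) auto
    then show ?thesis using h(2) by simp
  qed
  define c where "c b u = max (-b) (min b u)" for b u :: real
  have c_le: "\<bar>c b u\<bar> \<le> b" if "b \<ge> 0" for b u using that by (auto simp: c_def)
  have c_id: "c b u = u" if "\<bar>u\<bar> \<le> b" for b u using that by (auto simp: c_def)
  have c_lip: "\<bar>c b u - c b v\<bar> \<le> \<bar>u - v\<bar>" for b u v by (auto simp: c_def min_def max_def)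
  have c_cont: "continuous_on S (\<lambda>z. c b (g z))" if "continuous_on S g" for S :: "'z::topological_space set" and b g
    unfolding c_def using that by (intro continuous_intros)
  define I where "I \<eta> p t = f (t * c h (fst p), c r (\<eta> (t * c h (fst p), c h (snd p))))"
    for \<eta> :: "real \<times> real \<Rightarrow> real" and p :: "real \<times> real" and t :: real
  define T where "T \<eta> p = c h (snd p) + c h (fst p) * integral {0..1} (I \<eta> p)"
    for \<eta> :: "real \<times> real \<Rightarrow> real" and p :: "real \<times> real"
  have inQ: "(t * c h x, c r y) \<in> ?Q" if "t \<in> {0..1}" for t x y
  proof -
    have "\<bar>t * c h x\<bar> \<le> r" using scaled_in_interval(1)[OF that c_le, of h x] h(1) hr by simp
    moreover have "\<bar>c r y\<bar> \<le> r" using c_le r by simp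
    ultimately show ?thesis by (auto simp: abs_le_iff)
  qed
  have I_cont2: "continuous_on (UNIV \<times> {0..1}) (\<lambda>z. I \<eta> (fst z) (snd z))" if "continuous_on UNIV \<eta>" for \<eta>
    unfolding I_def
  proof (rule continuous_on_compose2[OF cf(1)])
    show "continuous_on (UNIV \<times> {0..1}) (\<lambda>z. (snd z * c h (fst (fst z)), c r (\<eta> (snd z * c h (fst (fst z)), c h (snd (fst z))))))"
      by (intro continuous_intros c_cont continuous_on_compose2[OF that]) auto
    show "(\<lambda>z. (snd z * c h (fst (fst z)), c r (\<eta> (snd z * c h (fst (fst z)), c h (snd (fst z)))))) ` (UNIV \<times> {0..1}) \<subseteq> ?Q"
      using inQ by fastforce
  qed
  have I_cont: "continuous_on {0..1} (I \<eta> p)" if "continuous_on UNIV \<eta>" for \<eta> p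
  proof -
    have "continuous_on {0..1::real} (\<lambda>t. (p, t))" by (intro continuous_intros)
    from continuous_on_compose2[OF I_cont2[OF that] this] show ?thesis by auto
  qed
  have I_bound: "\<bar>I \<eta> p t\<bar> \<le> K" if "t \<in> {0..1}" for \<eta> p t
    unfolding I_def using K(1)[OF inQ[OF that]] .
  have T_cont: "continuous_on UNIV (T \<eta>)" if "continuous_on UNIV \<eta>" for \<eta>
    unfolding T_def
    using integral_continuous_on_param[of UNIV 0 1 "I \<eta>"] I_cont2[OF that]
    by (intro continuous_intros c_cont) (simp_all add: case_prod_beta)
  have T_bound: "\<bar>T \<eta> p\<bar> \<le> r" if "continuous_on UNIV \<eta>" for \<eta> p
  proof -
    have "norm (integral {0..1} (I \<eta> p)) \<le> K * (1 - 0)"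
      by (rule integral_bound[OF _ I_cont[OF that]]) (use I_bound in auto)
    then have "\<bar>c h (fst p)\<bar> * \<bar>integral {0..1} (I \<eta> p)\<bar> \<le> h * K"
      using c_le[of h "fst p"] h(1) by (intro mult_mono) auto
    then have "\<bar>T \<eta> p\<bar> \<le> h + h * K"
      unfolding T_def using c_le[of h "snd p"] h(1) by (simp add: abs_mult[symmetric])
    then show ?thesis using h(2) by (simp add: algebra_simps)
  qed
  define T' where "T' \<eta> = Bcontfun (T (apply_bcontfun \<eta>))" for \<eta> :: "(real \<times> real) \<Rightarrow>\<^sub>C real"
  have T'_apply: "apply_bcontfun (T' \<eta>) = T (apply_bcontfun \<eta>)" for \<eta>
    unfolding T'_def
    by (rule Bcontfun_inverse)
      (auto simp: bcontfun_def bounded_iff intro!: T_cont exI[of _ r] T_bound)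
  have "dist (T' \<eta>) (T' \<xi>) \<le> 1/2 * dist \<eta> \<xi>" for \<eta> \<xi>
  proof (rule dist_bound)
    fix p
    let ?d = "dist \<eta> \<xi>"
    have diff: "\<bar>I \<eta> p t - I \<xi> p t\<bar> \<le> L * ?d" if t: "t \<in> {0..1}" for t
    proof -
      define q where "q = (t * c h (fst p), c h (snd p))"
      have "\<bar>I \<eta> p t - I \<xi> p t\<bar> \<le> L * \<bar>c r (\<eta> q) - c r (\<xi> q)\<bar>"
        unfolding I_def q_def
        using inQ[OF t, of "fst p" 0] r by (intro lip c_le) (auto simp: abs_le_iff)
      also have "\<bar>c r (\<eta> q) - c r (\<xi> q)\<bar> \<le> ?d"
        using c_lip[of r "\<eta> q" "\<xi> q"] dist_bounded[of \<eta> q \<xi>] by (simp add: dist_real_def)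
      finally show ?thesis using L(2) by simp
    qed
    have ci: "continuous_on {0..1} (I \<eta> p)" "continuous_on {0..1} (I \<xi> p)" by (auto intro!: I_cont)
    have "norm (integral {0..1} (\<lambda>t. I \<eta> p t - I \<xi> p t)) \<le> (L * ?d) * (1 - 0)"
      by (rule integral_bound) (use diff ci in \<open>auto intro!: continuous_intros\<close>)
    then have "\<bar>integral {0..1} (I \<eta> p) - integral {0..1} (I \<xi> p)\<bar> \<le> L * ?d"
      using ci by (simp add: integral_diff integrable_continuous_interval)
    then have "\<bar>c h (fst p)\<bar> * \<bar>integral {0..1} (I \<eta> p) - integral {0..1} (I \<xi> p)\<bar> \<le> h * (L * ?d)"
      using c_le[of h "fst p"] h(1) by (intro mult_mono) auto
    also have "\<dots> \<le> 1/2 * ?d"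
      using mult_right_mono[OF h(3), of ?d] by simp
    finally have "\<bar>c h (fst p) * (integral {0..1} (I \<eta> p) - integral {0..1} (I \<xi> p))\<bar> \<le> 1/2 * ?d"
      by (simp add: abs_mult)
    then show "dist (apply_bcontfun (T' \<eta>) p) (apply_bcontfun (T' \<xi>) p) \<le> 1/2 * ?d"
      by (simp add: T'_apply T_def dist_real_def right_diff_distrib)
  qed
  then obtain \<eta> where fixpoint: "T' \<eta> = \<eta>"
    using banach_fix_type[of "1/2" T'] by auto
  define Y where "Y = apply_bcontfun \<eta>"
  have YT: "Y p = T Y p" for p using T'_apply[of \<eta>] by (simp add: fixpoint Y_def)
  have Yc: "continuous_on UNIV Y" by (simp add: Y_def)
  have Yb: "\<bar>Y p\<bar> \<le> r" for p using T_bound[OF Yc] YT by metis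
  have "\<bar>Y (x, a)\<bar> \<le> r \<and> Y (x, a) = a + x * integral {0..1} (\<lambda>t. f (t * x, Y (t * x, a)))"
    if "\<bar>x\<bar> \<le> h" "\<bar>a\<bar> \<le> h" for x a
  proof -
    have "I Y (x, a) = (\<lambda>t. f (t * x, Y (t * x, a)))"
      unfolding I_def using that Yb by (simp add: c_id)
    then have "Y (x, a) = a + x * integral {0..1} (\<lambda>t. f (t * x, Y (t * x, a)))"
      using YT[of "(x, a)"] that by (simp add: T_def c_id)
    with Yb show ?thesis by blast
  qed
  then show thesis using that h(1) hr Yc by blast
qed

text \<open>Caratheodory's criterion: a continuous secant slope takes the value of the derivative at
  its centre.\<close>

lemma has_real_derivative_of_factorization:
  fixes f g :: "real \<Rightarrow> real"
  assumes "open S" "x \<in> S" "\<And>z. z \<in> S \<Longrightarrow> f z - f x = g z * (z - x)" "continuous_on S g"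
  shows "(f has_real_derivative g x) (at x)"
proof -
  have "isCont g x" using assms continuous_on_eq_continuous_at by blast
  then have "((\<lambda>z. f x + g z * (z - x)) has_real_derivative g x) (at x)"
    unfolding CARAT_DERIV by (intro exI[of _ g]) simp
  then show ?thesis
    by (rule has_field_derivative_transform_within_open[OF _ assms(1,2)]) (use assms(3) in force)
qed

lemma segment_in_symmetric_interval:
  fixes y z r s :: real
  assumes "\<bar>y\<bar> \<le> r" "\<bar>z\<bar> \<le> r" "s \<in> {0..1}"
  shows "y + s * (z - y) \<in> {-r..r}"
proof -
  have "(1 - s) *\<^sub>R y + s *\<^sub>R z \<in> {-r..r}"
    using convexD[OF convex_real_interval(5), of y "-r" r z "1 - s" s] assms by (auto simp: abs_le_iff)
  then show ?thesis by (simp add: algebra_simps)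
qed

text \<open>Hadamard's factorization. Unlike a difference quotient, the averaged derivative makes
  sense for \<open>z = y\<close> and, for continuous \<open>f'\<close>, depends continuously on both
  end points.\<close>

lemma difference_eq_mean_derivative:
  fixes f f' :: "real \<Rightarrow> real"
  assumes f: "\<And>u. u \<in> {-r..r} \<Longrightarrow> (f has_real_derivative f' u) (at u)" and yz: "\<bar>y\<bar> \<le> r" "\<bar>z\<bar> \<le> r"
  shows "f z - f y = (z - y) * integral {0..1} (\<lambda>s. f' (y + s * (z - y)))"
proof -
  have "((\<lambda>s. f (y + s * (z - y))) has_real_derivative f' (y + s * (z - y)) * (z - y)) (at s within {0..1})"
    if "s \<in> {0..1}" for s
  proof -
    have "((\<lambda>s. y + s * (z - y)) has_real_derivative (z - y)) (at s within {0..1})"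
      by (auto intro!: derivative_eq_intros)
    with f[OF segment_in_symmetric_interval[OF yz that]] show ?thesis by (rule DERIV_chain2)
  qed
  then have "((\<lambda>s. f' (y + s * (z - y)) * (z - y)) has_integral (f (y + 1 * (z - y)) - f (y + 0 * (z - y)))) {0..1}"
    by (intro fundamental_theorem_of_calculus) (auto simp: has_real_derivative_iff_has_vector_derivative)
  then have "integral {0..1} (\<lambda>s. f' (y + s * (z - y)) * (z - y)) = f (y + 1 * (z - y)) - f (y + 0 * (z - y))"
    by (rule integral_unique)
  then show ?thesis by (simp add: mult.commute)
qed

text \<open>For two initial values Hadamard's factorization turns
  \<open>d = Y (x, a) - Y (x, b)\<close> into a solution of a linear equation
  \<open>d' = g d\<close>, so that \<open>d = (a - b) exp (M a b x)\<close>. The exponential is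
  continuous in \<open>a\<close>, hence a secant slope to which Caratheodory's criterion applies; at
  \<open>a = b\<close> the averaged coefficient is \<open>f_y\<close> along the solution.\<close>

lemma scaled_ode_derivatives:
  fixes f Y :: "real \<times> real \<Rightarrow> real"
  assumes r: "{-r..r} \<times> {-r..r} \<subseteq> W" and f: "smooth_on W f"
    and h: "0 < h" "h \<le> r" and Yc: "continuous_on UNIV Y"
    and Y: "\<And>x a. \<bar>x\<bar> \<le> h \<Longrightarrow> \<bar>a\<bar> \<le> h \<Longrightarrow>
       \<bar>Y (x, a)\<bar> \<le> r \<and> Y (x, a) = a + x * integral {0..1} (\<lambda>t. f (t * x, Y (t * x, a)))"
    and x: "\<bar>x\<bar> < h"
  shows "\<And>a. \<bar>a\<bar> \<le> h \<Longrightarrow> ((\<lambda>x. Y (x, a)) has_real_derivative f (x, Y (x, a))) (at x)"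
    and "\<And>b. \<bar>b\<bar> < h \<Longrightarrow> ((\<lambda>a. Y (x, a)) has_real_derivative
           exp (x * integral {0..1} (\<lambda>t. partial_y f (t * x, Y (t * x, b))))) (at b)"
proof -
  let ?Q = "{-r..r} \<times> {-r..r}"
  have cf: "continuous_on ?Q f" "continuous_on ?Q (partial_y f)"
    using r f by (meson continuous_on_subset smooth_on_imp_continuous_on smooth_on_partial_y)+
  have Yr: "\<bar>Y (x, a)\<bar> \<le> r" if "\<bar>x\<bar> \<le> h" "\<bar>a\<bar> \<le> h" for x a using Y[OF that] by blast
  have Y0: "Y (0, a) = a" if "\<bar>a\<bar> \<le> h" for a using conjunct2[OF Y[of 0 a]] h that by simp
  have Yx: "((\<lambda>x. Y (x, a)) has_real_derivative f (x, Y (x, a))) (at x)"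
    if x: "\<bar>x\<bar> < h" and a: "\<bar>a\<bar> \<le> h" for x a
  proof -
    have "continuous_on {-h..h} (\<lambda>u. f (u, Y (u, a)))"
    proof (rule continuous_on_compose2[OF cf(1)])
      show "continuous_on {-h..h} (\<lambda>u. (u, Y (u, a)))"
        by (intro continuous_intros continuous_on_compose2[OF Yc]) auto
      have "-r \<le> Y (u, a) \<and> Y (u, a) \<le> r" if "u \<in> {-h..h}" for u
        using Yr[OF _ a, of u] that by (simp add: abs_le_iff minus_le_iff)
      then show "(\<lambda>u. (u, Y (u, a))) ` {-h..h} \<subseteq> ?Q" using h by force
    qed
    from scaled_integral_has_derivative[OF this x]
    have d: "((\<lambda>x. a + x * integral {0..1} (\<lambda>t. f (t * x, Y (t * x, a)))) has_real_derivative f (x, Y (x, a))) (at x)"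
      using DERIV_add[OF DERIV_const[of a]] by fastforce
    show ?thesis
      by (rule has_field_derivative_transform_within_open[OF d, of "{-h<..<h}"])
        (use x a Y in \<open>auto simp: abs_less_iff abs_le_iff\<close>)
  qed
  then show "\<And>a. \<bar>a\<bar> \<le> h \<Longrightarrow> ((\<lambda>x. Y (x, a)) has_real_derivative f (x, Y (x, a))) (at x)" using x by blast
  \<comment> \<open>For \<open>u = (x, y, z)\<close> this is the mean of \<open>f_y (x, .)\<close>
    over the segment from \<open>y\<close> to \<open>z\<close>.\<close>
  define q where "q u = integral {0..1} (\<lambda>s. partial_y f (fst u, fst (snd u) + s * (snd (snd u) - fst (snd u))))"
    for u :: "real \<times> real \<times> real"
  let ?Q3 = "{-r..r} \<times> {-r..r} \<times> {-r..r}"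
  have qc: "continuous_on ?Q3 q"
  proof -
    have "continuous_on (?Q3 \<times> cbox 0 1) (\<lambda>z. partial_y f (fst (fst z), fst (snd (fst z)) + snd z * (snd (snd (fst z)) - fst (snd (fst z)))))"
    proof (rule continuous_on_compose2[OF cf(2)])
      show "(\<lambda>z. (fst (fst z), fst (snd (fst z)) + snd z * (snd (snd (fst z)) - fst (snd (fst z))))) ` (?Q3 \<times> cbox 0 1) \<subseteq> ?Q"
        using segment_in_symmetric_interval[of _ r] by (force simp: abs_le_iff)
    qed (intro continuous_intros)
    then show ?thesis
      unfolding q_def using integral_continuous_on_param[of ?Q3 0 1 "\<lambda>u s. partial_y f (fst u, fst (snd u) + s * (snd (snd u) - fst (snd u)))"]
      by (simp add: case_prod_beta)
  qed
  define g where "g a b u = q (u, Y (u, b), Y (u, a))" for a b u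
  have gc: "continuous_on U (\<lambda>z. g (\<alpha> z) b (\<beta> z))"
    if "continuous_on U \<alpha>" "continuous_on U \<beta>" "\<And>z. z \<in> U \<Longrightarrow> \<bar>\<alpha> z\<bar> \<le> h" "\<And>z. z \<in> U \<Longrightarrow> \<bar>\<beta> z\<bar> \<le> h" "\<bar>b\<bar> \<le> h"
    for U :: "'z::topological_space set" and \<alpha> \<beta> b
    unfolding g_def
  proof (rule continuous_on_compose2[OF qc])
    show "continuous_on U (\<lambda>z. (\<beta> z, Y (\<beta> z, b), Y (\<beta> z, \<alpha> z)))"
      by (intro continuous_intros continuous_on_compose2[OF Yc] that) auto
    show "(\<lambda>z. (\<beta> z, Y (\<beta> z, b), Y (\<beta> z, \<alpha> z))) ` U \<subseteq> ?Q3"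
    proof clarsimp
      fix z assume z: "z \<in> U"
      have "\<bar>\<beta> z\<bar> \<le> r" using that(4)[OF z] h by linarith
      then show "- r \<le> \<beta> z \<and> \<beta> z \<le> r \<and> - r \<le> Y (\<beta> z, b) \<and> Y (\<beta> z, b) \<le> r \<and> - r \<le> Y (\<beta> z, \<alpha> z) \<and> Y (\<beta> z, \<alpha> z) \<le> r"
        using Yr[of "\<beta> z" b] Yr[of "\<beta> z" "\<alpha> z"] that(3,4)[OF z] that(5) by linarith
    qed
  qed
  have gf: "f (u, Y (u, a)) - f (u, Y (u, b)) = (Y (u, a) - Y (u, b)) * g a b u"
    if "\<bar>u\<bar> \<le> h" "\<bar>a\<bar> \<le> h" "\<bar>b\<bar> \<le> h" for u a b
    unfolding g_def q_def fst_conv snd_conv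
  proof (rule difference_eq_mean_derivative[where r = r])
    show "((\<lambda>y. f (u, y)) has_real_derivative partial_y f (u, y)) (at y)" if "y \<in> {-r..r}" for y
      using r that h \<open>\<bar>u\<bar> \<le> h\<close> by (intro has_real_derivative_partial_y[OF f] subsetD[OF r]) auto
  qed (use Yr that in auto)
  define M where "M a b x = x * integral {0..1} (\<lambda>t. g a b (t * x))" for a b x
  have Md: "(M a b has_real_derivative g a b x) (at x)" if "\<bar>x\<bar> < h" "\<bar>a\<bar> \<le> h" "\<bar>b\<bar> \<le> h" for a b x
    unfolding M_def
    by (rule scaled_integral_has_derivative[OF _ that(1)], rule gc) (use that in \<open>auto intro!: continuous_intros\<close>)
  have key: "Y (x, a) - Y (x, b) = exp (M a b x) * (a - b)" if ab: "\<bar>a\<bar> \<le> h" "\<bar>b\<bar> \<le> h" for a b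
  proof -
    \<comment> \<open>Integrating factor: \<open>P\<close> is constant in \<open>x\<close> and
      equals \<open>a - b\<close> at 0.\<close>
    define P where "P x = (Y (x, a) - Y (x, b)) * exp (- M a b x)" for x
    have "(P has_real_derivative 0) (at u)" if "u \<in> {-h<..<h}" for u
    proof -
      have u: "\<bar>u\<bar> < h" using that by (simp add: abs_less_iff)
      have "(P has_real_derivative (f (u, Y (u, a)) - f (u, Y (u, b))) * exp (- M a b u)
          + exp (- M a b u) * (- g a b u) * (Y (u, a) - Y (u, b))) (at u)"
        unfolding P_def
        by (rule DERIV_mult[OF DERIV_diff[OF Yx[OF u ab(1)] Yx[OF u ab(2)]] DERIV_fun_exp[OF DERIV_minus[OF Md[OF u ab]]]])
      then show ?thesis using gf[OF _ ab, of u] u by (simp add: algebra_simps)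
    qed
    then have "P x = P 0"
      using x h by (intro DERIV_isconst3[of "-h" h]) (auto simp: abs_less_iff)
    also have "P 0 = a - b" using ab by (simp add: P_def M_def Y0)
    finally show ?thesis by (simp add: P_def exp_minus field_simps)
  qed
  show "((\<lambda>a. Y (x, a)) has_real_derivative
           exp (x * integral {0..1} (\<lambda>t. partial_y f (t * x, Y (t * x, b))))) (at b)" if b: "\<bar>b\<bar> < h" for b
  proof -
    have "((\<lambda>a. Y (x, a)) has_real_derivative exp (M b b x)) (at b)"
    proof (rule has_real_derivative_of_factorization[of "{-h<..<h}" b "\<lambda>a. Y (x, a)" "\<lambda>a. exp (M a b x)"])
      have "continuous_on ({-h<..<h} \<times> cbox 0 1) (\<lambda>z. g (fst z) b (snd z * x))"
      proof (rule gc)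
        show "\<bar>snd z * x\<bar> \<le> h" if "z \<in> {-h<..<h} \<times> cbox 0 1" for z
          using scaled_in_interval(1)[of "snd z" x h] that x by auto
      qed (use b in \<open>auto intro!: continuous_intros\<close>)
      then have "continuous_on {-h<..<h} (\<lambda>a. integral (cbox 0 1) (\<lambda>t. g a b (t * x)))"
        by (intro integral_continuous_on_param) (simp add: case_prod_beta)
      then show "continuous_on {-h<..<h} (\<lambda>a. exp (M a b x))"
        unfolding M_def by (intro continuous_intros) simp
    qed (use key b in \<open>auto simp: abs_less_iff abs_le_iff\<close>)
    moreover have "g b b u = partial_y f (u, Y (u, b))" for u
      by (simp add: g_def q_def)
    ultimately show ?thesis by (simp add: M_def)
  qed
qed

text \<open>Continuity is asked of the \<open>y\<close>-derivative, which for the flow is an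
  explicit exponential; the \<open>x\<close>-derivative enters at the single point
  \<open>p\<close>.\<close>

lemma has_derivative_from_partials:
  fixes Y :: "real \<times> real \<Rightarrow> real"
  assumes S: "open I" "open J" "convex J" "p \<in> I \<times> J"
    and x: "((\<lambda>x. Y (x, snd p)) has_real_derivative A) (at (fst p))"
    and y: "\<And>x y. x \<in> I \<Longrightarrow> y \<in> J \<Longrightarrow> ((\<lambda>y. Y (x, y)) has_real_derivative E (x, y)) (at y)"
    and E: "continuous_on (I \<times> J) E"
  shows "(Y has_derivative (\<lambda>v. fst v *\<^sub>R A + snd v *\<^sub>R E p)) (at p)"
proof -
  obtain u v where p: "p = (u, v)" by force
  have IJ: "open (I \<times> J)" using S by (intro open_Times)
  have "((\<lambda>(x, y). Y (x, y)) has_derivative (\<lambda>(tx, ty). A * tx + blinfun_mult_right (E (u, v)) ty)) (at (u, v) within I \<times> J)"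
  proof (rule has_derivative_partialsI[where fy = "\<lambda>x y. blinfun_mult_right (E (x, y))"])
    show "((\<lambda>x. Y (x, v)) has_derivative (\<lambda>t. A * t)) (at u within I)"
      using x has_derivative_at_withinI unfolding p by (fastforce simp: has_field_derivative_def)
    show "((\<lambda>y. Y (x, y)) has_derivative blinfun_apply (blinfun_mult_right (E (x, y)))) (at y within J)"
      if "x \<in> I" "y \<in> J" for x y
      using y[OF that] has_derivative_at_withinI by (fastforce simp: has_field_derivative_def)
    have "continuous_on (I \<times> J) (\<lambda>z. blinfun_mult_right (E z))"
      by (rule bounded_linear.continuous_on[OF bounded_linear_blinfun_mult_right E])
    then have "continuous (at (u, v) within I \<times> J) (\<lambda>z. blinfun_mult_right (E z))"
      using S(4) p continuous_on_eq_continuous_within by blast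
    then show "continuous (at (u, v) within I \<times> J) (\<lambda>(x, y). blinfun_mult_right (E (x, y)))"
      by (simp add: case_prod_beta')
  qed (use S p in auto)
  then have "((\<lambda>(x, y). Y (x, y)) has_derivative (\<lambda>(tx, ty). A * tx + blinfun_mult_right (E (u, v)) ty)) (at p)"
    using at_within_open[OF S(4) IJ] p by simp
  then show ?thesis
    by (simp add: case_prod_beta' p mult.commute)
qed

text \<open>Both partial derivatives of \<open>Y\<close> are expressed through \<open>Y\<close>
  without loss of order: one is \<open>f (x, Y)\<close>, the other the exponential \<open>E\<close>.
  Order \<open>k\<close> of \<open>Y\<close> passes to both of them and gives order
  \<open>k + 1\<close>. An exponential has no zeros, which yields the last clause.\<close>

lemma smooth_ode_flow:
  fixes f :: "real \<times> real \<Rightarrow> real"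
  assumes r: "r > 0" "{-r..r} \<times> {-r..r} \<subseteq> W" and f: "smooth_on W f"
  obtains h Y where "0 < h" "smooth_on (square h) Y" "Y (0, 0) = 0"
    "\<And>p. p \<in> square h \<Longrightarrow> (fst p, Y p) \<in> W"
    "\<And>p. p \<in> square h \<Longrightarrow> partial_x Y p = f (fst p, Y p)"
    "\<And>p. p \<in> square h \<Longrightarrow> partial_y Y p \<noteq> 0"
proof -
  obtain h Y where h: "0 < h" "h \<le> r" and Yc: "continuous_on UNIV Y"
    and Y: "\<And>x a. \<bar>x\<bar> \<le> h \<Longrightarrow> \<bar>a\<bar> \<le> h \<Longrightarrow>
       \<bar>Y (x, a)\<bar> \<le> r \<and> Y (x, a) = a + x * integral {0..1} (\<lambda>t. f (t * x, Y (t * x, a)))"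
    using scaled_ode_exists[OF r f] by blast
  have sq: "open (square h)" by (intro open_Times) auto
  have inW: "(fst p, Y p) \<in> W" if "p \<in> square h" for p
  proof -
    have "\<bar>fst p\<bar> \<le> h" "\<bar>snd p\<bar> \<le> h" using that by (auto simp: abs_le_iff)
    from conjunct1[OF Y[OF this]] this(1) h have "(fst p, Y p) \<in> {-r..r} \<times> {-r..r}" by (simp add: abs_le_iff)
    then show ?thesis using r by blast
  qed
  define G where "G p = partial_y f (fst p, Y p)" for p
  \<comment> \<open>The factor 1 is the weight of the scaled integral.\<close>
  define E where "E p = exp (fst p * integral {0..1} (\<lambda>t. 1 * G (t * fst p, snd p)))" for p
  have dE: "differentiable_times_on k (square h) E" if k: "differentiable_times_on k (square h) Y" for k
  proof -
    have "differentiable_times_on k (square h) G"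
      unfolding G_def
      by (rule differentiable_times_on_compose[OF sq smooth_onD[OF smooth_on_partial_y[OF f]]])
        (use inW in \<open>auto intro!: differentiable_times_on_intros sq k\<close>)
    then have "differentiable_times_on k (square h) (\<lambda>p. fst p * integral {0..1} (\<lambda>t. 1 * G (t * fst p, snd p)))"
      by (intro differentiable_times_on_mult differentiable_times_on_fst differentiable_times_on_ident
          differentiable_times_on_scaled_integral sq) auto
    then show ?thesis
      unfolding E_def
      by (intro differentiable_times_on_compose[OF sq smooth_onD[OF smooth_on_exp_real]]) auto
  qed
  have Yd: "(Y has_derivative (\<lambda>v. fst v *\<^sub>R f (fst p, Y p) + snd v *\<^sub>R E p)) (at p)" if p: "p \<in> square h" for p
  proof (rule has_derivative_from_partials[OF _ _ _ p])
    show "continuous_on (square h) E"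
      using dE[of 0] continuous_on_subset[OF Yc] by simp
    show "((\<lambda>x. Y (x, snd p)) has_real_derivative f (fst p, Y p)) (at (fst p))"
      using scaled_ode_derivatives(1)[OF r(2) f h Yc Y, of "fst p" "snd p"] p by auto
    show "((\<lambda>y. Y (x, y)) has_real_derivative E (x, y)) (at y)" if "x \<in> {-h<..<h}" "y \<in> {-h<..<h}" for x y
      using scaled_ode_derivatives(2)[OF r(2) f h Yc Y, of x y] that by (auto simp: E_def G_def)
  qed auto
  have "differentiable_times_on k (square h) Y" for k
  proof (induction k)
    case 0
    then show ?case using continuous_on_subset[OF Yc] by simp
  next
    case (Suc k)
    have "differentiable_times_on k (square h) (\<lambda>p. f (fst p, Y p))"
      by (rule differentiable_times_on_compose[OF sq smooth_onD[OF f]])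
        (use inW in \<open>auto intro!: differentiable_times_on_intros sq Suc\<close>)
    from differentiable_times_on_SucI_plane[OF sq Yd this dE[OF Suc]] show ?case .
  qed
  then have "smooth_on (square h) Y" by (simp add: smooth_on_def)
  moreover have "partial_x Y p = f (fst p, Y p)" "partial_y Y p = E p" if "p \<in> square h" for p
    using frechet_derivative_at[OF Yd[OF that], symmetric] by (auto simp: partial_x_def partial_y_def)
  moreover have "Y (0, 0) = 0" using conjunct2[OF Y[of 0 0]] h by simp
  ultimately show thesis using that[of h Y] h(1) inW by (simp add: E_def)
qed

text \<open>The map \<open>F (x, a) = (x, Y (x, a))\<close> straightens the solution curves and is
  locally invertible because \<open>Y_a \<noteq> 0\<close>. The second component \<open>u\<close> of
  its inverse is the initial value of the solution through a point, hence constant along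
  solutions.\<close>

lemma first_integral_at_origin:
  fixes f :: "real \<times> real \<Rightarrow> real"
  assumes W: "open W" "0 \<in> W" and f: "smooth_on W f"
  obtains V and u :: "real \<times> real \<Rightarrow> real" where "open V" "0 \<in> V" "V \<subseteq> W" "smooth_on V u"
    "\<And>p. p \<in> V \<Longrightarrow> deriv_at u p (1, f p) = 0"
    "\<And>p. p \<in> V \<Longrightarrow> deriv_at u p (0, 1) \<noteq> 0"
proof -
  obtain e where e: "e > 0" "ball 0 e \<subseteq> W" using W open_contains_ball by blast
  \<comment> \<open>On this square \<open>|x| + |y| \<le> 2 e / 3 < e\<close>.\<close>
  have r: "{-(e/3)..e/3} \<times> {-(e/3)..e/3} \<subseteq> W"
  proof
    fix p assume p: "p \<in> {-(e/3)..e/3} \<times> {-(e/3)..e/3}"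
    have "norm p \<le> \<bar>fst p\<bar> + \<bar>snd p\<bar>"
      unfolding norm_prod_def using sqrt_sum_squares_le_sum_abs[of "fst p" "snd p"] by simp
    then have "p \<in> ball 0 e" using p e(1) by (auto simp: abs_le_iff)
    then show "p \<in> W" using e(2) by blast
  qed
  obtain h Y where h: "0 < h" and Y: "smooth_on (square h) Y" "Y (0, 0) = 0"
    and inW: "\<And>p. p \<in> square h \<Longrightarrow> (fst p, Y p) \<in> W"
    and Yx: "\<And>p. p \<in> square h \<Longrightarrow> partial_x Y p = f (fst p, Y p)"
    and Yy: "\<And>p. p \<in> square h \<Longrightarrow> partial_y Y p \<noteq> 0"
    using smooth_ode_flow[OF _ r f] e(1) by auto
  have sq: "open (square h)" "0 \<in> square h" using h by (auto intro: open_Times simp: zero_prod_def)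
  define F where "F p = (fst p, Y p)" for p
  have F: "smooth_on (square h) F"
    unfolding smooth_on_def F_def by (intro allI differentiable_times_on_intros sq smooth_onD Y)
  have Fd: "(F has_derivative (\<lambda>v. (fst v, fst v *\<^sub>R partial_x Y p + snd v *\<^sub>R partial_y Y p))) (at p)"
    if "p \<in> square h" for p
    unfolding F_def
    using smooth_on_has_derivative_plane[OF Y(1) that] by (auto intro!: derivative_eq_intros)
  have Fxy: "partial_x F p = (1, partial_x Y p)" "partial_y F p = (0, partial_y Y p)" if "p \<in> square h" for p
    using frechet_derivative_at[OF Fd[OF that], symmetric] by (auto simp: partial_x_def partial_y_def)
  obtain U V g where U: "open U" "U \<subseteq> square h" "0 \<in> U" and V: "open V" "F 0 \<in> V"
    and hom: "homeomorphism U V F g" and g: "smooth_on V g"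
    using smooth_local_inverse_plane[OF sq(1) F sq(2)] Fxy[OF sq(2)] Yy[OF sq(2)] by auto
  define u where "u z = snd (g z)" for z
  have u: "smooth_on V u"
    unfolding u_def by (rule smooth_on_bounded_linear_compose[OF V(1) bounded_linear_snd g])
  have VW: "V \<subseteq> W"
  proof
    fix z assume "z \<in> V"
    then obtain p where "p \<in> U" "z = F p" using hom by (auto simp: homeomorphism_def)
    then show "z \<in> W" using U(2) inW by (auto simp: F_def)
  qed
  have "deriv_at u z (1, f z) = 0 \<and> deriv_at u z (0, 1) \<noteq> 0" if z: "z \<in> V" for z
  proof -
    obtain p where p: "p \<in> U" "z = F p" using hom z by (auto simp: homeomorphism_def)
    have ps: "p \<in> square h" using p U by blast
    \<comment> \<open>Differentiating \<open>u (F p) = snd p\<close> in the directions (1, 0) and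
      (0, 1) gives the two claims.\<close>
    have "((\<lambda>p. u (F p)) has_derivative (\<lambda>v. deriv_at u z (fst v, fst v *\<^sub>R partial_x Y p + snd v *\<^sub>R partial_y Y p))) (at p)"
      using has_derivative_compose[OF Fd[OF ps]] smooth_on_has_derivative[OF u z] p(2) by simp
    moreover have "((\<lambda>p. u (F p)) has_derivative snd) (at p)"
    proof (rule has_derivative_transform_within_open[OF _ U(1) p(1)])
      show "(snd has_derivative snd) (at p)" by (simp add: bounded_linear_imp_has_derivative bounded_linear_snd)
    qed (use hom in \<open>auto simp: u_def homeomorphism_def\<close>)
    ultimately have eq: "(\<lambda>v. deriv_at u z (fst v, fst v *\<^sub>R partial_x Y p + snd v *\<^sub>R partial_y Y p)) = snd"
      by (rule has_derivative_unique)
    have lin: "linear (deriv_at u z)"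
      using has_derivative_linear[OF smooth_on_has_derivative[OF u z]] .
    have "deriv_at u z (1, f z) = 0"
      using fun_cong[OF eq, of "(1, 0)"] Yx[OF ps] by (simp add: p(2) F_def)
    moreover have "deriv_at u z (0, partial_y Y p) = 1"
      using fun_cong[OF eq, of "(0, 1)"] by simp
    then have "partial_y Y p *\<^sub>R deriv_at u z (0, 1) = 1"
      using linear_cmul[OF lin, of "partial_y Y p" "(0, 1)"] by simp
    ultimately show ?thesis by auto
  qed
  moreover have "0 \<in> V" using V(2) Y(2) by (simp add: F_def zero_prod_def)
  ultimately show thesis using that[of V u] V(1) VW u by blast
qed

text \<open>In the coordinates \<open>p = q + L z\<close> the field \<open>v + m w\<close> becomes
  \<open>(1, m)\<close>, whose integral curves are graphs. This reduces an arbitrary basis to the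
  scalar equation at the origin.\<close>

lemma first_integral_in_basis:
  fixes m :: "real \<times> real \<Rightarrow> real" and v w q :: "real \<times> real"
  assumes W: "open W" "q \<in> W" and m: "smooth_on W m"
    and basis: "fst v * snd w - snd v * fst w \<noteq> 0"
  obtains V and u :: "real \<times> real \<Rightarrow> real" where "open V" "q \<in> V" "V \<subseteq> W" "smooth_on V u"
    "\<And>p. p \<in> V \<Longrightarrow> deriv_at u p (v + m p *\<^sub>R w) = 0"
    "\<And>p. p \<in> V \<Longrightarrow> deriv_at u p w \<noteq> 0"
proof -
  define L where "L z = fst z *\<^sub>R v + snd z *\<^sub>R w" for z :: "real \<times> real"
  define j where "j = fst v * snd w - snd v * fst w"
  define K where "K z = ((snd w * fst z - fst w * snd z) / j, (fst v * snd z - snd v * fst z) / j)" for z :: "real \<times> real"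
  have L: "bounded_linear L" unfolding L_def
    by (auto intro!: bounded_linear_add bounded_linear_scaleR_const bounded_linear_fst bounded_linear_snd)
  have K: "bounded_linear K" unfolding K_def
    by (auto intro!: bounded_linear_Pair bounded_linear_divide[THEN bounded_linear_compose] bounded_linear_sub
        bounded_linear_const_mult bounded_linear_fst bounded_linear_snd)
  have inv: "inv L = K"
    using linear_plane_inverse[of "fst v" "snd w" "snd v" "fst w"] basis
    by (simp add: L_def[abs_def] K_def[abs_def] j_def)
  have "fst (K (L z)) = fst z" "snd (K (L z)) = snd z" for z
    using basis by (auto simp: K_def L_def j_def divide_simps) (auto simp: algebra_simps)
  then have KL: "K (L z) = z" for z by (simp add: prod_eq_iff)
  have "surj L" using linear_injective_imp_surjective[OF bounded_linear.linear[OF L]] KL by (metis injI)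
  then have LK: "L (K z) = z" for z using surj_f_inv_f[of L z] by (simp add: inv)
  define W' where "W' = (\<lambda>z. q + L z) -` W"
  have cL: "continuous_on UNIV (\<lambda>z. q + L z)" by (intro continuous_intros linear_continuous_on L)
  have W': "open W'" "0 \<in> W'"
    using open_vimage[OF W(1) cL] W(2) linear_0[OF bounded_linear.linear[OF L]] by (auto simp: W'_def)
  have sL: "smooth_on S (\<lambda>z. q + L z)" if "open S" for S
    unfolding smooth_on_def
    by (intro allI differentiable_times_on_add differentiable_times_on_const differentiable_times_on_bounded_linear L that)
  have mL: "smooth_on W' (\<lambda>z. m (q + L z))"
    by (rule smooth_on_compose[OF W'(1) m sL[OF W'(1)]]) (auto simp: W'_def)
  obtain V' and u' :: "real \<times> real \<Rightarrow> real" where V': "open V'" "0 \<in> V'" "V' \<subseteq> W'" and u': "smooth_on V' u'"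
    and u'1: "\<And>p. p \<in> V' \<Longrightarrow> deriv_at u' p (1, m (q + L p)) = 0"
    and u'2: "\<And>p. p \<in> V' \<Longrightarrow> deriv_at u' p (0, 1) \<noteq> 0"
    using first_integral_at_origin[OF W' mL] by blast
  define k where "k z = K (z - q)" for z
  define V where "V = k -` V'"
  define u where "u z = u' (k z)" for z
  have ck: "continuous_on UNIV k"
    unfolding k_def by (intro bounded_linear.continuous_on[OF K] continuous_intros)
  have V: "open V" "q \<in> V"
    using open_vimage[OF V'(1) ck] V'(2) linear_0[OF bounded_linear.linear[OF K]] by (auto simp: V_def k_def)
  have VW: "V \<subseteq> W"
  proof
    fix z assume "z \<in> V"
    then have "q + L (K (z - q)) \<in> W" using V'(3) by (auto simp: V_def W'_def k_def)
    then show "z \<in> W" by (simp add: LK)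
  qed
  have kd: "(k has_derivative K) (at z)" for z
    unfolding k_def by (rule bounded_linear.has_derivative[OF K]) (auto intro!: derivative_eq_intros)
  have "smooth_on V (\<lambda>z. K (z - q))"
    unfolding smooth_on_def
    by (intro allI differentiable_times_on_compose_bounded_linear[OF V(1) K] differentiable_times_on_diff
        differentiable_times_on_const differentiable_times_on_ident V(1))
  then have "smooth_on V k" by (simp add: k_def[abs_def])
  then have "smooth_on V u"
    unfolding u_def by (intro smooth_on_compose[OF V(1) u']) (auto simp: V_def)
  moreover have "deriv_at u p h = deriv_at u' (k p) (K h)" if "p \<in> V" for p h
  proof -
    have "(u has_derivative (\<lambda>h. deriv_at u' (k p) (K h))) (at p)"
      unfolding u_def
      by (rule has_derivative_compose[OF kd]) (rule smooth_on_has_derivative[OF u'], use that V_def in auto)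
    from frechet_derivative_at[OF this] show ?thesis by metis
  qed
  moreover have "K (v + c *\<^sub>R w) = (1, c)" "K w = (0, 1)" for c
    using KL[of "(1, c)"] KL[of "(0, 1)"] by (auto simp: L_def)
  moreover have "deriv_at u' (k p) (1, m p) = 0" if "p \<in> V" for p
    using u'1[of "k p"] that by (simp add: V_def k_def LK)
  moreover have "k p \<in> V'" if "p \<in> V" for p using that by (simp add: V_def)
  ultimately show thesis by (intro that[of V u] V VW) (simp_all add: u'2)
qed

subsection \<open>The representation formula\<close>

lemma frechet_derivative_bounded_linear_compose:
  assumes "smooth_on S f" "p \<in> S" "bounded_linear L"
  shows "deriv_at (\<lambda>q. L (f q)) p = (\<lambda>h. L (deriv_at f p h))"
  using frechet_derivative_at[OF bounded_linear.has_derivative[OF assms(3) smooth_on_has_derivative[OF assms(1,2)]]]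
  by simp

lemma has_derivative_vector_3:
  fixes f g k :: "'a::real_normed_vector \<Rightarrow> real"
  assumes "(f has_derivative f') F" "(g has_derivative g') F" "(k has_derivative k') F"
  shows "((\<lambda>p. vector [f p, g p, k p] :: real^3) has_derivative (\<lambda>h. vector [f' h, g' h, k' h])) F"
  unfolding vector_3_eq_axis
  by (intro has_derivative_add has_derivative_scaleR_left assms)

lemma inner_3: "x \<bullet> y = x$1 * y$1 + x$2 * y$2 + x$3 * y$3" for x y :: "real^3"
  by (simp add: inner_vec_def sum_3)

lemma B_fun_pos: "B_fun \<kappa> s p > 0"
  unfolding B_fun_def by (simp add: add_nonneg_pos)

lemma B_fun_has_derivative:
  assumes "(\<kappa> has_derivative \<kappa>') (at p)" "(s has_derivative s') (at p)"
  shows "(B_fun \<kappa> s has_derivative (\<lambda>h. \<kappa> p * \<kappa>' h + s p * s' h)) (at p)"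
proof -
  have "((\<lambda>p. (\<kappa> p * \<kappa> p + s p * s p + 1) / 2) has_derivative (\<lambda>h. \<kappa> p * \<kappa>' h + s p * s' h)) (at p)"
    using assms by (auto intro!: derivative_eq_intros simp: algebra_simps)
  then show ?thesis by (simp add: B_fun_def[abs_def] power2_eq_square)
qed

lemma normal_vector_has_derivative:
  assumes k: "(\<kappa> has_derivative \<kappa>') (at p)" and s: "(s has_derivative s') (at p)"
  defines "B \<equiv> B_fun \<kappa> s p" and "b \<equiv> \<lambda>h. \<kappa> p * \<kappa>' h + s p * s' h"
  shows "(normal_vector \<kappa> s has_derivative (\<lambda>h. vector [(\<kappa>' h * B - \<kappa> p * b h) / (B * B),
           (s' h * B - s p * b h) / (B * B), - b h / (B * B)])) (at p)"
proof -
  have B: "(B_fun \<kappa> s has_derivative b) (at p)" unfolding b_def by (rule B_fun_has_derivative[OF k s])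
  have nz: "B_fun \<kappa> s p \<noteq> 0" using B_fun_pos[of \<kappa> s p] by simp
  have "((\<lambda>p. 1 / B_fun \<kappa> s p - 1) has_derivative (\<lambda>h. - b h / (B * B))) (at p)"
    using has_derivative_diff[OF has_derivative_divide'[OF has_derivative_const[of 1] B nz] has_derivative_const[of 1]]
    by (simp add: B_def)
  then show ?thesis
    unfolding normal_vector_def
    by (intro has_derivative_vector_3)
      (use has_derivative_divide'[OF k B nz] has_derivative_divide'[OF s B nz] in \<open>simp_all add: B_def\<close>)
qed

lemma smooth_on_B_fun: "open U \<Longrightarrow> smooth_on U \<kappa> \<Longrightarrow> smooth_on U s \<Longrightarrow> smooth_on U (B_fun \<kappa> s)"
  unfolding smooth_on_def B_fun_def[abs_def]
  by (intro allI differentiable_times_on_intros) auto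

lemma smooth_on_normal_vector:
  assumes "open U" "smooth_on U \<kappa>" "smooth_on U s"
  shows "smooth_on U (normal_vector \<kappa> s)"
  unfolding smooth_on_def normal_vector_def[abs_def]
  using B_fun_pos[of \<kappa> s]
  by (intro allI differentiable_times_on_intros smooth_onD smooth_on_B_fun assms) (metis less_irrefl)+

lemma smooth_on_radius_vector:
  assumes "open U" "smooth_on U \<kappa>1" "smooth_on U s1" "smooth_on U \<kappa>2" "smooth_on U s2" "smooth_on U A"
  shows "smooth_on U (radius_vector \<kappa>1 s1 \<kappa>2 s2 A)"
  unfolding smooth_on_def radius_vector_def[abs_def]
  using B_fun_pos[of \<kappa>1 s1]
  by (intro allI differentiable_times_on_intros smooth_onD smooth_on_B_fun assms) (metis less_irrefl)+

lemma smooth_on_potential: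
  assumes "open U" "smooth_on U \<kappa>1" "smooth_on U s1" "smooth_on U \<kappa>2" "smooth_on U s2"
    and "is_potential U \<kappa>1 s1 \<kappa>2 s2 A"
  shows "smooth_on U A"
proof (rule smooth_on_smooth_derivative[OF assms(1)])
  show "(A has_derivative (\<lambda>h. \<kappa>1 p * deriv_at \<kappa>2 p h + s1 p * deriv_at s2 p h)) (at p)"
    if "p \<in> U" for p using assms(6) that by (simp add: is_potential_def)
  show "smooth_on U (\<lambda>p. \<kappa>1 p * deriv_at \<kappa>2 p v + s1 p * deriv_at s2 p v)" for v
    unfolding smooth_on_def
    by (intro allI differentiable_times_on_add differentiable_times_on_mult smooth_onD smooth_on_frechet_derivative assms)
qed

lemma norm_normal_vector: "norm (normal_vector \<kappa> s p) = 1"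
proof -
  define B where "B = B_fun \<kappa> s p"
  have B: "B > 0" "\<kappa> p * \<kappa> p + s p * s p + 1 = 2 * B"
    using B_fun_pos[of \<kappa> s p] by (auto simp: B_def B_fun_def power2_eq_square)
  have "(\<kappa> p / B) * (\<kappa> p / B) + (s p / B) * (s p / B) + (1 / B - 1) * (1 / B - 1) =
      (\<kappa> p * \<kappa> p + s p * s p + 1 - 2 * B + B * B) / (B * B)"
    using B(1) by (simp add: field_simps)
  also have "\<dots> = 1" using B by simp
  finally show ?thesis
    unfolding norm_eq_sqrt_inner inner_3 by (simp add: normal_vector_def B_def)
qed

text \<open>\<open>n\<close> is the inverse stereographic projection from (0, 0, -1), conformal with
  factor \<open>1 / B\<close>. The combinations in the fifth and sixth claims project along
  \<open>(\<kappa>, s, 1) = B (n + e3)\<close>; since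
  \<open>d (B (n + e3)) = (d\<kappa>, ds, 0)\<close>, they send \<open>dn\<close> to
  \<open>(d\<kappa>, ds) / B\<close>.\<close>

lemma normal_vector_derivative_components:
  assumes "smooth_on U \<kappa>" "smooth_on U s" "p \<in> U"
  defines "dn \<equiv> deriv_at (normal_vector \<kappa> s) p"
    and "d\<kappa> \<equiv> deriv_at \<kappa> p" and "ds \<equiv> deriv_at s p"
    and "B \<equiv> B_fun \<kappa> s p"
  shows "dn h $ 1 = (d\<kappa> h * B - \<kappa> p * (\<kappa> p * d\<kappa> h + s p * ds h)) / (B * B)"
    and "dn h $ 2 = (ds h * B - s p * (\<kappa> p * d\<kappa> h + s p * ds h)) / (B * B)"
    and "dn h $ 3 = - (\<kappa> p * d\<kappa> h + s p * ds h) / (B * B)"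
    and "dn h \<bullet> dn h' = (d\<kappa> h * d\<kappa> h' + ds h * ds h') / B\<^sup>2"
    and "dn h $ 1 - \<kappa> p * dn h $ 3 = d\<kappa> h / B"
    and "dn h $ 2 - s p * dn h $ 3 = ds h / B"
    and "normal_vector \<kappa> s p \<bullet> dn h = 0"
proof -
  have dn: "dn = (\<lambda>h. vector [(d\<kappa> h * B - \<kappa> p * (\<kappa> p * d\<kappa> h + s p * ds h)) / (B * B),
           (ds h * B - s p * (\<kappa> p * d\<kappa> h + s p * ds h)) / (B * B), - (\<kappa> p * d\<kappa> h + s p * ds h) / (B * B)])"
    unfolding dn_def d\<kappa>_def ds_def B_def
    by (rule frechet_derivative_at[symmetric, OF normal_vector_has_derivative])
      (rule smooth_on_has_derivative[OF assms(1,3)], rule smooth_on_has_derivative[OF assms(2,3)])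
  show 1: "dn h $ 1 = (d\<kappa> h * B - \<kappa> p * (\<kappa> p * d\<kappa> h + s p * ds h)) / (B * B)"
    and 2: "dn h $ 2 = (ds h * B - s p * (\<kappa> p * d\<kappa> h + s p * ds h)) / (B * B)"
    and 3: "dn h $ 3 = - (\<kappa> p * d\<kappa> h + s p * ds h) / (B * B)" for h
    by (simp_all add: dn)
  have B: "B > 0" "\<kappa> p * \<kappa> p + s p * s p + 1 = 2 * B"
    using B_fun_pos[of \<kappa> s p] by (auto simp: B_def B_fun_def power2_eq_square)
  define b where "b h = \<kappa> p * d\<kappa> h + s p * ds h" for h
  \<comment> \<open>A polynomial identity modulo \<open>\<kappa>^2 + s^2 + 1 = 2 B\<close>, with
    \<open>b = dB\<close>.\<close>
  have num: "(d\<kappa> h * B - \<kappa> p * b h) * (d\<kappa> h' * B - \<kappa> p * b h') + (ds h * B - s p * b h) * (ds h' * B - s p * b h')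
      + b h * b h' = (d\<kappa> h * d\<kappa> h' + ds h * ds h') * (B * B)"
    using B(2) b_def[of h] b_def[of h'] by algebra
  have "dn h \<bullet> dn h' = ((d\<kappa> h * B - \<kappa> p * b h) * (d\<kappa> h' * B - \<kappa> p * b h') + (ds h * B - s p * b h) * (ds h' * B - s p * b h')
      + b h * b h') / ((B * B) * (B * B))"
    unfolding inner_3 1 2 3 b_def[symmetric] by (simp add: add_divide_distrib)
  also have "\<dots> = (d\<kappa> h * d\<kappa> h' + ds h * ds h') / B\<^sup>2"
    unfolding num using B(1) by (simp add: power2_eq_square)
  finally show "dn h \<bullet> dn h' = (d\<kappa> h * d\<kappa> h' + ds h * ds h') / B\<^sup>2" .
  show "dn h $ 1 - \<kappa> p * dn h $ 3 = d\<kappa> h / B" "dn h $ 2 - s p * dn h $ 3 = ds h / B"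
    unfolding 1 2 3 using B(1) by (simp_all add: field_simps)
  have "normal_vector \<kappa> s p \<bullet> dn h =
      (\<kappa> p * (d\<kappa> h * B - \<kappa> p * b h) + s p * (ds h * B - s p * b h) - (1 - B) * b h) / (B * B * B)"
    unfolding inner_3 1 2 3 b_def[symmetric] normal_vector_def B_def[symmetric]
    using B(1) by (simp add: field_simps)
  also have "\<kappa> p * (d\<kappa> h * B - \<kappa> p * b h) + s p * (ds h * B - s p * b h) - (1 - B) * b h = 0"
    using B(2) b_def[of h] by algebra
  finally show "normal_vector \<kappa> s p \<bullet> dn h = 0" by simp
qed

text \<open>One has \<open>dr = (d\<kappa>2, ds2, 0) - dA (n + e3) - A dn\<close> and
  \<open>(d\<kappa>1, ds1, 0) = dB (n + e3) + B dn\<close>. Along \<open>h\<close> the potential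
  condition reads \<open>dA = l dB\<close>, so the terms in \<open>n + e3\<close> cancel.\<close>

lemma radius_vector_directional_derivative:
  assumes sm: "smooth_on U \<kappa>1" "smooth_on U s1" "smooth_on U \<kappa>2" "smooth_on U s2"
    and pot: "is_potential U \<kappa>1 s1 \<kappa>2 s2 A" and p: "p \<in> U"
    and l: "deriv_at \<kappa>2 p h = l * deriv_at \<kappa>1 p h"
      "deriv_at s2 p h = l * deriv_at s1 p h"
  shows "deriv_at (radius_vector \<kappa>1 s1 \<kappa>2 s2 A) p h =
    (l * B_fun \<kappa>1 s1 p - A p) *\<^sub>R deriv_at (normal_vector \<kappa>1 s1) p h"
proof -
  note d = smooth_on_has_derivative[OF _ p]
  define dk ds where "dk = deriv_at \<kappa>1 p" and "ds = deriv_at s1 p"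
  define dA where "dA h = \<kappa>1 p * deriv_at \<kappa>2 p h + s1 p * deriv_at s2 p h" for h
  define b where "b h = \<kappa>1 p * dk h + s1 p * ds h" for h
  define B where "B = B_fun \<kappa>1 s1 p"
  have B: "B \<noteq> 0" using B_fun_pos[of \<kappa>1 s1 p] by (simp add: B_def)
  have dA: "(A has_derivative dA) (at p)" using pot p by (simp add: is_potential_def dA_def[abs_def])
  have dB: "(B_fun \<kappa>1 s1 has_derivative b) (at p)"
    unfolding b_def dk_def ds_def by (rule B_fun_has_derivative[OF d[OF sm(1)] d[OF sm(2)]])
  have nz: "B_fun \<kappa>1 s1 p \<noteq> 0" using B by (simp add: B_def)
  have "(radius_vector \<kappa>1 s1 \<kappa>2 s2 A has_derivative (\<lambda>h. vector
     [deriv_at \<kappa>2 p h - ((\<kappa>1 p * dA h + dk h * A p) * B - \<kappa>1 p * A p * b h) / (B * B),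
      deriv_at s2 p h - ((s1 p * dA h + ds h * A p) * B - s1 p * A p * b h) / (B * B),
      ((- dA h) * B - (- A p) * b h) / (B * B)])) (at p)"
    unfolding radius_vector_def B_def
    by (intro has_derivative_vector_3 has_derivative_diff d sm has_derivative_divide'[OF _ dB nz]
        has_derivative_minus[OF dA] has_derivative_mult[OF d[OF sm(1), folded dk_def] dA] has_derivative_mult[OF d[OF sm(2), folded ds_def] dA])
  from fun_cong[OF frechet_derivative_at[OF this], of h]
  have r: "deriv_at (radius_vector \<kappa>1 s1 \<kappa>2 s2 A) p h = vector
     [l * dk h - ((\<kappa>1 p * dA h + dk h * A p) * B - \<kappa>1 p * A p * b h) / (B * B),
      l * ds h - ((s1 p * dA h + ds h * A p) * B - s1 p * A p * b h) / (B * B),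
      ((- dA h) * B - (- A p) * b h) / (B * B)]"
    unfolding l dk_def ds_def by (rule sym)
  have dAh: "dA h = l * b h" using l by (simp add: dA_def b_def dk_def ds_def algebra_simps)
  note n = normal_vector_derivative_components(1-3)[OF sm(1,2) p, of h, folded dk_def ds_def B_def b_def]
  show ?thesis
    unfolding r vec_eq_iff forall_3 B_def[symmetric] vector_scaleR_component n dAh
    using B by (simp add: field_simps b_def)
qed

lemma immersion_at_iff_orthogonal:
  fixes f :: "real \<times> real \<Rightarrow> real^3"
  assumes "smooth_on S f" "p \<in> S" "partial_x f p \<bullet> partial_y f p = 0"
  shows "immersion_at f p \<longleftrightarrow> partial_x f p \<noteq> 0 \<and> partial_y f p \<noteq> 0"
proof -
  note d = smooth_on_has_derivative[OF assms(1,2)]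
  have lin: "linear (deriv_at f p)" using has_derivative_linear[OF d] .
  have "inj (deriv_at f p) \<longleftrightarrow> partial_x f p \<noteq> 0 \<and> partial_y f p \<noteq> 0"
  proof
    assume "inj (deriv_at f p)"
    then show "partial_x f p \<noteq> 0 \<and> partial_y f p \<noteq> 0"
      using linear_injective_0[OF lin] unfolding partial_x_def partial_y_def
      by (metis Pair_inject zero_neq_one zero_prod_def)
  next
    assume nz: "partial_x f p \<noteq> 0 \<and> partial_y f p \<noteq> 0"
    show "inj (deriv_at f p)"
      unfolding linear_injective_0[OF lin]
    proof (intro allI impI)
      fix h assume "deriv_at f p h = 0"
      then have z: "fst h *\<^sub>R partial_x f p + snd h *\<^sub>R partial_y f p = 0"
        using frechet_derivative_plane[OF assms(1,2)] by metis
      have "(fst h *\<^sub>R partial_x f p + snd h *\<^sub>R partial_y f p) \<bullet> partial_x f p = fst h * (partial_x f p \<bullet> partial_x f p)"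
        "(fst h *\<^sub>R partial_x f p + snd h *\<^sub>R partial_y f p) \<bullet> partial_y f p = snd h * (partial_y f p \<bullet> partial_y f p)"
        using assms(3) by (simp_all add: inner_add_left inner_commute[of "partial_y f p" "partial_x f p"])
      then show "h = 0" using nz z by (simp add: prod_eq_iff)
    qed
  qed
  moreover have "f differentiable (at p)" using d by (auto simp: differentiable_def)
  ultimately show ?thesis by (simp add: immersion_at_def)
qed

text \<open>Differentiating \<open>n \<bullet> dr u = 0\<close> in the direction \<open>v\<close>
  moves the second derivative of \<open>r\<close> onto \<open>n\<close>.\<close>

lemma second_form_eq:
  assumes U: "open U" and r: "smooth_on U r" and n: "smooth_on U n" and p: "p \<in> U"
    and orth: "\<And>q h. q \<in> U \<Longrightarrow> n q \<bullet> deriv_at r q h = 0"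
  shows "second_form r n p u v = - (deriv_at r p u \<bullet> deriv_at n p v)"
proof -
  let ?ru = "\<lambda>q. deriv_at r q u"
  have "((\<lambda>q. ?ru q \<bullet> n q) has_derivative
      (\<lambda>v. ?ru p \<bullet> deriv_at n p v + deriv_at ?ru p v \<bullet> n p)) (at p)"
    by (intro has_derivative_inner smooth_on_has_derivative[OF _ p] smooth_on_frechet_derivative r n)
  moreover have "((\<lambda>q. ?ru q \<bullet> n q) has_derivative (\<lambda>v. 0)) (at p)"
    by (rule has_derivative_transform_within_open[OF has_derivative_const U p])
      (use orth in \<open>simp add: inner_commute\<close>)
  ultimately have "(\<lambda>v. ?ru p \<bullet> deriv_at n p v + deriv_at ?ru p v \<bullet> n p) = (\<lambda>v. 0)"
    by (rule has_derivative_unique)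
  from fun_cong[OF this, of v] show ?thesis by (simp add: second_form_def)
qed

lemma frechet_derivative_eq_partials:
  "deriv_at f p (1, 0) = partial_x f p" "deriv_at f p (0, 1) = partial_y f p"
  by (simp_all add: partial_x_def partial_y_def)

text \<open>For both solutions the system makes \<open>(\<kappa>_x, s_x)\<close> a multiple of
  \<open>(tan \<phi>, 1)\<close> and \<open>(\<kappa>_y, s_y)\<close> a multiple of
  \<open>(- cot \<phi>, 1)\<close>, so the factor of proportionality is the quotient of the
  derivatives of \<open>s2\<close> and \<open>s1\<close>.\<close>

lemma representation_weingarten:
  assumes S1: "solves_system U \<phi> \<kappa>1 s1" and S2: "solves_system U \<phi> \<kappa>2 s2"
    and pot: "is_potential U \<kappa>1 s1 \<kappa>2 s2 A" and p: "p \<in> U"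
    and nz: "partial_x s1 p \<noteq> 0" "partial_y s1 p \<noteq> 0"
  shows "partial_x (radius_vector \<kappa>1 s1 \<kappa>2 s2 A) p =
      (partial_x s2 p / partial_x s1 p * B_fun \<kappa>1 s1 p - A p) *\<^sub>R partial_x (normal_vector \<kappa>1 s1) p"
    and "partial_y (radius_vector \<kappa>1 s1 \<kappa>2 s2 A) p =
      (partial_y s2 p / partial_y s1 p * B_fun \<kappa>1 s1 p - A p) *\<^sub>R partial_y (normal_vector \<kappa>1 s1) p"
proof -
  note sm = S1[unfolded solves_system_def, THEN conjunct1] S1[unfolded solves_system_def, THEN conjunct2, THEN conjunct1]
    S2[unfolded solves_system_def, THEN conjunct1] S2[unfolded solves_system_def, THEN conjunct2, THEN conjunct1]
  have e: "partial_x \<kappa>1 p = tan (\<phi> p) * partial_x s1 p" "partial_y \<kappa>1 p = - cot (\<phi> p) * partial_y s1 p"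
    "partial_x \<kappa>2 p = tan (\<phi> p) * partial_x s2 p" "partial_y \<kappa>2 p = - cot (\<phi> p) * partial_y s2 p"
    using S1 S2 p by (auto simp: solves_system_def)
  show "partial_x (radius_vector \<kappa>1 s1 \<kappa>2 s2 A) p =
      (partial_x s2 p / partial_x s1 p * B_fun \<kappa>1 s1 p - A p) *\<^sub>R partial_x (normal_vector \<kappa>1 s1) p"
    using radius_vector_directional_derivative[OF sm pot p, of "(1, 0)" "partial_x s2 p / partial_x s1 p"] nz e
    by (simp add: frechet_derivative_eq_partials)
  show "partial_y (radius_vector \<kappa>1 s1 \<kappa>2 s2 A) p =
      (partial_y s2 p / partial_y s1 p * B_fun \<kappa>1 s1 p - A p) *\<^sub>R partial_y (normal_vector \<kappa>1 s1) p"
    using radius_vector_directional_derivative[OF sm pot p, of "(0, 1)" "partial_y s2 p / partial_y s1 p"] nz e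
    by (simp add: frechet_derivative_eq_partials)
qed

text \<open>The vectors \<open>(tan \<phi>, 1)\<close> and \<open>(- cot \<phi>, 1)\<close> are
  orthogonal with squared lengths \<open>1 / cos^2 \<phi>\<close> and
  \<open>1 / sin^2 \<phi>\<close>; this accounts for the coefficients and for the absence of a mixed
  term.\<close>

lemma third_form_representation:
  assumes S1: "solves_system U \<phi> \<kappa> s" and p: "p \<in> U" and trig: "sin (\<phi> p) * cos (\<phi> p) \<noteq> 0"
  shows "third_form (normal_vector \<kappa> s) p (dx, dy) (dx, dy) =
      ((deriv_at \<kappa> p (dx, dy))\<^sup>2 + (deriv_at s p (dx, dy))\<^sup>2) / (B_fun \<kappa> s p)\<^sup>2"
    and "third_form (normal_vector \<kappa> s) p (dx, dy) (dx, dy) =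
      (partial_x s p / B_fun \<kappa> s p)\<^sup>2 * (dx\<^sup>2 / (cos (\<phi> p))\<^sup>2) +
      (partial_y s p / B_fun \<kappa> s p)\<^sup>2 * (dy\<^sup>2 / (sin (\<phi> p))\<^sup>2)"
    and "partial_x (normal_vector \<kappa> s) p \<bullet> partial_y (normal_vector \<kappa> s) p = 0"
proof -
  have sm: "smooth_on U \<kappa>" "smooth_on U s" and e: "partial_x \<kappa> p = tan (\<phi> p) * partial_x s p" "partial_y \<kappa> p = - cot (\<phi> p) * partial_y s p"
    using S1 p by (auto simp: solves_system_def)
  define B where "B = B_fun \<kappa> s p"
  have B: "B \<noteq> 0" using B_fun_pos[of \<kappa> s p] by (simp add: B_def)
  define c where "c = cos (\<phi> p)"
  define \<sigma> where "\<sigma> = sin (\<phi> p)"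
  have cs: "c \<noteq> 0" "\<sigma> \<noteq> 0" "c * c + \<sigma> * \<sigma> = 1"
    using trig sin_cos_squared_add2[of "\<phi> p"] by (auto simp: c_def \<sigma>_def power2_eq_square)
  have tc: "tan (\<phi> p) = \<sigma> / c" "cot (\<phi> p) = c / \<sigma>" by (simp_all add: tan_def cot_def c_def \<sigma>_def)
  note comp = normal_vector_derivative_components(4)[OF sm p, folded B_def]
  show 1: "third_form (normal_vector \<kappa> s) p (dx, dy) (dx, dy) =
      ((deriv_at \<kappa> p (dx, dy))\<^sup>2 + (deriv_at s p (dx, dy))\<^sup>2) / (B_fun \<kappa> s p)\<^sup>2"
    unfolding third_form_def comp B_def[symmetric] by (simp add: power2_eq_square)
  have fd: "deriv_at \<kappa> p (dx, dy) = dx * (\<sigma> / c * partial_x s p) - dy * (c / \<sigma> * partial_y s p)"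
    "deriv_at s p (dx, dy) = dx * partial_x s p + dy * partial_y s p"
    using frechet_derivative_plane[OF sm(1) p, of "(dx, dy)"] frechet_derivative_plane[OF sm(2) p, of "(dx, dy)"]
    by (simp_all add: e tc)
  have "(deriv_at \<kappa> p (dx, dy))\<^sup>2 + (deriv_at s p (dx, dy))\<^sup>2 =
      dx\<^sup>2 * (partial_x s p)\<^sup>2 * ((c * c + \<sigma> * \<sigma>) / (c * c)) + dy\<^sup>2 * (partial_y s p)\<^sup>2 * ((c * c + \<sigma> * \<sigma>) / (\<sigma> * \<sigma>))"
    unfolding fd using cs(1,2) by (simp add: power2_eq_square field_simps)
  then show "third_form (normal_vector \<kappa> s) p (dx, dy) (dx, dy) =
      (partial_x s p / B_fun \<kappa> s p)\<^sup>2 * (dx\<^sup>2 / (cos (\<phi> p))\<^sup>2) +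
      (partial_y s p / B_fun \<kappa> s p)\<^sup>2 * (dy\<^sup>2 / (sin (\<phi> p))\<^sup>2)"
    unfolding 1 B_def[symmetric] c_def[symmetric] \<sigma>_def[symmetric] cs(3)
    using B cs(1,2) by (simp add: power2_eq_square field_simps)
  show "partial_x (normal_vector \<kappa> s) p \<bullet> partial_y (normal_vector \<kappa> s) p = 0"
    using comp[of "(1, 0)" "(0, 1)"] cs(1,2) by (simp add: frechet_derivative_eq_partials e tc)
qed

text \<open>\<open>r_x \<bullet> n_y = 0\<close> stands in for the vanishing mixed coefficient of
  the second form, so that no second derivative of \<open>r\<close> has to be computed.\<close>

lemma curvature_line_surfaceI:
  assumes U: "open U" and r: "smooth_on U r" and n: "smooth_on U n"
    and imm: "\<And>p. p \<in> U \<Longrightarrow> immersion_at r p" and norm: "\<And>p. p \<in> U \<Longrightarrow> norm (n p) = 1"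
    and orth: "\<And>p. p \<in> U \<Longrightarrow> n p \<bullet> partial_x r p = 0" "\<And>p. p \<in> U \<Longrightarrow> n p \<bullet> partial_y r p = 0"
    and I: "\<And>p. p \<in> U \<Longrightarrow> partial_x r p \<bullet> partial_y r p = 0"
    and II: "\<And>p. p \<in> U \<Longrightarrow> partial_x r p \<bullet> partial_y n p = 0"
  shows "curvature_line_surface U r n"
proof -
  have o: "n p \<bullet> deriv_at r p h = 0" if "p \<in> U" for p h
    using orth[OF that] by (simp add: frechet_derivative_plane[OF r that] inner_add_right)
  have "second_form r n p (1, 0) (0, 1) = 0" if "p \<in> U" for p
    using second_form_eq[OF U r n that o] II[OF that] by (simp add: frechet_derivative_eq_partials)
  then show ?thesis
    using assms o by (auto simp: curvature_line_surface_def surface_def first_form_def frechet_derivative_eq_partials)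
qed

lemma smooth_on_representation:
  assumes "open U" "solves_system U \<phi> \<kappa>1 s1" "solves_system U \<phi> \<kappa>2 s2" "is_potential U \<kappa>1 s1 \<kappa>2 s2 A"
  shows "smooth_on U A" "smooth_on U (radius_vector \<kappa>1 s1 \<kappa>2 s2 A)" "smooth_on U (normal_vector \<kappa>1 s1)"
proof -
  have sm: "smooth_on U \<kappa>1" "smooth_on U s1" "smooth_on U \<kappa>2" "smooth_on U s2"
    using assms by (auto simp: solves_system_def)
  show "smooth_on U A" by (rule smooth_on_potential[OF assms(1) sm assms(4)])
  then show "smooth_on U (radius_vector \<kappa>1 s1 \<kappa>2 s2 A)" by (rule smooth_on_radius_vector[OF assms(1) sm])
  show "smooth_on U (normal_vector \<kappa>1 s1)" by (rule smooth_on_normal_vector[OF assms(1) sm(1,2)])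
qed

text \<open>\<open>r_x\<close> and \<open>r_y\<close> are multiples of the orthogonal vectors
  \<open>n_x\<close> and \<open>n_y\<close>, so both forms are diagonal. Orthogonality also reduces
  immersion to \<open>r_x \<noteq> 0\<close> and \<open>r_y \<noteq> 0\<close>, which makes the set
  of immersed points open.\<close>

lemma representation_curvature_line_surface:
  assumes U: "open U" and S1: "solves_system U \<phi> \<kappa>1 s1" and S2: "solves_system U \<phi> \<kappa>2 s2"
    and pot: "is_potential U \<kappa>1 s1 \<kappa>2 s2 A"
    and trig: "\<And>p. p \<in> U \<Longrightarrow> sin (\<phi> p) * cos (\<phi> p) \<noteq> 0"
    and nz: "\<And>p. p \<in> U \<Longrightarrow> partial_x s1 p \<noteq> 0 \<and> partial_y s1 p \<noteq> 0"
  defines "r \<equiv> radius_vector \<kappa>1 s1 \<kappa>2 s2 A" and "n \<equiv> normal_vector \<kappa>1 s1"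
  shows "curvature_line_surface {p \<in> U. immersion_at r p} r n"
proof -
  note sm = smooth_on_representation[OF U S1 S2 pot, folded r_def n_def]
  have sk: "smooth_on U \<kappa>1" "smooth_on U s1" using S1 by (auto simp: solves_system_def)
  note w = representation_weingarten[OF S1 S2 pot _ conjunct1[OF nz] conjunct2[OF nz], folded r_def n_def]
  have no: "partial_x n p \<bullet> partial_y n p = 0" if "p \<in> U" for p
    unfolding n_def by (rule third_form_representation(3)[OF S1 that trig[OF that]])
  have nn: "n p \<bullet> partial_x n p = 0" "n p \<bullet> partial_y n p = 0" if "p \<in> U" for p
    unfolding n_def partial_x_def partial_y_def by (rule normal_vector_derivative_components(7)[OF sk that])+
  have ro: "partial_x r p \<bullet> partial_y r p = 0" if "p \<in> U" for p
    using no[OF that] by (simp add: w[OF that that that])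
  have "{p \<in> U. immersion_at r p} = {p \<in> U. partial_x r p \<noteq> 0} \<inter> {p \<in> U. partial_y r p \<noteq> 0}"
    using immersion_at_iff_orthogonal[OF sm(2) _ ro] by auto
  moreover have "open {p \<in> U. partial_x r p \<noteq> 0}" "open {p \<in> U. partial_y r p \<noteq> 0}"
    using continuous_open_preimage[OF smooth_on_imp_continuous_on[OF smooth_on_partial_x[OF sm(2)]] U, of "- {0}"]
      continuous_open_preimage[OF smooth_on_imp_continuous_on[OF smooth_on_partial_y[OF sm(2)]] U, of "- {0}"]
    by (auto simp: vimage_def Int_def)
  ultimately have op: "open {p \<in> U. immersion_at r p}" by auto
  show ?thesis
    by (rule curvature_line_surfaceI[OF op smooth_on_subset[OF sm(2)] smooth_on_subset[OF sm(3)]])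
      (use no nn ro w in \<open>auto simp: n_def norm_normal_vector\<close>)
qed

lemma reconstruct_solution:
  assumes U: "open U" and sk: "smooth_on U \<kappa>1" "smooth_on U s1" and r: "smooth_on U r"
    and orth: "\<forall>p\<in>U. \<forall>h. normal_vector \<kappa>1 s1 p \<bullet> deriv_at r p h = 0"
  defines "\<kappa>2 \<equiv> \<lambda>p. r p $ 1 - \<kappa>1 p * r p $ 3" and "s2 \<equiv> \<lambda>p. r p $ 2 - s1 p * r p $ 3"
    and "A \<equiv> \<lambda>p. - (B_fun \<kappa>1 s1 p * r p $ 3)"
  shows "smooth_on U \<kappa>2" "smooth_on U s2" "smooth_on U A"
    and "is_potential U \<kappa>1 s1 \<kappa>2 s2 A"
    and "r p = radius_vector \<kappa>1 s1 \<kappa>2 s2 A p"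
    and "p \<in> U \<Longrightarrow> deriv_at \<kappa>2 p h = (deriv_at r p h $ 1 - \<kappa>1 p * deriv_at r p h $ 3)
           - deriv_at \<kappa>1 p h * r p $ 3"
    and "p \<in> U \<Longrightarrow> deriv_at s2 p h = (deriv_at r p h $ 2 - s1 p * deriv_at r p h $ 3)
           - deriv_at s1 p h * r p $ 3"
proof -
  show "smooth_on U \<kappa>2" "smooth_on U s2" "smooth_on U A"
    unfolding \<kappa>2_def s2_def A_def smooth_on_def
    by (intro allI differentiable_times_on_intros smooth_onD smooth_on_B_fun U sk r)+
  have c: "((\<lambda>p. r p $ i) has_derivative (\<lambda>h. deriv_at r p h $ i)) (at p)" if "p \<in> U" for p i
    by (rule bounded_linear.has_derivative[OF bounded_linear_vec_nth smooth_on_has_derivative[OF r that]])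
  show d\<kappa>: "deriv_at \<kappa>2 p h = (deriv_at r p h $ 1 - \<kappa>1 p * deriv_at r p h $ 3)
           - deriv_at \<kappa>1 p h * r p $ 3" if "p \<in> U" for p h
    unfolding \<kappa>2_def
    using fun_cong[OF frechet_derivative_at[OF has_derivative_diff[OF c[OF that] has_derivative_mult[OF smooth_on_has_derivative[OF sk(1) that] c[OF that]]]], of h 1 3]
    by simp
  show ds: "deriv_at s2 p h = (deriv_at r p h $ 2 - s1 p * deriv_at r p h $ 3)
           - deriv_at s1 p h * r p $ 3" if "p \<in> U" for p h
    unfolding s2_def
    using fun_cong[OF frechet_derivative_at[OF has_derivative_diff[OF c[OF that] has_derivative_mult[OF smooth_on_has_derivative[OF sk(2) that] c[OF that]]]], of h 2 3]
    by simp
  show "is_potential U \<kappa>1 s1 \<kappa>2 s2 A"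
    unfolding is_potential_def
  proof
    fix p assume p: "p \<in> U"
    define B where "B = B_fun \<kappa>1 s1 p"
    have B: "B > 0" "\<kappa>1 p * \<kappa>1 p + s1 p * s1 p + 1 = 2 * B"
      using B_fun_pos[of \<kappa>1 s1 p] by (auto simp: B_def B_fun_def power2_eq_square)
    have "(A has_derivative (\<lambda>h. - (B * deriv_at r p h $ 3 +
       (\<kappa>1 p * deriv_at \<kappa>1 p h + s1 p * deriv_at s1 p h) * r p $ 3))) (at p)"
      unfolding A_def B_def
      by (intro has_derivative_minus has_derivative_mult B_fun_has_derivative c p smooth_on_has_derivative[OF _ p] sk)
    moreover have "- (B * deriv_at r p h $ 3 +
       (\<kappa>1 p * deriv_at \<kappa>1 p h + s1 p * deriv_at s1 p h) * r p $ 3) =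
       \<kappa>1 p * deriv_at \<kappa>2 p h + s1 p * deriv_at s2 p h" for h
    proof -
      let ?d = "deriv_at r p h"
      \<comment> \<open>Tangency multiplied by \<open>B\<close>. The equation for \<open>dA\<close>
        follows from it on replacing \<open>\<kappa>1^2 + s1^2\<close> by
        \<open>2 B - 1\<close>.\<close>
      have "\<kappa>1 p * ?d $ 1 + s1 p * ?d $ 2 + (1 - B) * ?d $ 3 =
          B * (\<kappa>1 p / B * ?d $ 1 + s1 p / B * ?d $ 2 + (1 / B - 1) * ?d $ 3)"
        using B(1) by (simp add: field_simps)
      also have "\<dots> = 0"
        using orth[rule_format, OF p, of h] unfolding inner_3 normal_vector_def B_def by simp
      finally have "\<kappa>1 p * ?d $ 1 + s1 p * ?d $ 2 + (1 - B) * ?d $ 3 = 0" .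
      then show ?thesis unfolding d\<kappa>[OF p] ds[OF p] using B(2) by algebra
    qed
    ultimately show "(A has_derivative (\<lambda>h. \<kappa>1 p * deriv_at \<kappa>2 p h + s1 p * deriv_at s2 p h)) (at p)"
      by simp
  qed
  have "B_fun \<kappa>1 s1 p \<noteq> 0" using B_fun_pos[of \<kappa>1 s1 p] by simp
  then show "r p = radius_vector \<kappa>1 s1 \<kappa>2 s2 A p"
    by (simp add: vec_eq_iff forall_3 radius_vector_def \<kappa>2_def s2_def A_def)
qed

subsection \<open>Combescure equivalence\<close>

lemma solves_system_subset: "solves_system D \<phi> \<kappa> s \<Longrightarrow> U \<subseteq> D \<Longrightarrow> solves_system U \<phi> \<kappa> s"
  unfolding solves_system_def using smooth_on_subset[of D _ U] by blast

lemma is_potential_subset: "is_potential D \<kappa>1 s1 \<kappa>2 s2 A \<Longrightarrow> U \<subseteq> D \<Longrightarrow> is_potential U \<kappa>1 s1 \<kappa>2 s2 A"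
  unfolding is_potential_def by blast

lemma immersion_at_partials_nonzero:
  assumes "immersion_at r p"
  shows "partial_x r p \<noteq> 0" "partial_y r p \<noteq> 0"
proof -
  have lin: "linear (deriv_at r p)" and inj: "inj (deriv_at r p)"
    using assms frechet_derivative_works has_derivative_linear unfolding immersion_at_def by blast+
  then show "partial_x r p \<noteq> 0" "partial_y r p \<noteq> 0"
    using linear_injective_0[OF lin] unfolding partial_x_def partial_y_def
    by (metis Pair_inject zero_neq_one zero_prod_def)+
qed

lemma parallel_multiples:
  assumes "v = a *\<^sub>R x" "w = b *\<^sub>R x" "v \<noteq> 0" "w \<noteq> 0"
  shows "parallel v w"
  unfolding parallel_def
  by (rule exI[of _ "a / b"]) (use assms in auto)

text \<open>The tangents of both surfaces are multiples of the same \<open>n_x\<close> and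
  \<open>n_y\<close>, and immersion keeps the multiples nonzero.\<close>

lemma representation_combescure_equivalent:
  assumes U: "open U" and S1: "solves_system U \<phi> \<kappa>1 s1"
    and trig: "\<And>p. p \<in> U \<Longrightarrow> sin (\<phi> p) * cos (\<phi> p) \<noteq> 0"
    and nz: "\<And>p. p \<in> U \<Longrightarrow> partial_x s1 p \<noteq> 0 \<and> partial_y s1 p \<noteq> 0"
    and S2: "solves_system U \<phi> \<kappa>2 s2" and pot: "is_potential U \<kappa>1 s1 \<kappa>2 s2 A"
    and imm: "\<And>p. p \<in> U \<Longrightarrow> immersion_at (radius_vector \<kappa>1 s1 \<kappa>2 s2 A) p"
    and S2': "solves_system U \<phi> \<kappa>2' s2'" and pot': "is_potential U \<kappa>1 s1 \<kappa>2' s2' A'"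
    and imm': "\<And>p. p \<in> U \<Longrightarrow> immersion_at (radius_vector \<kappa>1 s1 \<kappa>2' s2' A') p"
  shows "combescure_equivalent U (radius_vector \<kappa>1 s1 \<kappa>2 s2 A) (normal_vector \<kappa>1 s1)
    (radius_vector \<kappa>1 s1 \<kappa>2' s2' A') (normal_vector \<kappa>1 s1)"
proof -
  have "curvature_line_surface U (radius_vector \<kappa>1 s1 \<kappa>2 s2 A) (normal_vector \<kappa>1 s1)"
    "curvature_line_surface U (radius_vector \<kappa>1 s1 \<kappa>2' s2' A') (normal_vector \<kappa>1 s1)"
    using representation_curvature_line_surface[OF U S1 S2 pot trig nz]
      representation_curvature_line_surface[OF U S1 S2' pot' trig nz] imm imm'
    by (simp_all cong: conj_cong)
  moreover have "parallel (partial_x (radius_vector \<kappa>1 s1 \<kappa>2 s2 A) p) (partial_x (radius_vector \<kappa>1 s1 \<kappa>2' s2' A') p)"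
    "parallel (partial_y (radius_vector \<kappa>1 s1 \<kappa>2 s2 A) p) (partial_y (radius_vector \<kappa>1 s1 \<kappa>2' s2' A') p)" if p: "p \<in> U" for p
    using nz[OF p] immersion_at_partials_nonzero[OF imm[OF p]] immersion_at_partials_nonzero[OF imm'[OF p]]
    by (blast intro: parallel_multiples representation_weingarten[OF S1 S2 pot p] representation_weingarten[OF S1 S2' pot' p])+
  moreover have "parallel v v" for v :: "real^3"
    unfolding parallel_def by (rule exI[of _ 1]) simp
  ultimately show ?thesis by (simp add: combescure_equivalent_def)
qed

lemma unit_parallel_eq:
  assumes "parallel v w" "norm v = 1" "norm w = 1"
  shows "v = w \<or> v = - w"
proof -
  obtain c where c: "v = c *\<^sub>R w" using assms(1) by (auto simp: parallel_def)
  then have "\<bar>c\<bar> = 1" using assms by simp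
  then show ?thesis using c by (auto simp: abs_if split: if_splits)
qed

text \<open>Parallel unit vectors agree up to sign. Along a connected arc
  \<open>n \<bullet> n'\<close> is continuous with values 1 and -1 only, hence constant, so the
  spherical images of the arc coincide up to the antipodal map. Over a disconnected \<open>U\<close>
  the sign may differ from one component to another.\<close>

lemma combescure_equivalent_normals:
  assumes eq: "combescure_equivalent U r n r' n'"
  shows "\<And>p. p \<in> U \<Longrightarrow> n' p = n p \<or> n' p = - n p"
    and "curvature_line_arc U L \<Longrightarrow> n' ` L = n ` L \<or> n' ` L = uminus ` n ` L"
proof -
  have s: "surface U r n" "surface U r' n'"
    using eq by (auto simp: combescure_equivalent_def curvature_line_surface_def)
  show pm: "n' p = n p \<or> n' p = - n p" if "p \<in> U" for p
  proof -
    have "parallel (n p) (n' p)" "norm (n p) = 1" "norm (n' p) = 1"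
      using eq s that by (auto simp: combescure_equivalent_def surface_def)
    from unit_parallel_eq[OF this] show ?thesis by auto
  qed
  have nn: "n p \<bullet> n p = 1" if "p \<in> U" for p
    using s that by (simp add: surface_def norm_eq_1)
  show "n' ` L = n ` L \<or> n' ` L = uminus ` n ` L" if L: "curvature_line_arc U L"
  proof -
    have LU: "L \<subseteq> U" "connected L" using L by (auto simp: curvature_line_arc_def)
    define \<sigma> where "\<sigma> p = n p \<bullet> n' p" for p
    have val: "n' p = \<sigma> p *\<^sub>R n p \<and> (\<sigma> p = 1 \<or> \<sigma> p = -1)" if "p \<in> L" for p
    proof -
      have "p \<in> U" using that LU(1) by blast
      from pm[OF this] nn[OF this] show ?thesis by (auto simp: \<sigma>_def)
    qed
    have "continuous_on U n" "continuous_on U n'"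
      using s smooth_on_imp_continuous_on by (auto simp: surface_def)
    then have "continuous_on L \<sigma>"
      unfolding \<sigma>_def using LU(1) by (intro continuous_on_inner continuous_on_subset[of U _ L])
    then have con: "connected (\<sigma> ` L)" using LU(2) connected_continuous_image by blast
    have "\<not> (1 \<in> \<sigma> ` L \<and> -1 \<in> \<sigma> ` L)"
    proof
      assume "1 \<in> \<sigma> ` L \<and> -1 \<in> \<sigma> ` L"
      then have "0 \<in> \<sigma> ` L" using connectedD_interval[OF con, of "-1" 1 0] by auto
      then show False using val by force
    qed
    then consider "\<forall>p\<in>L. \<sigma> p = 1" | "\<forall>p\<in>L. \<sigma> p = -1" using val by (metis image_eqI)
    then show ?thesis
    proof cases
      case 1
      then have "\<forall>p\<in>L. n' p = n p" using val by (metis scaleR_one)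
      then show ?thesis by auto
    next
      case 2
      then have "\<forall>p\<in>L. n' p = - n p" using val by (metis scaleR_minus1_left)
      then show ?thesis by (auto simp: image_image)
    qed
  qed
qed

text \<open>\<open>r'_x\<close> is parallel to \<open>r_x\<close>, hence a multiple of
  \<open>n_x\<close>, and the projection along \<open>n + e3\<close> carries \<open>n_x\<close> to
  \<open>(\<kappa>1_x, s1_x) / B\<close>. So the reconstructed pair has \<open>x\<close>-derivatives
  proportional to those of the first solution and inherits its equation; likewise in
  \<open>y\<close>.\<close>

lemma combescure_equivalent_representation:
  assumes U: "open U" and S1: "solves_system U \<phi> \<kappa>1 s1" and S2: "solves_system U \<phi> \<kappa>2 s2"
    and pot: "is_potential U \<kappa>1 s1 \<kappa>2 s2 A"
    and nz: "\<And>p. p \<in> U \<Longrightarrow> partial_x s1 p \<noteq> 0 \<and> partial_y s1 p \<noteq> 0"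
    and eq: "combescure_equivalent U (radius_vector \<kappa>1 s1 \<kappa>2 s2 A) (normal_vector \<kappa>1 s1) r' n'"
  shows "\<exists>\<kappa>2' s2' A'. solves_system U \<phi> \<kappa>2' s2' \<and> is_potential U \<kappa>1 s1 \<kappa>2' s2' A' \<and>
            (\<forall>p\<in>U. r' p = radius_vector \<kappa>1 s1 \<kappa>2' s2' A' p)"
proof -
  let ?r = "radius_vector \<kappa>1 s1 \<kappa>2 s2 A" and ?n = "normal_vector \<kappa>1 s1"
  have sk: "smooth_on U \<kappa>1" "smooth_on U s1" using S1 by (auto simp: solves_system_def)
  have s': "surface U r' n'" using eq by (auto simp: combescure_equivalent_def curvature_line_surface_def)
  then have r': "smooth_on U r'" by (simp add: surface_def)
  have orth: "\<forall>p\<in>U. \<forall>h. ?n p \<bullet> deriv_at r' p h = 0"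
  proof (intro ballI allI)
    fix p h assume p: "p \<in> U"
    have "n' p \<bullet> deriv_at r' p h = 0" using s' p unfolding surface_def by blast
    then show "?n p \<bullet> deriv_at r' p h = 0"
      using combescure_equivalent_normals(1)[OF eq p] by auto
  qed
  note rec = reconstruct_solution[OF U sk r' orth]
  let ?\<kappa> = "\<lambda>p. r' p $ 1 - \<kappa>1 p * r' p $ 3" and ?s = "\<lambda>p. r' p $ 2 - s1 p * r' p $ 3"
  \<comment> \<open>The projected tangent vector contributes \<open>c / B\<close> to the factor, and
    the terms with \<open>r'_3\<close> in the derivatives of the reconstructed pair contribute
    \<open>- r'_3\<close>.\<close>
  have proportional: "deriv_at ?\<kappa> p h = t * deriv_at \<kappa>1 p h \<and>
      deriv_at ?s p h = t * deriv_at s1 p h"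
    if p: "p \<in> U" and c: "deriv_at r' p h = c *\<^sub>R deriv_at ?n p h" and t: "t = c / B_fun \<kappa>1 s1 p - r' p $ 3" for p h c t
    using normal_vector_derivative_components(5,6)[OF sk p, of h]
    unfolding rec(6)[OF p] rec(7)[OF p] c t vector_scaleR_component
    by (simp add: left_diff_distrib mult.commute[of _ "r' p $ 3"] mult.left_commute[of _ c] flip: right_diff_distrib)
  have "partial_x ?\<kappa> p = tan (\<phi> p) * partial_x ?s p \<and> partial_y ?\<kappa> p = - cot (\<phi> p) * partial_y ?s p" if p: "p \<in> U" for p
  proof -
    have "parallel (partial_x ?r p) (partial_x r' p)" "parallel (partial_y ?r p) (partial_y r' p)"
      using eq p by (auto simp: combescure_equivalent_def)
    then obtain c d where cd: "c \<noteq> 0" "partial_x ?r p = c *\<^sub>R partial_x r' p" "d \<noteq> 0" "partial_y ?r p = d *\<^sub>R partial_y r' p"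
      by (auto simp: parallel_def)
    note w = representation_weingarten[OF S1 S2 pot p conjunct1[OF nz[OF p]] conjunct2[OF nz[OF p]]]
    have "partial_x r' p = (1 / c) *\<^sub>R partial_x ?r p" "partial_y r' p = (1 / d) *\<^sub>R partial_y ?r p"
      using cd by simp_all
    then obtain c' d' where "partial_x r' p = c' *\<^sub>R partial_x ?n p" "partial_y r' p = d' *\<^sub>R partial_y ?n p"
      unfolding w scaleR_scaleR by blast
    then have "\<exists>t. partial_x ?\<kappa> p = t * partial_x \<kappa>1 p \<and> partial_x ?s p = t * partial_x s1 p"
      "\<exists>t. partial_y ?\<kappa> p = t * partial_y \<kappa>1 p \<and> partial_y ?s p = t * partial_y s1 p"
      using proportional[OF p, of "(1, 0)"] proportional[OF p, of "(0, 1)"] unfolding frechet_derivative_eq_partials by blast+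
    then show ?thesis using S1 p by (auto simp: solves_system_def)
  qed
  then have "solves_system U \<phi> ?\<kappa> ?s" using rec(1,2) by (simp add: solves_system_def)
  then show ?thesis using rec(4,5) by blast
qed

text \<open>Pairing with a fixed vector carries the scalar equality of mixed partials over to
  \<open>r\<close>; it is applied with \<open>c\<close> the normal at the point.\<close>

lemma mixed_partials_inner:
  fixes r :: "real \<times> real \<Rightarrow> real^3"
  assumes U: "open U" and r: "smooth_on U r" and p: "p \<in> U"
  shows "partial_y (partial_x r) p \<bullet> c = partial_x (partial_y r) p \<bullet> c"
proof -
  let ?f = "\<lambda>q. r q \<bullet> c"
  have f: "smooth_on U ?f" by (rule smooth_on_bounded_linear_compose[OF U bounded_linear_inner_left r])
  have lin: "partial_x (\<lambda>q. g q \<bullet> c) q = partial_x g q \<bullet> c" "partial_y (\<lambda>q. g q \<bullet> c) q = partial_y g q \<bullet> c"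
    if "smooth_on U g" "q \<in> U" for g :: "real \<times> real \<Rightarrow> real^3" and q
    using frechet_derivative_bounded_linear_compose[OF that bounded_linear_inner_left]
    by (simp_all add: partial_x_def partial_y_def)
  have cong: "partial_x g p = partial_x h p" "partial_y g p = partial_y h p"
    if "smooth_on U g" "\<And>q. q \<in> U \<Longrightarrow> g q = h q" for g h :: "real \<times> real \<Rightarrow> real"
  proof -
    have "g differentiable (at p)" using smooth_on_has_derivative[OF that(1) p] by (auto simp: differentiable_def)
    from frechet_derivative_transform_within_open[OF this U p, of h] that(2)
    show "partial_x g p = partial_x h p" "partial_y g p = partial_y h p" by (simp_all add: partial_x_def partial_y_def)
  qed
  have "partial_y (partial_x ?f) p = partial_y (\<lambda>q. partial_x r q \<bullet> c) p"
    by (rule cong(2)[OF smooth_on_partial_x[OF f] lin(1)[OF r]])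
  moreover have "partial_x (partial_y ?f) p = partial_x (\<lambda>q. partial_y r q \<bullet> c) p"
    by (rule cong(1)[OF smooth_on_partial_y[OF f] lin(2)[OF r]])
  ultimately show ?thesis
    using mixed_partials_commute[OF U f p] lin(2)[OF smooth_on_partial_x[OF r] p] lin(1)[OF smooth_on_partial_y[OF r] p]
    by simp
qed

text \<open>Self-adjointness of the shape operator: up to sign both sides are values of the second
  form, and its symmetry is that of the second derivative.\<close>

lemma weingarten_symmetric:
  assumes s: "surface U r n" and p: "p \<in> U"
  shows "deriv_at r p u \<bullet> deriv_at n p v =
    deriv_at r p v \<bullet> deriv_at n p u"
proof -
  have U: "open U" and r: "smooth_on U r" and n: "smooth_on U n"
    and o: "\<And>q h. q \<in> U \<Longrightarrow> n q \<bullet> deriv_at r q h = 0"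
    using s by (auto simp: surface_def)
  have "partial_x r p \<bullet> partial_y n p = partial_y r p \<bullet> partial_x n p"
    using second_form_eq[OF U r n p o, of "(1, 0)" "(0, 1)"] second_form_eq[OF U r n p o, of "(0, 1)" "(1, 0)"]
      mixed_partials_inner[OF U r p, of "n p"]
    by (simp add: second_form_def frechet_derivative_eq_partials partial_x_def[symmetric, abs_def] partial_y_def[symmetric, abs_def])
  then show ?thesis
    by (simp add: frechet_derivative_plane[OF r p] frechet_derivative_plane[OF n p] inner_add_left inner_add_right algebra_simps)
qed

subsection \<open>Representation of a surface in curvature line coordinates\<close>

lemma orthogonal_matrix_inner:
  fixes Q :: "real^'n^'n"
  assumes "orthogonal_matrix Q"
  shows "(Q *v x) \<bullet> (Q *v y) = x \<bullet> y"
proof -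
  have "orthogonal_transformation ((*v) Q)"
    using assms by (simp add: orthogonal_transformation_matrix matrix_vector_mul_linear)
  then show ?thesis by (simp add: orthogonal_transformation_def)
qed

text \<open>With \<open>f = n \<times> e\<close>, the rows \<open>(e - f) / sqrt 2\<close>,
  \<open>(e + f) / sqrt 2\<close>, \<open>n\<close> turn the frame \<open>e, f\<close> by 45
  degrees. So \<open>e\<close> lands on the diagonal, which keeps numerator and denominator of
  \<open>tan \<phi> = \<kappa>1_x / s1_x\<close> away from zero. The order of the rows gives
  determinant 1.\<close>

lemma adapted_rotation:
  fixes n e :: "real^3"
  assumes n: "norm n = 1" and e: "norm e = 1" and ne: "n \<bullet> e = 0"
  obtains Q c where "rotation_matrix Q" "Q *v n = vector [0, 0, 1]" "Q *v e = vector [c, c, 0]" "c \<noteq> 0"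
proof -
  define f where "f = cross3 n e"
  define c :: real where "c = 1 / sqrt 2"
  have c: "c * c = 1 / 2" "c \<noteq> 0" by (simp_all add: c_def)
  have nn: "n \<bullet> n = 1" "e \<bullet> e = 1" using n e by (simp_all add: norm_eq_1)
  have fn: "f \<bullet> n = 0" "n \<bullet> f = 0" "f \<bullet> e = 0" "e \<bullet> f = 0"
    by (simp_all add: f_def dot_cross_self inner_commute)
  have ff: "f \<bullet> f = 1"
    using norm_cross_dot[of n e] n e ne by (simp add: f_def power2_norm_eq_inner)
  have fxn: "cross3 f n = e"
    using Lagrange[of n n e] nn ne by (simp add: f_def cross_skew[of "cross3 n e" n])
  define Q :: "real^3^3" where "Q = vector [c *\<^sub>R (e - f), c *\<^sub>R (e + f), n]"
  have rows: "Q $ 1 = c *\<^sub>R (e - f)" "Q $ 2 = c *\<^sub>R (e + f)" "Q $ 3 = n" by (simp_all add: Q_def)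
  have row: "row i Q = Q $ i" for i by (simp add: row_def vec_eq_iff)
  have "orthogonal_matrix Q"
    unfolding orthogonal_matrix_orthonormal_rows row forall_3 rows orthogonal_def norm_eq_1
    using c nn fn ff ne
    by (simp add: inner_diff_left inner_diff_right inner_add_left inner_add_right inner_commute[of e n] mult.assoc[symmetric])
  moreover have "det Q = 1"
  proof -
    have "det Q = (c *\<^sub>R (e - f)) \<bullet> cross3 (c *\<^sub>R (e + f)) n"
      unfolding Q_def by (rule dot_cross_det[symmetric])
    also have "cross3 (c *\<^sub>R (e + f)) n = c *\<^sub>R (e - f)"
      using cross_skew[of e n] fxn by (simp add: cross_mult_left cross_add_left flip: f_def)
    also have "(c *\<^sub>R (e - f)) \<bullet> (c *\<^sub>R (e - f)) = 1"
      using c nn fn ff by (simp add: inner_diff_left inner_diff_right mult.assoc[symmetric])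
    finally show ?thesis .
  qed
  moreover have "Q *v n = vector [0, 0, 1]" "Q *v e = vector [c, c, 0]"
    unfolding vec_eq_iff forall_3 matrix_vector_mul_component rows
    using nn fn ne by (simp_all add: inner_diff_left inner_add_left inner_commute[of e n])
  ultimately show thesis using that c(2) by (simp add: rotation_matrix_def)
qed

text \<open>Here \<open>a, b\<close> will be the projections of \<open>r_x, r_y\<close>, and
  \<open>u, y\<close> those of \<open>n_x, n_y\<close>. In a plane, \<open>u\<close> and
  \<open>a\<close> are parallel as both are orthogonal to \<open>b \<noteq> 0\<close>; then
  \<open>y\<close>, orthogonal to \<open>a \<noteq> 0\<close>, is orthogonal to
  \<open>u\<close>.\<close>

lemma plane_orthogonality:
  fixes a1 a2 b1 b2 u1 u2 y1 y2 :: real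
  assumes "u1 * b1 + u2 * b2 = 0" "a1 * b1 + a2 * b2 = 0" "y1 * a1 + y2 * a2 = 0"
    and a: "a1 * a1 + a2 * a2 \<noteq> 0" and b: "b1 * b1 + b2 * b2 \<noteq> 0"
  shows "u1 * a2 = u2 * a1" "u1 * y1 + u2 * y2 = 0"
proof -
  have "(b1 * b1 + b2 * b2) * (u1 * a2 - u2 * a1) = 0" using assms(1,2) by algebra
  then show 1: "u1 * a2 = u2 * a1" using b by (metis mult_eq_0_iff right_minus_eq)
  have "(a1 * a1 + a2 * a2) * (u1 * y1 + u2 * y2) = 0" using assms(3) 1 by algebra
  then show "u1 * y1 + u2 * y2 = 0" using a by (metis mult_eq_0_iff)
qed

text \<open>On tangent vectors \<open>x \<mapsto> x - x_3 (\<kappa>, s, 1)\<close> agrees with the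
  reflection along \<open>n + e3\<close>. That reflection takes \<open>n\<close> to
  \<open>- e3\<close> and therefore the tangent plane isometrically onto the horizontal
  plane.\<close>

lemma tangent_plane_isometry:
  fixes x y :: "real^3"
  assumes "normal_vector \<kappa> s p \<bullet> x = 0" "normal_vector \<kappa> s p \<bullet> y = 0"
  shows "(x$1 - \<kappa> p * x$3) * (y$1 - \<kappa> p * y$3) + (x$2 - s p * x$3) * (y$2 - s p * y$3) = x \<bullet> y"
proof -
  define B where "B = B_fun \<kappa> s p"
  have B: "B > 0" "\<kappa> p * \<kappa> p + s p * s p + 1 = 2 * B"
    using B_fun_pos[of \<kappa> s p] by (auto simp: B_def B_fun_def power2_eq_square)
  have t: "\<kappa> p * z$1 + s p * z$2 + (1 - B) * z$3 = 0" if "normal_vector \<kappa> s p \<bullet> z = 0" for z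
  proof -
    have "\<kappa> p * z$1 + s p * z$2 + (1 - B) * z$3 = B * (\<kappa> p / B * z$1 + s p / B * z$2 + (1 / B - 1) * z$3)"
      using B(1) by (simp add: field_simps)
    also have "\<dots> = 0" using that unfolding inner_3 normal_vector_def B_def by simp
    finally show ?thesis .
  qed
  show ?thesis unfolding inner_3 using t[OF assms(1)] t[OF assms(2)] B(2) by algebra
qed

text \<open>Stereographic projection from (0, 0, -1); in its coordinates
  \<open>B = 1 / (1 + n_3)\<close>.\<close>

lemma normal_vector_stereographic:
  fixes n :: "real \<times> real \<Rightarrow> real^3"
  assumes "norm (n p) = 1" "n p $ 3 \<noteq> -1"
  shows "normal_vector (\<lambda>p. n p $ 1 / (1 + n p $ 3)) (\<lambda>p. n p $ 2 / (1 + n p $ 3)) p = n p"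
proof -
  have nz: "1 + n p $ 3 \<noteq> 0" using assms(2) by linarith
  have "n p $ 1 * n p $ 1 + n p $ 2 * n p $ 2 + n p $ 3 * n p $ 3 = 1"
    using assms(1) unfolding norm_eq_1 inner_3 .
  then have "n p $ 1 * n p $ 1 + n p $ 2 * n p $ 2 + (1 + n p $ 3) * (1 + n p $ 3) = 2 * (1 + n p $ 3)"
    by (simp add: algebra_simps)
  then have "((n p $ 1 * n p $ 1 + n p $ 2 * n p $ 2 + (1 + n p $ 3) * (1 + n p $ 3)) / ((1 + n p $ 3) * (1 + n p $ 3))) / 2 = 1 / (1 + n p $ 3)"
    using nz by (simp only:) (simp add: divide_simps)
  then have "B_fun (\<lambda>p. n p $ 1 / (1 + n p $ 3)) (\<lambda>p. n p $ 2 / (1 + n p $ 3)) p = 1 / (1 + n p $ 3)"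
    unfolding B_fun_def power2_eq_square using nz by (simp add: add_divide_distrib)
  then show ?thesis
    unfolding normal_vector_def using nz by (simp add: vec_eq_iff forall_3)
qed

lemma open_nonzero_set:
  fixes f :: "'a::topological_space \<Rightarrow> 'b::real_normed_vector"
  assumes "open U" "continuous_on U f"
  shows "open {p \<in> U. f p \<noteq> 0}"
proof -
  have "{p \<in> U. f p \<noteq> 0} = U \<inter> f -` (- {0})" by auto
  moreover have "open (U \<inter> f -` (- {0}))" by (rule continuous_open_preimage[OF assms(2,1)]) auto
  ultimately show ?thesis by simp
qed

lemma curvature_line_surface_local_representation:
  fixes r n :: "real \<times> real \<Rightarrow> real^3"
  assumes cls: "curvature_line_surface U r n" and z0: "z0 \<in> U" and nx: "partial_x n z0 \<noteq> 0"
  shows "\<exists>e Q \<phi> \<kappa>1 s1 \<kappa>2 s2 A. e > 0 \<and> ball z0 e \<subseteq> U \<and> smooth_on (ball z0 e) \<phi> \<and>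
    (\<forall>p\<in>ball z0 e. sin (\<phi> p) * cos (\<phi> p) \<noteq> 0) \<and>
    solves_system (ball z0 e) \<phi> \<kappa>1 s1 \<and> solves_system (ball z0 e) \<phi> \<kappa>2 s2 \<and>
    smooth_on (ball z0 e) A \<and> is_potential (ball z0 e) \<kappa>1 s1 \<kappa>2 s2 A \<and> rotation_matrix Q \<and>
    (\<forall>p\<in>ball z0 e. Q *v r p = radius_vector \<kappa>1 s1 \<kappa>2 s2 A p \<and> Q *v n p = normal_vector \<kappa>1 s1 p)"
proof -
  have s: "surface U r n" using cls by (simp add: curvature_line_surface_def)
  have U: "open U" and r: "smooth_on U r" and n: "smooth_on U n"
    and norm: "\<And>p. p \<in> U \<Longrightarrow> norm (n p) = 1" and imm: "\<And>p. p \<in> U \<Longrightarrow> immersion_at r p"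
    and tang: "\<And>p h. p \<in> U \<Longrightarrow> n p \<bullet> deriv_at r p h = 0"
    using s by (auto simp: surface_def)
  have I: "partial_x r p \<bullet> partial_y r p = 0" and II: "partial_x r p \<bullet> partial_y n p = 0" if "p \<in> U" for p
    using cls that second_form_eq[OF U r n that tang, of "(1, 0)" "(0, 1)"]
    by (auto simp: curvature_line_surface_def first_form_def frechet_derivative_eq_partials)
  have II': "partial_y r p \<bullet> partial_x n p = 0" if "p \<in> U" for p
    using weingarten_symmetric[OF s that, of "(1, 0)" "(0, 1)"] II[OF that]
    by (simp add: frechet_derivative_eq_partials)
  have ntang: "n p \<bullet> deriv_at n p h = 0" if p: "p \<in> U" for p h
  proof -
    have "((\<lambda>q. n q \<bullet> n q) has_derivative (\<lambda>h. n p \<bullet> deriv_at n p h + deriv_at n p h \<bullet> n p)) (at p)"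
      by (intro has_derivative_inner smooth_on_has_derivative[OF n p])
    moreover have "((\<lambda>q. n q \<bullet> n q) has_derivative (\<lambda>h. 0)) (at p)"
      by (rule has_derivative_transform_within_open[OF has_derivative_const[of 1] U p])
        (use norm in \<open>simp add: norm_eq_1\<close>)
    ultimately have "(\<lambda>h. n p \<bullet> deriv_at n p h + deriv_at n p h \<bullet> n p) = (\<lambda>h. 0)"
      by (rule has_derivative_unique)
    from fun_cong[OF this, of h] show ?thesis by (simp add: inner_commute)
  qed
  \<comment> \<open>\<open>n\<close> goes to the centre of the stereographic chart and
    \<open>n_x\<close> to its diagonal.\<close>
  obtain Q c where Q: "rotation_matrix Q" "Q *v n z0 = vector [0, 0, 1]"
    "Q *v (partial_x n z0 /\<^sub>R norm (partial_x n z0)) = vector [c, c, 0]" "c \<noteq> 0"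
  proof (rule adapted_rotation[of "n z0" "partial_x n z0 /\<^sub>R norm (partial_x n z0)"])
    show "n z0 \<bullet> (partial_x n z0 /\<^sub>R norm (partial_x n z0)) = 0"
      using ntang[OF z0, of "(1, 0)"] by (simp add: frechet_derivative_eq_partials)
  qed (use norm[OF z0] nx in auto)
  define r' where "r' p = Q *v r p" for p
  define n' where "n' p = Q *v n p" for p
  have bl: "bounded_linear ((*v) Q)" by (rule matrix_vector_mul_bounded_linear)
  have iso: "(Q *v x) \<bullet> (Q *v y) = x \<bullet> y" for x y
    using Q(1) by (simp add: rotation_matrix_def orthogonal_matrix_inner)
  have r': "smooth_on U r'" and n': "smooth_on U n'"
    unfolding r'_def n'_def using smooth_on_bounded_linear_compose[OF U bl] r n by blast+
  have dr': "deriv_at r' p h = Q *v deriv_at r p h"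
    and dn': "deriv_at n' p h = Q *v deriv_at n p h" if "p \<in> U" for p h
    unfolding r'_def n'_def
    using frechet_derivative_bounded_linear_compose[OF r that bl] frechet_derivative_bounded_linear_compose[OF n that bl] by simp_all
  have nz0: "Q *v partial_x n z0 = norm (partial_x n z0) *\<^sub>R vector [c, c, 0]"
    using Q(3)[symmetric] nx by (simp add: matrix_vector_mult_scaleR)
  define U1 where "U1 = {p \<in> U. n' p $ 3 \<noteq> -1}"
  have "continuous_on U (\<lambda>p. n' p $ 3)"
    using smooth_on_imp_continuous_on[OF n'] by (intro continuous_intros)
  from continuous_open_preimage[OF this U, of "- {-1}"] have U1: "open U1" "U1 \<subseteq> U"
    by (auto simp: U1_def vimage_def Int_def)
  have z1: "z0 \<in> U1" using z0 by (simp add: U1_def n'_def Q(2))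
  define \<kappa>1 where "\<kappa>1 = (\<lambda>p. n' p $ 1 / (1 + n' p $ 3))"
  define s1 where "s1 = (\<lambda>p. n' p $ 2 / (1 + n' p $ 3))"
  have n'1: "smooth_on U1 n'" and r'1: "smooth_on U1 r'" using n' r' U1(2) smooth_on_subset by blast+
  have sk: "smooth_on U1 \<kappa>1" "smooth_on U1 s1"
    unfolding \<kappa>1_def s1_def smooth_on_def
    by (intro allI differentiable_times_on_intros smooth_onD n'1 U1(1); auto simp: U1_def add_eq_0_iff)+
  have nv: "normal_vector \<kappa>1 s1 p = n' p" if "p \<in> U1" for p
    unfolding \<kappa>1_def s1_def
  proof (rule normal_vector_stereographic)
    show "norm (n' p) = 1"
      using norm[OF subsetD[OF U1(2) that]] by (simp add: norm_eq_1 n'_def iso)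
  qed (use that U1_def in auto)
  have dnv: "deriv_at (normal_vector \<kappa>1 s1) p h = Q *v deriv_at n p h" if "p \<in> U1" for p h
  proof -
    have "n' differentiable (at p)" using smooth_on_has_derivative[OF n'1 that] by (auto simp: differentiable_def)
    from frechet_derivative_transform_within_open[OF this U1(1) that, of "normal_vector \<kappa>1 s1"] nv
    show ?thesis using dn'[OF subsetD[OF U1(2) that]] by simp
  qed
  define B where "B p = B_fun \<kappa>1 s1 p" for p
  have B: "B p > 0" for p by (simp add: B_def B_fun_pos)
  note comp = normal_vector_derivative_components(5,6)[OF sk, folded B_def]
  have orth: "\<forall>p\<in>U1. \<forall>h. normal_vector \<kappa>1 s1 p \<bullet> deriv_at r' p h = 0"
  proof (intro ballI allI)
    fix p h assume p: "p \<in> U1"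
    have pU: "p \<in> U" using p U1(2) by blast
    show "normal_vector \<kappa>1 s1 p \<bullet> deriv_at r' p h = 0"
      using tang[OF pU] by (simp add: nv[OF p] dr'[OF pU] n'_def iso)
  qed
  note rec = reconstruct_solution[OF U1(1) sk r'1 orth]
  define \<kappa>2 where "\<kappa>2 = (\<lambda>p. r' p $ 1 - \<kappa>1 p * r' p $ 3)"
  define s2 where "s2 = (\<lambda>p. r' p $ 2 - s1 p * r' p $ 3)"
  define A where "A = (\<lambda>p. - (B_fun \<kappa>1 s1 p * r' p $ 3))"
  note rec = rec[folded \<kappa>2_def s2_def A_def]
  define U2 where "U2 = {p \<in> U1. partial_x \<kappa>1 p \<noteq> 0} \<inter> {p \<in> U1. partial_x s1 p \<noteq> 0}"
  have U2: "open U2"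
    unfolding U2_def
    by (intro open_Int open_nonzero_set[OF U1(1)] smooth_on_imp_continuous_on smooth_on_partial_x sk)
  have z2: "z0 \<in> U2"
  proof -
    \<comment> \<open>At the centre of the chart the projection just drops the third coordinate, so
      \<open>\<kappa>1_x / B\<close> and \<open>s1_x / B\<close> are the two equal horizontal
      components of \<open>Q n_x\<close>.\<close>
    have "\<kappa>1 z0 = 0" "s1 z0 = 0" by (simp_all add: \<kappa>1_def s1_def n'_def Q(2))
    then have "partial_x \<kappa>1 z0 / B z0 = norm (partial_x n z0) * c" "partial_x s1 z0 / B z0 = norm (partial_x n z0) * c"
      using comp[OF z1, of "(1, 0)", unfolded dnv[OF z1], unfolded frechet_derivative_eq_partials nz0] by auto
    then show ?thesis using nx Q(4) z1 by (auto simp: U2_def)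
  qed
  \<comment> \<open>With \<open>tan \<phi> = \<kappa>1_x / s1_x\<close> these relations become the
    \<open>y\<close>-equations of both solutions and the \<open>x\<close>-equation of the second;
    the \<open>x\<close>-equation of the first is the definition of \<open>\<phi>\<close>.\<close>
  have key: "partial_x \<kappa>1 p * partial_y \<kappa>1 p + partial_x s1 p * partial_y s1 p = 0 \<and>
      partial_x \<kappa>1 p * partial_x s2 p = partial_x s1 p * partial_x \<kappa>2 p \<and>
      partial_x \<kappa>1 p * partial_y \<kappa>2 p + partial_x s1 p * partial_y s2 p = 0" if p: "p \<in> U1" for p
  proof -
    have pU: "p \<in> U" using p U1(2) by blast
    have t: "normal_vector \<kappa>1 s1 p \<bullet> (Q *v deriv_at r p h) = 0"
      "normal_vector \<kappa>1 s1 p \<bullet> (Q *v deriv_at n p h) = 0" for h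
      using tang[OF pU] ntang[OF pU] by (simp_all add: nv[OF p] n'_def iso)
    note tx = t[of "(1, 0)", unfolded frechet_derivative_eq_partials]
      and ty = t[of "(0, 1)", unfolded frechet_derivative_eq_partials]
    let ?P1 = "\<lambda>x. (Q *v x) $ 1 - \<kappa>1 p * (Q *v x) $ 3" and ?P2 = "\<lambda>x. (Q *v x) $ 2 - s1 p * (Q *v x) $ 3"
    have nxy: "?P1 (partial_x n p) = partial_x \<kappa>1 p / B p" "?P2 (partial_x n p) = partial_x s1 p / B p"
      "?P1 (partial_y n p) = partial_y \<kappa>1 p / B p" "?P2 (partial_y n p) = partial_y s1 p / B p"
      using comp[OF p, of "(1, 0)", unfolded dnv[OF p], unfolded frechet_derivative_eq_partials]
        comp[OF p, of "(0, 1)", unfolded dnv[OF p], unfolded frechet_derivative_eq_partials] by blast+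
    \<comment> \<open>Since the projection preserves inner products of tangent vectors, all
      relations between \<open>r_x, r_y, n_x, n_y\<close> can be read in the plane.\<close>
    note isoP = tangent_plane_isometry[of \<kappa>1 s1 p, unfolded iso]
    have e1: "?P1 (partial_x n p) * ?P1 (partial_y r p) + ?P2 (partial_x n p) * ?P2 (partial_y r p) = 0"
      using isoP[OF tx(2) ty(1)] II'[OF pU] by (simp add: iso inner_commute)
    have e2: "?P1 (partial_x r p) * ?P1 (partial_y r p) + ?P2 (partial_x r p) * ?P2 (partial_y r p) = 0"
      using isoP[OF tx(1) ty(1)] I[OF pU] by (simp add: iso)
    have e3: "?P1 (partial_y n p) * ?P1 (partial_x r p) + ?P2 (partial_y n p) * ?P2 (partial_x r p) = 0"
      using isoP[OF ty(2) tx(1)] II[OF pU] by (simp add: iso inner_commute)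
    have e4: "?P1 (partial_x r p) * ?P1 (partial_x r p) + ?P2 (partial_x r p) * ?P2 (partial_x r p) \<noteq> 0"
      using isoP[OF tx(1) tx(1)] immersion_at_partials_nonzero[OF imm[OF pU]] by (simp add: iso)
    have e5: "?P1 (partial_y r p) * ?P1 (partial_y r p) + ?P2 (partial_y r p) * ?P2 (partial_y r p) \<noteq> 0"
      using isoP[OF ty(1) ty(1)] immersion_at_partials_nonzero[OF imm[OF pU]] by (simp add: iso)
    note o = plane_orthogonality[OF e1 e2 e3 e4 e5]
    have 1: "partial_x \<kappa>1 p * partial_y \<kappa>1 p + partial_x s1 p * partial_y s1 p = 0"
      using o(2) B[of p] unfolding nxy by (simp add: add_divide_distrib[symmetric])
    have 2: "partial_x \<kappa>1 p * ?P2 (partial_x r p) = partial_x s1 p * ?P1 (partial_x r p)"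
      using o(1) B[of p] unfolding nxy by simp
    have 3: "partial_x \<kappa>1 p * ?P1 (partial_y r p) + partial_x s1 p * ?P2 (partial_y r p) = 0"
      using e1 B[of p] unfolding nxy by (simp add: add_divide_distrib[symmetric])
    \<comment> \<open>The terms with \<open>r'_3\<close> are multiples of the derivatives of
      \<open>(\<kappa>1, s1)\<close>, so they disturb neither the parallelism in \<open>x\<close>
      nor, by relation \<open>1\<close>, the orthogonality in \<open>y\<close>.\<close>
    have d: "partial_x \<kappa>2 p = ?P1 (partial_x r p) - partial_x \<kappa>1 p * r' p $ 3"
      "partial_x s2 p = ?P2 (partial_x r p) - partial_x s1 p * r' p $ 3"
      "partial_y \<kappa>2 p = ?P1 (partial_y r p) - partial_y \<kappa>1 p * r' p $ 3"
      "partial_y s2 p = ?P2 (partial_y r p) - partial_y s1 p * r' p $ 3"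
      using rec(6,7)[OF p, of "(1, 0)", unfolded dr'[OF pU], unfolded frechet_derivative_eq_partials]
        rec(6,7)[OF p, of "(0, 1)", unfolded dr'[OF pU], unfolded frechet_derivative_eq_partials] by blast+
    have "partial_x \<kappa>1 p * partial_x s2 p = partial_x s1 p * partial_x \<kappa>2 p"
      unfolding d using 2 by algebra
    moreover have "partial_x \<kappa>1 p * partial_y \<kappa>2 p + partial_x s1 p * partial_y s2 p = 0"
      unfolding d using 1 3 by algebra
    ultimately show ?thesis using 1 by blast
  qed
  obtain e where e: "e > 0" "ball z0 e \<subseteq> U2" using U2 z2 open_contains_ball by blast
  let ?b = "ball z0 e"
  have b1: "?b \<subseteq> U1" using e(2) by (auto simp: U2_def)
  define \<phi> where "\<phi> p = arctan (partial_x \<kappa>1 p / partial_x s1 p)" for p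
  have nz: "partial_x \<kappa>1 p \<noteq> 0" "partial_x s1 p \<noteq> 0" if "p \<in> ?b" for p using e(2) that by (auto simp: U2_def)
  have tan: "tan (\<phi> p) = partial_x \<kappa>1 p / partial_x s1 p" for p by (simp add: \<phi>_def tan_arctan)
  have cot: "cot (\<phi> p) = partial_x s1 p / partial_x \<kappa>1 p" for p
    using tan[of p] by (simp add: cot_altdef)
  have trig: "sin (\<phi> p) * cos (\<phi> p) \<noteq> 0" if "p \<in> ?b" for p
    using tan[of p] nz[OF that] by (auto simp: tan_def)
  have skb: "smooth_on ?b \<kappa>1" "smooth_on ?b s1" using sk b1 smooth_on_subset by blast+
  have "smooth_on ?b (\<lambda>p. partial_x \<kappa>1 p / partial_x s1 p)"
    unfolding smooth_on_def
    by (intro allI differentiable_times_on_divide smooth_onD smooth_on_partial_x skb open_ball nz)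
  then have \<phi>: "smooth_on ?b \<phi>"
    unfolding \<phi>_def by (intro smooth_on_compose[OF open_ball smooth_on_arctan]) auto
  have S1: "solves_system ?b \<phi> \<kappa>1 s1"
    unfolding solves_system_def
  proof (intro conjI ballI skb)
    fix p assume p: "p \<in> ?b"
    show "partial_x \<kappa>1 p = tan (\<phi> p) * partial_x s1 p" using nz[OF p] by (simp add: tan)
    have "partial_x \<kappa>1 p * partial_y \<kappa>1 p = - (partial_x s1 p * partial_y s1 p)"
      using key[OF subsetD[OF b1 p]] by (simp add: add_eq_0_iff2)
    then show "partial_y \<kappa>1 p = - cot (\<phi> p) * partial_y s1 p" using nz[OF p] by (simp add: cot field_simps)
  qed
  have S2: "solves_system ?b \<phi> \<kappa>2 s2"
    unfolding solves_system_def
  proof (intro conjI ballI)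
    show "smooth_on ?b \<kappa>2" "smooth_on ?b s2" using rec(1,2) b1 smooth_on_subset by blast+
    fix p assume p: "p \<in> ?b"
    have k: "partial_x \<kappa>1 p * partial_x s2 p = partial_x s1 p * partial_x \<kappa>2 p"
      "partial_x \<kappa>1 p * partial_y \<kappa>2 p = - (partial_x s1 p * partial_y s2 p)"
      using key[OF subsetD[OF b1 p]] by (simp_all add: add_eq_0_iff2)
    show "partial_x \<kappa>2 p = tan (\<phi> p) * partial_x s2 p" using nz[OF p] k(1) by (simp add: tan field_simps)
    show "partial_y \<kappa>2 p = - cot (\<phi> p) * partial_y s2 p" using nz[OF p] k(2) by (simp add: cot field_simps)
  qed
  have rep: "Q *v r p = radius_vector \<kappa>1 s1 \<kappa>2 s2 A p \<and> Q *v n p = normal_vector \<kappa>1 s1 p" if "p \<in> ?b" for p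
    using rec(5)[of p] nv[OF subsetD[OF b1 that]] by (simp add: r'_def n'_def)
  have bU: "?b \<subseteq> U" using b1 U1(2) by blast
  have tr: "\<forall>p\<in>?b. sin (\<phi> p) * cos (\<phi> p) \<noteq> 0"
    and rp: "\<forall>p\<in>?b. Q *v r p = radius_vector \<kappa>1 s1 \<kappa>2 s2 A p \<and> Q *v n p = normal_vector \<kappa>1 s1 p"
    using trig rep by blast+
  show ?thesis
    by (rule exI[of _ e], rule exI[of _ Q], rule exI[of _ \<phi>], rule exI[of _ \<kappa>1], rule exI[of _ s1],
        rule exI[of _ \<kappa>2], rule exI[of _ s2], rule exI[of _ A])
      (rule e(1) bU \<phi> tr S1 S2 smooth_on_subset[OF rec(3) b1] is_potential_subset[OF rec(4) b1] Q(1) rp conjI)+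
qed

subsection \<open>Existence of curvature line coordinates\<close>

text \<open>Simultaneous diagonalization of two quadratic forms, the first positive definite. The
  quadratic with coefficients \<open>a, b, c\<close> is the classical equation of the lines of
  curvature; its zeros \<open>v\<close> are the vectors conjugate, for the second form, to their own
  orthogonal complement \<open>w\<close>.\<close>

lemma simultaneous_orthogonal_basis:
  fixes E F G L M K :: real
  assumes E: "E > 0" and EG: "E * G - F * F > 0"
  shows "\<exists>v1 v2 w1 w2. v1 * w2 - v2 * w1 \<noteq> 0 \<and>
    E * (v1 * w1) + F * (v1 * w2 + v2 * w1) + G * (v2 * w2) = 0 \<and>
    L * (v1 * w1) + M * (v1 * w2 + v2 * w1) + K * (v2 * w2) = 0"
proof -
  define a b c where "a = E * M - F * L" and "b = E * K - G * L" and "c = F * K - G * M"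
  \<comment> \<open>\<open>E^2\<close> times the discriminant is a square plus
    \<open>4 a^2 (E G - F^2)\<close>, so a real root exists.\<close>
  have "E * E * (b * b - 4 * a * c) = (E * b - 2 * a * F) * (E * b - 2 * a * F) + 4 * (a * a) * (E * G - F * F)"
    unfolding a_def b_def c_def by algebra
  moreover have "\<dots> \<ge> 0"
    using EG mult_nonneg_nonneg[of "4 * (a * a)" "E * G - F * F"] by (intro add_nonneg_nonneg) auto
  ultimately have disc: "b * b - 4 * a * c \<ge> 0"
    using E by (metis mult_pos_pos zero_le_mult_iff not_less)
  obtain v1 v2 where v: "v1 \<noteq> 0 \<or> v2 \<noteq> 0" "a * (v1 * v1) + b * (v1 * v2) + c * (v2 * v2) = 0"
  proof (cases "a = 0")
    case True
    then show thesis using that[of 1 0] by simp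
  next
    case False
    define d where "d = sqrt (b * b - 4 * a * c)"
    have "d * d = b * b - 4 * a * c" using disc by (simp add: d_def)
    then have "a * ((d - b) * (d - b)) + b * ((d - b) * (2 * a)) + c * ((2 * a) * (2 * a)) = 0" by algebra
    then show thesis using that[of "d - b" "2 * a"] False by simp
  qed
  \<comment> \<open>The quarter turn of the covector \<open>(E v1 + F v2, F v1 + G v2)\<close>,
    which makes orthogonality for the first form automatic.\<close>
  define w1 w2 where "w1 = - (F * v1 + G * v2)" and "w2 = E * v1 + F * v2"
  have "E * (v1 * w2 - v2 * w1) = (E * v1 + F * v2) * (E * v1 + F * v2) + (E * G - F * F) * (v2 * v2)"
    unfolding w1_def w2_def by algebra
  moreover have "\<dots> > 0"
  proof (cases "v2 = 0")
    case True
    then have "E * v1 \<noteq> 0" using v(1) E by simp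
    then have "0 < (E * v1) * (E * v1)" by (metis not_real_square_gt_zero)
    then show ?thesis using True by simp
  next
    case False
    then have "0 < v2 * v2" by (metis not_real_square_gt_zero)
    then have "(E * G - F * F) * (v2 * v2) > 0" by (rule mult_pos_pos[OF EG])
    then show ?thesis by (simp add: add_nonneg_pos)
  qed
  ultimately have "v1 * w2 - v2 * w1 \<noteq> 0" by force
  moreover have "E * (v1 * w1) + F * (v1 * w2 + v2 * w1) + G * (v2 * w2) = 0"
    unfolding w1_def w2_def by algebra
  moreover have "L * (v1 * w1) + M * (v1 * w2 + v2 * w1) + K * (v2 * w2) = 0"
    using v(2) unfolding w1_def w2_def a_def b_def c_def by algebra
  ultimately show ?thesis by blast
qed

lemma plane_decomposition:
  fixes v w x :: "real \<times> real"
  assumes "fst v * snd w - snd v * fst w \<noteq> 0"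
  obtains \<alpha> \<beta> where "x = \<alpha> *\<^sub>R v + \<beta> *\<^sub>R w"
proof -
  define j where "j = fst v * snd w - snd v * fst w"
  have "x = ((fst x * snd w - snd x * fst w) / j) *\<^sub>R v + ((fst v * snd x - snd v * fst x) / j) *\<^sub>R w"
    using assms unfolding j_def[symmetric] prod_eq_iff
    by (simp add: add_divide_distrib[symmetric] nonzero_eq_divide_eq) (simp add: j_def algebra_simps)
  then show thesis using that by blast
qed

text \<open>If the fourth expression vanished, \<open>dR v \<bullet> dN v\<close> and
  \<open>dR w \<bullet> dN w\<close> would be the same multiple of the squared lengths, the two
  forms would be proportional and the point umbilic. So the two multiples differ, they are not both
  zero, and exchanging \<open>v\<close> and \<open>w\<close> if necessary secures the last
  condition, which later gives \<open>n_x \<noteq> 0\<close>.\<close>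

lemma principal_directions_at_nonumbilic:
  assumes s: "surface W R N" and q: "q \<in> W" and nu: "\<not> umbilic_at R N q"
  defines "dR \<equiv> deriv_at R q" and "dN \<equiv> deriv_at N q"
  obtains v w where "fst v * snd w - snd v * fst w \<noteq> 0" "dR v \<bullet> dR w = 0" "dR v \<bullet> dN w = 0"
    "(dR v \<bullet> dR v) * (dR w \<bullet> dN w) - (dR w \<bullet> dR w) * (dR v \<bullet> dN v) \<noteq> 0" "dR v \<bullet> dN v \<noteq> 0"
proof -
  have W: "open W" and R: "smooth_on W R" and N: "smooth_on W N" and imm: "immersion_at R q"
    and tang: "\<And>p h. p \<in> W \<Longrightarrow> N p \<bullet> deriv_at R p h = 0"
    using s q by (auto simp: surface_def)
  have lR: "linear dR" and lN: "linear dN"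
    unfolding dR_def dN_def using has_derivative_linear smooth_on_has_derivative R N q by blast+
  note lin = linear_add[OF lR] linear_add[OF lN] linear_cmul[OF lR] linear_cmul[OF lN]
  have inj: "dR h = 0 \<Longrightarrow> h = 0" for h
    using imm linear_injective_0[OF lR] unfolding immersion_at_def dR_def by blast
  have sym: "dR u \<bullet> dN v = dR v \<bullet> dN u" for u v
    unfolding dR_def dN_def by (rule weingarten_symmetric[OF s q])
  define E F G where "E = dR (1, 0) \<bullet> dR (1, 0)" and "F = dR (1, 0) \<bullet> dR (0, 1)" and "G = dR (0, 1) \<bullet> dR (0, 1)"
  define L M K where "L = dR (1, 0) \<bullet> dN (1, 0)" and "M = dR (1, 0) \<bullet> dN (0, 1)" and "K = dR (0, 1) \<bullet> dN (0, 1)"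
  have dec: "h = fst h *\<^sub>R (1, 0) + snd h *\<^sub>R (0, 1)" for h :: "real \<times> real" by (simp add: prod_eq_iff)
  have dR: "dR h = fst h *\<^sub>R dR (1, 0) + snd h *\<^sub>R dR (0, 1)" and dN: "dN h = fst h *\<^sub>R dN (1, 0) + snd h *\<^sub>R dN (0, 1)" for h
    using dec[of h] lin by metis+
  have gexp: "dR u \<bullet> dR v = E * (fst u * fst v) + F * (fst u * snd v + snd u * fst v) + G * (snd u * snd v)" for u v
    unfolding dR[of u] dR[of v] E_def F_def G_def
    by (simp add: inner_add_left inner_add_right inner_commute[of "dR (0, 1)" "dR (1, 0)"] algebra_simps)
  have sexp: "dR u \<bullet> dN v = L * (fst u * fst v) + M * (fst u * snd v + snd u * fst v) + K * (snd u * snd v)" for u v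
    unfolding dR[of u] dN[of v] L_def M_def K_def
    by (simp add: inner_add_left inner_add_right sym[of "(0, 1)" "(1, 0)"] algebra_simps)
  have gpos: "dR h \<bullet> dR h > 0" if "h \<noteq> 0" for h
    using inj[of h] that inner_gt_zero_iff[of "dR h"] by blast
  have E: "E > 0" using gpos[of "(1, 0)"] by (simp add: E_def zero_prod_def)
  \<comment> \<open>\<open>(- F, E)\<close> is orthogonal to (1, 0) for the first form and has
    squared length \<open>E (E G - F^2)\<close>; hence the Gram determinant is positive.\<close>
  have "dR (- F, E) \<bullet> dR (- F, E) > 0" using E by (intro gpos) (simp add: zero_prod_def)
  then have "E * (E * G - F * F) > 0" unfolding gexp by (simp add: algebra_simps)
  then have EG: "E * G - F * F > 0" using E by (simp add: zero_less_mult_iff)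
  obtain v1 v2 w1 w2 where *: "v1 * w2 - v2 * w1 \<noteq> 0"
    "E * (v1 * w1) + F * (v1 * w2 + v2 * w1) + G * (v2 * w2) = 0"
    "L * (v1 * w1) + M * (v1 * w2 + v2 * w1) + K * (v2 * w2) = 0"
    using simultaneous_orthogonal_basis[OF E EG] by blast
  define v w where "v = (v1, v2)" and "w = (w1, w2)"
  have det: "fst v * snd w - snd v * fst w \<noteq> 0" and vw: "dR v \<bullet> dR w = 0" "dR v \<bullet> dN w = 0"
    using * unfolding gexp sexp by (simp_all add: v_def w_def)
  have wv: "dR w \<bullet> dR v = 0" "dR w \<bullet> dN v = 0" using vw sym[of w v] by (simp_all add: inner_commute)
  have nb: "(dR v \<bullet> dR v) * (dR w \<bullet> dN w) - (dR w \<bullet> dR w) * (dR v \<bullet> dN v) \<noteq> 0"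
  proof
    assume z: "(dR v \<bullet> dR v) * (dR w \<bullet> dN w) - (dR w \<bullet> dR w) * (dR v \<bullet> dN v) = 0"
    have "v \<noteq> 0" using det by (auto simp: zero_prod_def)
    then have gv: "dR v \<bullet> dR v \<noteq> 0" using gpos[of v] by simp
    define t where "t = (dR v \<bullet> dN v) / (dR v \<bullet> dR v)"
    have tv: "dR v \<bullet> dN v = t * (dR v \<bullet> dR v)" and tw: "dR w \<bullet> dN w = t * (dR w \<bullet> dR w)"
      using gv z by (simp_all add: t_def field_simps)
    have "dR x \<bullet> dN y = t * (dR x \<bullet> dR y)" for x y
    proof -
      obtain \<alpha> \<beta> where x: "x = \<alpha> *\<^sub>R v + \<beta> *\<^sub>R w" by (rule plane_decomposition[OF det])
      obtain \<gamma> \<delta> where y: "y = \<gamma> *\<^sub>R v + \<delta> *\<^sub>R w" by (rule plane_decomposition[OF det])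
      show ?thesis
        unfolding x y lin
        by (simp add: inner_add_left inner_add_right vw wv tv tw algebra_simps)
    qed
    then have "second_form R N q x y = (- t) * first_form R q x y" for x y
      using second_form_eq[OF W R N q tang] by (simp add: first_form_def dR_def dN_def)
    then show False using nu unfolding umbilic_at_def by blast
  qed
  show thesis
  proof (cases "dR v \<bullet> dN v = 0")
    case False
    then show ?thesis using that[OF det vw nb] by blast
  next
    case True
    then have "dR w \<bullet> dN w \<noteq> 0" using nb by auto
    moreover have "fst w * snd v - snd w * fst v \<noteq> 0" using det by (simp add: mult.commute)
    moreover have "(dR w \<bullet> dR w) * (dR v \<bullet> dN v) - (dR v \<bullet> dR v) * (dR w \<bullet> dN w) \<noteq> 0" using nb by simp
    ultimately show ?thesis using that[of w v] wv by blast
  qed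
qed

text \<open>In a basis close to the principal one, the principal directions are \<open>v + m w\<close> and \<open>w + k v\<close>
  with \<open>m\<close> and \<open>k\<close> the small roots of \<open>a + b m + c m\<^sup>2 = 0\<close> and \<open>c + b k + a k\<^sup>2 = 0\<close>.\<close>

lemma conjugate_small_roots:
  fixes E F G L M K :: real
  defines "a \<equiv> E * M - F * L" and "b \<equiv> E * K - G * L" and "c \<equiv> F * K - G * M"
  assumes b: "b \<noteq> 0" and T: "1 - 4 * a * c / (b * b) \<ge> 0"
  defines "\<tau> \<equiv> 1 + sqrt (1 - 4 * a * c / (b * b))"
  defines "m \<equiv> - 2 * a / (b * \<tau>)" and "k \<equiv> - 2 * c / (b * \<tau>)"
  shows "k * E + F + m * k * F + m * G = 0" "k * L + M + m * k * M + m * K = 0"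
proof -
  have \<tau>: "\<tau> > 0" using T by (simp add: \<tau>_def add_pos_nonneg)
  have "(\<tau> - 1) * (\<tau> - 1) = 1 - 4 * a * c / (b * b)" using T by (simp add: \<tau>_def)
  then have "(\<tau> - 1) * (\<tau> - 1) * (b * b) = b * b - 4 * a * c" using b by (simp add: field_simps)
  then have t: "(b * \<tau>) * (b * \<tau>) + 4 * a * c = 2 * b * (b * \<tau>)" by algebra
  have nz: "b * \<tau> \<noteq> 0" using b \<tau> by simp
  have m: "m * (b * \<tau>) = - 2 * a" and k: "k * (b * \<tau>) = - 2 * c" using nz by (simp_all add: m_def k_def)
  \<comment> \<open>The left side is the value on \<open>v + m w\<close> and \<open>w + k v\<close>
    of the symmetric form with coefficients \<open>x, y, z\<close>. For \<open>E, F, G\<close> and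
    for \<open>L, M, K\<close> the side condition holds because \<open>c x - b y + a z\<close> is a
    3 by 3 determinant with a repeated row.\<close>
  have root: "k * x + y + m * k * y + m * z = 0" if "y * b - c * x - a * z = 0" for x y z
  proof -
    have "((b * \<tau>) * (b * \<tau>)) * (k * x + y + m * k * y + m * z) =
       (b * \<tau>) * (k * (b * \<tau>)) * x + y * ((b * \<tau>) * (b * \<tau>) + (m * (b * \<tau>)) * (k * (b * \<tau>))) + (b * \<tau>) * (m * (b * \<tau>)) * z"
      by (simp only: algebra_simps)
    also have "\<dots> = (b * \<tau>) * (- 2 * c) * x + y * ((b * \<tau>) * (b * \<tau>) + 4 * a * c) + (b * \<tau>) * (- 2 * a) * z"
      unfolding m k by simp
    also have "\<dots> = 2 * (b * \<tau>) * (y * b - c * x - a * z)" unfolding t by (simp add: algebra_simps)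
    finally show ?thesis using nz that by (metis mult_eq_0_iff)
  qed
  show "k * E + F + m * k * F + m * G = 0" "k * L + M + m * k * M + m * K = 0"
    by (rule root, unfold a_def b_def c_def, algebra)+
qed

lemma diffeomorphism_on_restrict:
  fixes \<psi> :: "'a::real_normed_vector \<Rightarrow> 'b::real_normed_vector"
  assumes d: "diffeomorphism_on U V \<psi>" and V: "open V" and S: "open S" "S \<subseteq> U"
  shows "open (\<psi> ` S)" "diffeomorphism_on S (\<psi> ` S) \<psi>"
proof -
  have bij: "bij_betw \<psi> U V" and sm: "smooth_on U \<psi>" and inv: "smooth_on V (inv_into U \<psi>)"
    using d by (auto simp: diffeomorphism_on_def)
  have SV: "\<psi> ` S \<subseteq> V" using bij S(2) by (auto simp: bij_betw_def)
  have inj: "inj_on \<psi> U" using bij by (simp add: bij_betw_def)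
  have invS: "inv_into U \<psi> (\<psi> x) = x" if "x \<in> U" for x using inj that by simp
  have "\<psi> ` S = V \<inter> inv_into U \<psi> -` S"
  proof (intro equalityI subsetI)
    fix y assume "y \<in> \<psi> ` S"
    then show "y \<in> V \<inter> inv_into U \<psi> -` S" using SV S(2) invS by auto
  next
    fix y assume y: "y \<in> V \<inter> inv_into U \<psi> -` S"
    then have "y = \<psi> (inv_into U \<psi> y)" using bij by (simp add: bij_betw_def f_inv_into_f)
    then show "y \<in> \<psi> ` S" using y by blast
  qed
  then show op: "open (\<psi> ` S)"
    using continuous_open_preimage[OF smooth_on_imp_continuous_on[OF inv] V S(1)] by simp
  have "smooth_on (\<psi> ` S) (inv_into S \<psi>)"
  proof (rule smooth_on_cong[OF op _ smooth_on_subset[OF inv SV]])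
    fix y assume "y \<in> \<psi> ` S"
    then obtain x where x: "x \<in> S" "y = \<psi> x" by blast
    then show "inv_into U \<psi> y = inv_into S \<psi> y"
      using invS[of x] S(2) inv_into_f_f[OF inj_on_subset[OF inj S(2)] x(1)] by auto
  qed
  then show "diffeomorphism_on S (\<psi> ` S) \<psi>"
    using smooth_on_subset[OF sm S(2)] inj_on_subset[OF inj S(2)]
    by (simp add: diffeomorphism_on_def bij_betw_def)
qed

text \<open>The basis \<open>v, w\<close> is principal at \<open>q\<close> only and stays fixed.
  Nearby, the principal directions are \<open>v + m w\<close> and \<open>w + k v\<close> with smooth
  coefficients vanishing at \<open>q\<close>. As \<open>u2\<close> is a first integral of the former
  field and \<open>u1\<close> of the latter, \<open>u1\<close> can serve as coordinate along
  \<open>v + m w\<close>.\<close>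

lemma principal_coordinate_functions:
  assumes s: "surface W R N" and q: "q \<in> W"
    and det: "fst v * snd w - snd v * fst w \<noteq> 0"
    and vw: "deriv_at R q v \<bullet> deriv_at R q w = 0"
      "deriv_at R q v \<bullet> deriv_at N q w = 0"
    and nb: "(deriv_at R q v \<bullet> deriv_at R q v) * (deriv_at R q w \<bullet> deriv_at N q w)
      - (deriv_at R q w \<bullet> deriv_at R q w) * (deriv_at R q v \<bullet> deriv_at N q v) \<noteq> 0"
  shows "\<exists>V m k (u1 :: real \<times> real \<Rightarrow> real) (u2 :: real \<times> real \<Rightarrow> real).
    open V \<and> q \<in> V \<and> V \<subseteq> W \<and> smooth_on V u1 \<and> smooth_on V u2 \<and> m q = 0 \<and> k q = 0 \<and>
    (\<forall>p\<in>V. deriv_at u2 p (v + m p *\<^sub>R w) = 0 \<and> deriv_at u2 p w \<noteq> 0 \<and>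
      deriv_at u1 p (w + k p *\<^sub>R v) = 0 \<and> deriv_at u1 p v \<noteq> 0 \<and>
      deriv_at R p (v + m p *\<^sub>R w) \<bullet> deriv_at R p (w + k p *\<^sub>R v) = 0 \<and>
      deriv_at R p (v + m p *\<^sub>R w) \<bullet> deriv_at N p (w + k p *\<^sub>R v) = (0 :: real))"
proof -
  have W: "open W" and R: "smooth_on W R" and N: "smooth_on W N" using s by (auto simp: surface_def)
  let ?R = "\<lambda>p. deriv_at R p" and ?N = "\<lambda>p. deriv_at N p"
  define E F G where "E p = ?R p v \<bullet> ?R p v" and "F p = ?R p v \<bullet> ?R p w" and "G p = ?R p w \<bullet> ?R p w" for p
  define L M K where "L p = ?R p v \<bullet> ?N p v" and "M p = ?R p v \<bullet> ?N p w" and "K p = ?R p w \<bullet> ?N p w" for p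
  have sm: "smooth_on W E" "smooth_on W F" "smooth_on W G" "smooth_on W L" "smooth_on W M" "smooth_on W K"
    unfolding E_def F_def G_def L_def M_def K_def smooth_on_def
    by (intro allI differentiable_times_on_inner W smooth_onD smooth_on_frechet_derivative R N)+
  define a b c where "a p = E p * M p - F p * L p" and "b p = E p * K p - G p * L p" and "c p = F p * K p - G p * M p" for p
  have abc: "smooth_on W a" "smooth_on W b" "smooth_on W c"
    unfolding a_def b_def c_def smooth_on_def
    by (intro allI differentiable_times_on_diff differentiable_times_on_mult W smooth_onD sm)+
  \<comment> \<open>\<open>a\<close> and \<open>c\<close> vanish because \<open>v, w\<close> is
    principal at \<open>q\<close>; \<open>b q \<noteq> 0\<close> expresses that the point is not
    umbilic.\<close>
  have q0: "a q = 0" "c q = 0" "b q \<noteq> 0"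
    using vw nb by (simp_all add: a_def b_def c_def E_def F_def G_def L_def M_def K_def)
  define W1 where "W1 = {p \<in> W. b p \<noteq> 0}"
  have W1: "open W1" "q \<in> W1" "W1 \<subseteq> W"
    using open_nonzero_set[OF W smooth_on_imp_continuous_on[OF abc(2)]] q q0 by (auto simp: W1_def)
  have abc1: "smooth_on W1 a" "smooth_on W1 b" "smooth_on W1 c" using abc W1(3) smooth_on_subset by blast+
  define T where "T p = 1 - 4 * a p * c p / (b p * b p)" for p
  have T: "smooth_on W1 T"
    unfolding T_def smooth_on_def
    by (intro allI differentiable_times_on_intros W1(1) smooth_onD abc1) (simp add: W1_def)
  define W2 where "W2 = W1 \<inter> T -` {0<..}"
  have W2: "open W2" "q \<in> W2" "W2 \<subseteq> W1"
    using continuous_open_preimage[OF smooth_on_imp_continuous_on[OF T] W1(1), of "{0<..}"] W1(2) q0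
    by (auto simp: W2_def T_def)
  define \<tau> where "\<tau> p = 1 + sqrt (T p)" for p
  have "smooth_on W2 (\<lambda>p. sqrt (T p))"
    by (rule smooth_on_compose[OF W2(1) smooth_on_sqrt smooth_on_subset[OF T W2(3)]]) (auto simp: W2_def)
  then have \<tau>: "smooth_on W2 \<tau>"
    unfolding \<tau>_def smooth_on_def
    by (intro allI differentiable_times_on_add differentiable_times_on_const W2(1)) auto
  have nz: "b p * \<tau> p \<noteq> 0" if "p \<in> W2" for p
  proof -
    have "b p \<noteq> 0" "T p > 0" using that by (auto simp: W2_def W1_def)
    then have "\<tau> p > 0" unfolding \<tau>_def by (simp add: add_pos_nonneg)
    with \<open>b p \<noteq> 0\<close> show ?thesis by simp
  qed
  have abc2: "smooth_on W2 a" "smooth_on W2 b" "smooth_on W2 c" using abc1 W2(3) smooth_on_subset by blast+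
  \<comment> \<open>The quadratic formula with the root in the denominator: it stays smooth across
    zeros of \<open>a\<close>, in particular at \<open>q\<close>, where
    \<open>b \<tau> = 2 b \<noteq> 0\<close>.\<close>
  define m where "m p = - 2 * a p / (b p * \<tau> p)" for p
  define k where "k p = - 2 * c p / (b p * \<tau> p)" for p
  have quot: "smooth_on W2 (\<lambda>p. - 2 * f p / (b p * \<tau> p))" if "smooth_on W2 f" for f
    unfolding smooth_on_def
    by (intro allI differentiable_times_on_divide differentiable_times_on_mult differentiable_times_on_const
        W2(1) smooth_onD abc2(2) that \<tau> nz)
  have mk: "smooth_on W2 m" "smooth_on W2 k"
    unfolding m_def k_def using quot abc2(1,3) by blast+
  obtain V2 and u2 :: "real \<times> real \<Rightarrow> real" where V2: "open V2" "q \<in> V2" "V2 \<subseteq> W2" "smooth_on V2 u2"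
    and u2: "\<And>p. p \<in> V2 \<Longrightarrow> deriv_at u2 p (v + m p *\<^sub>R w) = 0"
      "\<And>p. p \<in> V2 \<Longrightarrow> deriv_at u2 p w \<noteq> 0"
    using first_integral_in_basis[OF W2(1,2) mk(1) det] by blast
  have det': "fst w * snd v - snd w * fst v \<noteq> 0" using det by (simp add: mult.commute)
  obtain V1 and u1 :: "real \<times> real \<Rightarrow> real" where V1: "open V1" "q \<in> V1" "V1 \<subseteq> W2" "smooth_on V1 u1"
    and u1: "\<And>p. p \<in> V1 \<Longrightarrow> deriv_at u1 p (w + k p *\<^sub>R v) = 0"
      "\<And>p. p \<in> V1 \<Longrightarrow> deriv_at u1 p v \<noteq> 0"
    using first_integral_in_basis[OF W2(1,2) mk(2) det'] by blast
  define V where "V = V1 \<inter> V2"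
  have V: "open V" "q \<in> V" "V \<subseteq> W2" using V1 V2 by (auto simp: V_def)
  have smu: "smooth_on V u1" "smooth_on V u2"
    using smooth_on_subset[OF V1(4)] smooth_on_subset[OF V2(4)] by (auto simp: V_def)
  have conj: "?R p (v + m p *\<^sub>R w) \<bullet> ?R p (w + k p *\<^sub>R v) = 0"
    "?R p (v + m p *\<^sub>R w) \<bullet> ?N p (w + k p *\<^sub>R v) = 0" if "p \<in> W2" for p
  proof -
    have pW: "p \<in> W" using that W2(3) W1(3) by blast
    have "b p \<noteq> 0" "T p > 0" using that by (auto simp: W2_def W1_def)
    then have "b p \<noteq> 0" "0 \<le> T p" by simp_all
    note roots = conjugate_small_roots[where E = "E p" and F = "F p" and G = "G p" and L = "L p" and M = "M p" and K = "K p",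
        folded a_def b_def c_def, folded T_def, OF this, folded \<tau>_def, folded m_def k_def]
    have lR: "linear (?R p)" and lN: "linear (?N p)"
      using has_derivative_linear smooth_on_has_derivative R N pW by blast+
    note lin = linear_add[OF lR] linear_add[OF lN] linear_cmul[OF lR] linear_cmul[OF lN]
    have sym: "?R p w \<bullet> ?N p v = M p" unfolding M_def by (rule weingarten_symmetric[OF s pW])
    show "?R p (v + m p *\<^sub>R w) \<bullet> ?R p (w + k p *\<^sub>R v) = 0"
      using roots(1) unfolding lin E_def F_def G_def
      by (simp add: inner_add_left inner_add_right inner_commute[of "?R p w" "?R p v"] algebra_simps)
    show "?R p (v + m p *\<^sub>R w) \<bullet> ?N p (w + k p *\<^sub>R v) = 0"
      using roots(2) unfolding lin
      by (simp add: inner_add_left inner_add_right sym L_def[symmetric] M_def[symmetric] K_def[symmetric] algebra_simps)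
  qed
  have VW: "V \<subseteq> W" using V(3) W2(3) W1(3) by blast
  have mkq: "m q = 0" "k q = 0" by (simp_all add: m_def k_def q0)
  show ?thesis
    by (rule exI[of _ V], rule exI[of _ m], rule exI[of _ k], rule exI[of _ u1], rule exI[of _ u2])
      (intro conjI ballI V(1,2) VW smu mkq u1 u2 conj; use V(3) V_def in blast)
qed

text \<open>The inverse \<open>\<psi>\<close> of \<open>\<Phi> = (u1, u2)\<close> sends the
  \<open>x\<close>-lines into level sets of \<open>u2\<close>, which follow \<open>v + m w\<close>,
  and the \<open>y\<close>-lines into level sets of \<open>u1\<close>, which follow
  \<open>w + k v\<close>.\<close>

lemma curvature_line_coordinates:
  assumes s: "surface W R N" and q: "q \<in> W" and nu: "\<not> umbilic_at R N q"
  shows "\<exists>U V \<psi> z0. open U \<and> open V \<and> V \<subseteq> W \<and> diffeomorphism_on U V \<psi> \<and>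
    curvature_line_surface U (R \<circ> \<psi>) (N \<circ> \<psi>) \<and> z0 \<in> U \<and> \<psi> z0 = q \<and> partial_x (N \<circ> \<psi>) z0 \<noteq> 0"
proof -
  have W: "open W" and R: "smooth_on W R" and N: "smooth_on W N"
    and imm: "\<And>p. p \<in> W \<Longrightarrow> immersion_at R p" and norm: "\<And>p. p \<in> W \<Longrightarrow> norm (N p) = 1"
    and tang: "\<And>p h. p \<in> W \<Longrightarrow> N p \<bullet> deriv_at R p h = 0"
    using s by (auto simp: surface_def)
  let ?R = "\<lambda>p. deriv_at R p" and ?N = "\<lambda>p. deriv_at N p"
  obtain v w where det: "fst v * snd w - snd v * fst w \<noteq> 0" and vw: "?R q v \<bullet> ?R q w = 0" "?R q v \<bullet> ?N q w = 0"
    and nb: "(?R q v \<bullet> ?R q v) * (?R q w \<bullet> ?N q w) - (?R q w \<bullet> ?R q w) * (?R q v \<bullet> ?N q v) \<noteq> 0"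
    and nv: "?R q v \<bullet> ?N q v \<noteq> 0"
    using principal_directions_at_nonumbilic[OF s q nu] by blast
  obtain V0 m k and u1 u2 :: "real \<times> real \<Rightarrow> real" where V0: "open V0" "q \<in> V0" "V0 \<subseteq> W"
    and u: "smooth_on V0 u1" "smooth_on V0 u2" and mkq: "m q = 0" "k q = 0"
    and all: "\<forall>p\<in>V0. deriv_at u2 p (v + m p *\<^sub>R w) = 0 \<and> deriv_at u2 p w \<noteq> 0 \<and>
      deriv_at u1 p (w + k p *\<^sub>R v) = 0 \<and> deriv_at u1 p v \<noteq> 0 \<and>
      ?R p (v + m p *\<^sub>R w) \<bullet> ?R p (w + k p *\<^sub>R v) = 0 \<and> ?R p (v + m p *\<^sub>R w) \<bullet> ?N p (w + k p *\<^sub>R v) = 0"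
    using principal_coordinate_functions[OF s q det vw nb] by blast
  define \<Phi> where "\<Phi> p = (u1 p, u2 p)" for p
  have \<Phi>: "smooth_on V0 \<Phi>"
    unfolding \<Phi>_def smooth_on_def by (intro allI differentiable_times_on_Pair V0(1) smooth_onD u)
  have d\<Phi>: "(\<Phi> has_derivative (\<lambda>h. (deriv_at u1 p h, deriv_at u2 p h))) (at p)" if "p \<in> V0" for p
    unfolding \<Phi>_def by (intro has_derivative_Pair smooth_on_has_derivative[OF _ that] u)
  have \<Phi>xy: "partial_x \<Phi> p = (partial_x u1 p, partial_x u2 p)" "partial_y \<Phi> p = (partial_y u1 p, partial_y u2 p)" if "p \<in> V0" for p
    using frechet_derivative_at[OF d\<Phi>[OF that], symmetric] by (auto simp: partial_x_def partial_y_def)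
  \<comment> \<open>In the basis \<open>v, w\<close> the differential of \<open>\<Phi>\<close> at
    \<open>q\<close> is diagonal, since \<open>m\<close> and \<open>k\<close> vanish there.\<close>
  have J: "fst (partial_x \<Phi> q) * snd (partial_y \<Phi> q) - snd (partial_x \<Phi> q) * fst (partial_y \<Phi> q) \<noteq> 0"
  proof -
    have e: "deriv_at u1 q h = fst h * partial_x u1 q + snd h * partial_y u1 q"
      "deriv_at u2 q h = fst h * partial_x u2 q + snd h * partial_y u2 q" for h
      using frechet_derivative_plane[OF u(1) V0(2)] frechet_derivative_plane[OF u(2) V0(2)] by simp_all
    have "deriv_at u1 q w = 0" "deriv_at u2 q v = 0"
      "deriv_at u1 q v \<noteq> 0" "deriv_at u2 q w \<noteq> 0"
      using all V0(2) mkq by force+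
    then have "deriv_at u1 q v * deriv_at u2 q w
        - deriv_at u2 q v * deriv_at u1 q w \<noteq> 0" by simp
    moreover have "deriv_at u1 q v * deriv_at u2 q w
        - deriv_at u2 q v * deriv_at u1 q w =
      (partial_x u1 q * partial_y u2 q - partial_x u2 q * partial_y u1 q) * (fst v * snd w - snd v * fst w)"
      unfolding e by (simp add: algebra_simps)
    ultimately show ?thesis by (auto simp: \<Phi>xy[OF V0(2)])
  qed
  obtain V U \<psi> where V: "open V" "V \<subseteq> V0" "q \<in> V" and U: "open U" "\<Phi> q \<in> U"
    and hom: "homeomorphism V U \<Phi> \<psi>" and \<psi>: "smooth_on U \<psi>"
    using smooth_local_inverse_plane[OF V0(1) \<Phi> V0(2) J] by blast
  have \<psi>V: "\<psi> z \<in> V" and \<Phi>\<psi>: "\<Phi> (\<psi> z) = z" if "z \<in> U" for z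
    using hom that by (auto simp: homeomorphism_def)
  have \<psi>\<Phi>: "\<psi> (\<Phi> p) = p" "\<Phi> p \<in> U" if "p \<in> V" for p
    using hom that by (auto simp: homeomorphism_def)
  have bij: "bij_betw \<psi> U V"
    by (rule bij_betwI[where g = \<Phi>]) (use \<psi>V \<Phi>\<psi> \<psi>\<Phi> in auto)
  have "smooth_on V (inv_into U \<psi>)"
  proof (rule smooth_on_cong[OF V(1) _ smooth_on_subset[OF \<Phi> V(2)]])
    fix p assume p: "p \<in> V"
    show "\<Phi> p = inv_into U \<psi> p"
      using bij \<psi>\<Phi>[OF p] by (metis bij_betw_def inv_into_f_f)
  qed
  then have diff: "diffeomorphism_on U V \<psi>" using bij \<psi> by (simp add: diffeomorphism_on_def)
  define D where "D z = deriv_at \<psi> z" for z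
  have d\<psi>: "(\<psi> has_derivative D z) (at z)" if "z \<in> U" for z
    unfolding D_def by (rule smooth_on_has_derivative[OF \<psi> that])
  have VW: "V \<subseteq> W" using V(2) V0(3) by blast
  have du: "deriv_at u1 (\<psi> z) (D z h) = fst h" "deriv_at u2 (\<psi> z) (D z h) = snd h" if z: "z \<in> U" for z h
  proof -
    have "((\<lambda>z. \<Phi> (\<psi> z)) has_derivative (\<lambda>h. (deriv_at u1 (\<psi> z) (D z h), deriv_at u2 (\<psi> z) (D z h)))) (at z)"
      by (rule has_derivative_compose[OF d\<psi>[OF z] d\<Phi>]) (use \<psi>V[OF z] V(2) in blast)
    moreover have "((\<lambda>z. \<Phi> (\<psi> z)) has_derivative (\<lambda>h. h)) (at z)"
      by (rule has_derivative_transform_within_open[OF has_derivative_ident U(1) z]) (simp add: \<Phi>\<psi>)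
    ultimately have "(\<lambda>h. (deriv_at u1 (\<psi> z) (D z h), deriv_at u2 (\<psi> z) (D z h))) = (\<lambda>h. h)"
      by (rule has_derivative_unique)
    from fun_cong[OF this, of h]
    show "deriv_at u1 (\<psi> z) (D z h) = fst h" "deriv_at u2 (\<psi> z) (D z h) = snd h"
      by (auto simp: prod_eq_iff)
  qed
  have dirs: "\<exists>\<alpha>. D z (1, 0) = \<alpha> *\<^sub>R (v + m (\<psi> z) *\<^sub>R w)" "\<exists>\<beta>. D z (0, 1) = \<beta> *\<^sub>R (w + k (\<psi> z) *\<^sub>R v)" if z: "z \<in> U" for z
  proof -
    let ?p = "\<psi> z"
    have p: "?p \<in> V0" using \<psi>V[OF z] V(2) by blast
    have l: "linear (deriv_at u1 ?p)" "linear (deriv_at u2 ?p)"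
      using has_derivative_linear[OF smooth_on_has_derivative[OF u(1) p]] has_derivative_linear[OF smooth_on_has_derivative[OF u(2) p]] .
    note lin = linear_add[OF l(1)] linear_add[OF l(2)] linear_cmul[OF l(1)] linear_cmul[OF l(2)]
    have f: "deriv_at u2 ?p v + m ?p * deriv_at u2 ?p w = 0" "deriv_at u2 ?p w \<noteq> 0"
      "deriv_at u1 ?p w + k ?p * deriv_at u1 ?p v = 0" "deriv_at u1 ?p v \<noteq> 0"
      using bspec[OF all p] by (auto simp: lin)
    \<comment> \<open>\<open>du2\<close> annihilates \<open>D z (1, 0)\<close> and
      \<open>v + m w\<close> but not \<open>w\<close>. Its kernel is a line, so the first vector is
      a multiple of the second.\<close>
    obtain \<alpha> \<beta> where e: "D z (1, 0) = \<alpha> *\<^sub>R v + \<beta> *\<^sub>R w" by (rule plane_decomposition[OF det])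
    have "\<alpha> * deriv_at u2 ?p v + \<beta> * deriv_at u2 ?p w = 0"
      using du(2)[OF z, of "(1, 0)"] by (simp add: e lin)
    then have "(\<beta> - \<alpha> * m ?p) * deriv_at u2 ?p w = 0" using f(1) by algebra
    then have "\<beta> = \<alpha> * m ?p" using f(2) by simp
    then show "\<exists>\<alpha>. D z (1, 0) = \<alpha> *\<^sub>R (v + m ?p *\<^sub>R w)" using e by (auto simp: scaleR_add_right)
    obtain \<gamma> \<delta> where e': "D z (0, 1) = \<gamma> *\<^sub>R v + \<delta> *\<^sub>R w" by (rule plane_decomposition[OF det])
    have "\<gamma> * deriv_at u1 ?p v + \<delta> * deriv_at u1 ?p w = 0"
      using du(1)[OF z, of "(0, 1)"] by (simp add: e' lin)
    then have "(\<gamma> - \<delta> * k ?p) * deriv_at u1 ?p v = 0" using f(3) by algebra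
    then have "\<gamma> = \<delta> * k ?p" using f(4) by simp
    then show "\<exists>\<beta>. D z (0, 1) = \<beta> *\<^sub>R (w + k ?p *\<^sub>R v)" using e' by (auto simp: scaleR_add_right add.commute)
  qed
  have chain: "deriv_at (f \<circ> \<psi>) z h = deriv_at f (\<psi> z) (D z h)"
    if f: "smooth_on W f" and z: "z \<in> U" for f :: "real \<times> real \<Rightarrow> real^3" and z h
  proof -
    have "\<psi> z \<in> W" using \<psi>V[OF z] VW by blast
    from has_derivative_compose[OF d\<psi>[OF z] smooth_on_has_derivative[OF f this]]
    have "((f \<circ> \<psi>) has_derivative (\<lambda>h. deriv_at f (\<psi> z) (D z h))) (at z)" by (simp add: o_def)
    from fun_cong[OF frechet_derivative_at[OF this], of h] show ?thesis by simp
  qed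
  have smc: "smooth_on U (f \<circ> \<psi>)" if "smooth_on W f" for f :: "real \<times> real \<Rightarrow> real^3"
    unfolding o_def by (rule smooth_on_compose[OF U(1) that \<psi>]) (use \<psi>V VW in blast)
  have lin: "linear (?R p)" "linear (?N p)" if "p \<in> W" for p
    using has_derivative_linear[OF smooth_on_has_derivative[OF R that]] has_derivative_linear[OF smooth_on_has_derivative[OF N that]] .
  have cls: "curvature_line_surface U (R \<circ> \<psi>) (N \<circ> \<psi>)"
  proof (rule curvature_line_surfaceI[OF U(1) smc[OF R] smc[OF N]])
    fix z assume z: "z \<in> U"
    have pV: "\<psi> z \<in> V0" and pW: "\<psi> z \<in> W" using \<psi>V[OF z] V(2) VW by blast+
    show "norm ((N \<circ> \<psi>) z) = 1" using norm[OF pW] by simp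
    show "(N \<circ> \<psi>) z \<bullet> partial_x (R \<circ> \<psi>) z = 0" "(N \<circ> \<psi>) z \<bullet> partial_y (R \<circ> \<psi>) z = 0"
      using tang[OF pW] by (simp_all add: partial_x_def partial_y_def chain[OF R z])
    obtain \<alpha> \<beta> where e: "D z (1, 0) = \<alpha> *\<^sub>R (v + m (\<psi> z) *\<^sub>R w)" "D z (0, 1) = \<beta> *\<^sub>R (w + k (\<psi> z) *\<^sub>R v)"
      using dirs[OF z] by blast
    have px: "partial_x (R \<circ> \<psi>) z = \<alpha> *\<^sub>R ?R (\<psi> z) (v + m (\<psi> z) *\<^sub>R w)"
      and py: "partial_y (R \<circ> \<psi>) z = \<beta> *\<^sub>R ?R (\<psi> z) (w + k (\<psi> z) *\<^sub>R v)"
      and ny: "partial_y (N \<circ> \<psi>) z = \<beta> *\<^sub>R ?N (\<psi> z) (w + k (\<psi> z) *\<^sub>R v)"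
      unfolding partial_x_def partial_y_def chain[OF R z] chain[OF N z] e
      by (rule linear_cmul[OF lin(1)[OF pW]] linear_cmul[OF lin(2)[OF pW]])+
    show "partial_x (R \<circ> \<psi>) z \<bullet> partial_y (R \<circ> \<psi>) z = 0" "partial_x (R \<circ> \<psi>) z \<bullet> partial_y (N \<circ> \<psi>) z = 0"
      using bspec[OF all pV] by (simp_all add: px py ny)
    have "inj (deriv_at (R \<circ> \<psi>) z)"
    proof (rule injI)
      fix x y assume "deriv_at (R \<circ> \<psi>) z x = deriv_at (R \<circ> \<psi>) z y"
      then have "D z x = D z y"
        using imm[OF pW] unfolding chain[OF R z] immersion_at_def by (meson injD)
      then have "fst x = fst y" "snd x = snd y" using du[OF z, of x] du[OF z, of y] by simp_all
      then show "x = y" by (rule prod_eqI)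
    qed
    then show "immersion_at (R \<circ> \<psi>) z"
      using smooth_on_has_derivative[OF smc[OF R] z] by (auto simp: immersion_at_def differentiable_def)
  qed
  have nx: "partial_x (N \<circ> \<psi>) (\<Phi> q) \<noteq> 0"
  proof -
    have q1: "\<psi> (\<Phi> q) = q" using \<psi>\<Phi>[OF V(3)] by simp
    obtain \<alpha> where e: "D (\<Phi> q) (1, 0) = \<alpha> *\<^sub>R v" using dirs(1)[OF U(2)] mkq(1) q1 by auto
    \<comment> \<open>At \<open>\<Phi> q\<close> one has \<open>du1 (D (1, 0)) = 1\<close>, so
      \<open>D (1, 0) = \<alpha> v\<close> cannot vanish.\<close>
    have "\<alpha> \<noteq> 0"
    proof
      assume "\<alpha> = 0"
      then have "deriv_at u1 q 0 = 1" using du(1)[OF U(2), of "(1, 0)"] e q1 by simp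
      then show False
        using linear_0[OF has_derivative_linear[OF smooth_on_has_derivative[OF u(1) V0(2)]]] by simp
    qed
    moreover have "partial_x (N \<circ> \<psi>) (\<Phi> q) = \<alpha> *\<^sub>R ?N q v"
      unfolding partial_x_def chain[OF N U(2)] e q1 by (rule linear_cmul[OF lin(2)[OF q]])
    ultimately show ?thesis using nv by auto
  qed
  have "\<psi> (\<Phi> q) = q" using \<psi>\<Phi>[OF V(3)] by simp
  then show ?thesis using U V(1) VW diff cls nx by blast
qed

section \<open>The two halves of the theorem\<close>

text \<open>The Combescure clause ranges over every open \<open>U\<close> in \<open>D\<close> on
  which \<open>r\<close> is an immersion, since \<open>r\<close> may degenerate elsewhere; all data
  are restricted to \<open>U\<close> before surfaces are compared.\<close>

lemma representation_properties:
  assumes D: "open D" and trig: "\<forall>p\<in>D. sin (\<phi> p) * cos (\<phi> p) \<noteq> 0"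
    and S1: "solves_system D \<phi> \<kappa>1 s1" and S2: "solves_system D \<phi> \<kappa>2 s2"
    and nz: "\<forall>p\<in>D. partial_x s1 p \<noteq> 0 \<and> partial_y s1 p \<noteq> 0"
    and pot: "is_potential D \<kappa>1 s1 \<kappa>2 s2 A"
  defines "B \<equiv> B_fun \<kappa>1 s1" and "r \<equiv> radius_vector \<kappa>1 s1 \<kappa>2 s2 A" and "n \<equiv> normal_vector \<kappa>1 s1"
    and "\<rho>1 \<equiv> \<lambda>p. partial_x s2 p / partial_x s1 p * B_fun \<kappa>1 s1 p - A p"
    and "\<rho>2 \<equiv> \<lambda>p. partial_y s2 p / partial_y s1 p * B_fun \<kappa>1 s1 p - A p"
  shows "curvature_line_surface {p\<in>D. immersion_at r p} r n" (is ?cls)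
    and "\<forall>p\<in>D. partial_x r p = \<rho>1 p *\<^sub>R partial_x n p \<and> partial_y r p = \<rho>2 p *\<^sub>R partial_y n p" (is ?wein)
    and "principal_radii {p\<in>D. immersion_at r p} r n \<rho>1 \<rho>2"
    and "\<forall>p\<in>D. \<forall>dx dy.
              third_form n p (dx, dy) (dx, dy) =
                ((deriv_at \<kappa>1 p (dx, dy))\<^sup>2 + (deriv_at s1 p (dx, dy))\<^sup>2)
                  / (B p)\<^sup>2 \<and>
              third_form n p (dx, dy) (dx, dy) =
                (partial_x s1 p / B p)\<^sup>2 * (dx\<^sup>2 / (cos (\<phi> p))\<^sup>2) +
                (partial_y s1 p / B p)\<^sup>2 * (dy\<^sup>2 / (sin (\<phi> p))\<^sup>2)" (is ?third)
    and "\<forall>U. open U \<and> U \<subseteq> D \<and> (\<forall>p\<in>U. immersion_at r p) \<longrightarrow>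
              (\<forall>\<kappa>2' s2' A'.
                 solves_system U \<phi> \<kappa>2' s2' \<and> is_potential U \<kappa>1 s1 \<kappa>2' s2' A' \<and>
                 (\<forall>p\<in>U. immersion_at (radius_vector \<kappa>1 s1 \<kappa>2' s2' A') p) \<longrightarrow>
                 combescure_equivalent U r n (radius_vector \<kappa>1 s1 \<kappa>2' s2' A') n) \<and>
              (\<forall>r' n'.
                 combescure_equivalent U r n r' n' \<longrightarrow>
                 (\<exists>\<kappa>2' s2' A'.
                    solves_system U \<phi> \<kappa>2' s2' \<and> is_potential U \<kappa>1 s1 \<kappa>2' s2' A' \<and>
                    (\<forall>p\<in>U. r' p = radius_vector \<kappa>1 s1 \<kappa>2' s2' A' p)) \<and>
                 (\<forall>L. curvature_line_arc U L \<longrightarrow> n' ` L = n ` L \<or> n' ` L = uminus ` n ` L))" (is ?combescure)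
proof -
  show cls: ?cls
    unfolding r_def n_def using representation_curvature_line_surface[OF D S1 S2 pot] trig nz by blast
  show wein: ?wein
    unfolding r_def n_def \<rho>1_def \<rho>2_def
    using representation_weingarten[OF S1 S2 pot] nz by blast
  show "principal_radii {p\<in>D. immersion_at r p} r n \<rho>1 \<rho>2"
    using cls wein by (simp add: principal_radii_def)
  show ?third
    unfolding n_def B_def
    by (intro ballI allI conjI third_form_representation(1,2)[OF S1 _ bspec[OF trig]])
  show ?combescure
    unfolding r_def n_def
  proof (intro allI impI conjI; elim conjE)
    fix U assume U: "open U" and UD: "U \<subseteq> D" and imm: "\<forall>p\<in>U. immersion_at (radius_vector \<kappa>1 s1 \<kappa>2 s2 A) p"
    have S1': "solves_system U \<phi> \<kappa>1 s1" and S2': "solves_system U \<phi> \<kappa>2 s2" and pot': "is_potential U \<kappa>1 s1 \<kappa>2 s2 A"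
      using S1 S2 pot UD solves_system_subset is_potential_subset by blast+
    have nz': "partial_x s1 p \<noteq> 0 \<and> partial_y s1 p \<noteq> 0" if "p \<in> U" for p using nz UD that by blast
    have trig': "sin (\<phi> p) * cos (\<phi> p) \<noteq> 0" if "p \<in> U" for p using trig UD that by blast
    {
      fix \<kappa>2' s2' A'
      assume "solves_system U \<phi> \<kappa>2' s2'" "is_potential U \<kappa>1 s1 \<kappa>2' s2' A'"
        "\<forall>p\<in>U. immersion_at (radius_vector \<kappa>1 s1 \<kappa>2' s2' A') p"
      then show "combescure_equivalent U (radius_vector \<kappa>1 s1 \<kappa>2 s2 A) (normal_vector \<kappa>1 s1)
          (radius_vector \<kappa>1 s1 \<kappa>2' s2' A') (normal_vector \<kappa>1 s1)"
        using representation_combescure_equivalent[OF U S1' trig' nz' S2' pot'] imm by blast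
    next
      fix r' n'
      assume eq: "combescure_equivalent U (radius_vector \<kappa>1 s1 \<kappa>2 s2 A) (normal_vector \<kappa>1 s1) r' n'"
      show "\<exists>\<kappa>2' s2' A'. solves_system U \<phi> \<kappa>2' s2' \<and> is_potential U \<kappa>1 s1 \<kappa>2' s2' A' \<and>
          (\<forall>p\<in>U. r' p = radius_vector \<kappa>1 s1 \<kappa>2' s2' A' p)"
        by (rule combescure_equivalent_representation[OF U S1' S2' pot' nz' eq])
      show "n' ` L = normal_vector \<kappa>1 s1 ` L \<or> n' ` L = uminus ` normal_vector \<kappa>1 s1 ` L"
        if "curvature_line_arc U L" for L
        by (rule combescure_equivalent_normals(2)[OF eq that])
    }
  qed
qed

text \<open>Shrinking the coordinate domain to a ball makes it simply connected by convexity, and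
  the curvature line coordinates restrict to a diffeomorphism of the ball onto its open
  image.\<close>

lemma nonumbilic_representation:
  assumes s: "surface W R N" and q: "q \<in> W" and nu: "\<not> umbilic_at R N q"
  shows "\<exists>U V \<psi> Q \<phi> \<kappa>1 s1 \<kappa>2 s2 A.
           open V \<and> q \<in> V \<and> V \<subseteq> W \<and>
           open U \<and> simply_connected U \<and> diffeomorphism_on U V \<psi> \<and>
           curvature_line_surface U (R \<circ> \<psi>) (N \<circ> \<psi>) \<and>
           smooth_on U \<phi> \<and> (\<forall>p\<in>U. sin (\<phi> p) * cos (\<phi> p) \<noteq> 0) \<and>
           solves_system U \<phi> \<kappa>1 s1 \<and> solves_system U \<phi> \<kappa>2 s2 \<and>
           smooth_on U A \<and> is_potential U \<kappa>1 s1 \<kappa>2 s2 A \<and>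
           rotation_matrix Q \<and>
           (\<forall>p\<in>U. Q *v R (\<psi> p) = radius_vector \<kappa>1 s1 \<kappa>2 s2 A p \<and>
                  Q *v N (\<psi> p) = normal_vector \<kappa>1 s1 p)"
proof -
  obtain U V \<psi> z0 where U: "open U" "open V" "V \<subseteq> W" and d: "diffeomorphism_on U V \<psi>"
    and cls: "curvature_line_surface U (R \<circ> \<psi>) (N \<circ> \<psi>)" and z0: "z0 \<in> U" "\<psi> z0 = q"
    and nx: "partial_x (N \<circ> \<psi>) z0 \<noteq> 0"
    using curvature_line_coordinates[OF s q nu] by blast
  obtain e Q \<phi> \<kappa>1 s1 \<kappa>2 s2 A where e: "e > 0" "ball z0 e \<subseteq> U"
    and rest: "smooth_on (ball z0 e) \<phi>" "\<forall>p\<in>ball z0 e. sin (\<phi> p) * cos (\<phi> p) \<noteq> 0"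
      "solves_system (ball z0 e) \<phi> \<kappa>1 s1" "solves_system (ball z0 e) \<phi> \<kappa>2 s2"
      "smooth_on (ball z0 e) A" "is_potential (ball z0 e) \<kappa>1 s1 \<kappa>2 s2 A" "rotation_matrix Q"
    and rep: "\<forall>p\<in>ball z0 e. Q *v (R \<circ> \<psi>) p = radius_vector \<kappa>1 s1 \<kappa>2 s2 A p \<and> Q *v (N \<circ> \<psi>) p = normal_vector \<kappa>1 s1 p"
    using curvature_line_surface_local_representation[OF cls z0(1) nx] by blast
  note restr = diffeomorphism_on_restrict[OF d U(2) open_ball e(2)]
  have "\<psi> ` ball z0 e \<subseteq> V" using d e(2) by (auto simp: diffeomorphism_on_def bij_betw_def)
  then have sub: "\<psi> ` ball z0 e \<subseteq> W" using U(3) by blast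
  have qin: "q \<in> \<psi> ` ball z0 e" using z0(2) e(1) by force
  have cls': "curvature_line_surface (ball z0 e) (R \<circ> \<psi>) (N \<circ> \<psi>)"
    using cls e(2) smooth_on_subset[of U _ "ball z0 e"]
    unfolding curvature_line_surface_def surface_def by blast
  have sc: "simply_connected (ball z0 e)" by (rule convex_imp_simply_connected[OF convex_ball])
  have rep': "\<forall>p\<in>ball z0 e. Q *v R (\<psi> p) = radius_vector \<kappa>1 s1 \<kappa>2 s2 A p \<and> Q *v N (\<psi> p) = normal_vector \<kappa>1 s1 p"
    using rep by simp
  show ?thesis
    by (rule exI[of _ "ball z0 e"], rule exI[of _ "\<psi> ` ball z0 e"], rule exI[of _ \<psi>], rule exI[of _ Q],
        rule exI[of _ \<phi>], rule exI[of _ \<kappa>1], rule exI[of _ s1], rule exI[of _ \<kappa>2], rule exI[of _ s2], rule exI[of _ A])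
      (rule restr qin sub open_ball sc cls' rest rep' conjI)+
qed

theorem mainTheorem4:
  shows
    "(\<forall>D \<phi> \<kappa>1 s1 \<kappa>2 s2 A.
        open D \<and> simply_connected D \<and> smooth_on D \<phi> \<and> (\<forall>p\<in>D. sin (\<phi> p) * cos (\<phi> p) \<noteq> 0) \<and>
        solves_system D \<phi> \<kappa>1 s1 \<and> solves_system D \<phi> \<kappa>2 s2 \<and>
        (\<forall>p\<in>D. partial_x s1 p \<noteq> 0 \<and> partial_y s1 p \<noteq> 0) \<and>
        is_potential D \<kappa>1 s1 \<kappa>2 s2 A \<longrightarrow>
        (let B = B_fun \<kappa>1 s1;
             r = radius_vector \<kappa>1 s1 \<kappa>2 s2 A;
             n = normal_vector \<kappa>1 s1;
             l1 = (\<lambda>p. partial_x s2 p / partial_x s1 p);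
             l2 = (\<lambda>p. partial_y s2 p / partial_y s1 p);
             \<rho>1 = (\<lambda>p. l1 p * B p - A p);
             \<rho>2 = (\<lambda>p. l2 p * B p - A p)
         in
           curvature_line_surface {p\<in>D. immersion_at r p} r n \<and>
           (\<forall>p\<in>D. partial_x r p = \<rho>1 p *\<^sub>R partial_x n p \<and> partial_y r p = \<rho>2 p *\<^sub>R partial_y n p) \<and>
           principal_radii {p\<in>D. immersion_at r p} r n \<rho>1 \<rho>2 \<and>
           (\<forall>p\<in>D. \<forall>dx dy.
              third_form n p (dx, dy) (dx, dy) =
                ((frechet_derivative \<kappa>1 (at p) (dx, dy))\<^sup>2 + (frechet_derivative s1 (at p) (dx, dy))\<^sup>2)
                  / (B p)\<^sup>2 \<and>
              third_form n p (dx, dy) (dx, dy) =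
                (partial_x s1 p / B p)\<^sup>2 * (dx\<^sup>2 / (cos (\<phi> p))\<^sup>2) +
                (partial_y s1 p / B p)\<^sup>2 * (dy\<^sup>2 / (sin (\<phi> p))\<^sup>2)) \<and>
           (\<forall>U. open U \<and> U \<subseteq> D \<and> (\<forall>p\<in>U. immersion_at r p) \<longrightarrow>
              (\<forall>\<kappa>2' s2' A'.
                 solves_system U \<phi> \<kappa>2' s2' \<and> is_potential U \<kappa>1 s1 \<kappa>2' s2' A' \<and>
                 (\<forall>p\<in>U. immersion_at (radius_vector \<kappa>1 s1 \<kappa>2' s2' A') p) \<longrightarrow>
                 combescure_equivalent U r n (radius_vector \<kappa>1 s1 \<kappa>2' s2' A') n) \<and>
              (\<forall>r' n'.
                 combescure_equivalent U r n r' n' \<longrightarrow>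
                 (\<exists>\<kappa>2' s2' A'.
                    solves_system U \<phi> \<kappa>2' s2' \<and> is_potential U \<kappa>1 s1 \<kappa>2' s2' A' \<and>
                    (\<forall>p\<in>U. r' p = radius_vector \<kappa>1 s1 \<kappa>2' s2' A' p)) \<and>
                 (\<forall>L. curvature_line_arc U L \<longrightarrow> n' ` L = n ` L \<or> n' ` L = uminus ` n ` L)))))
     \<and>
     (\<forall>W R N q.
        surface W R N \<and> q \<in> W \<and> \<not> umbilic_at R N q \<longrightarrow>
        (\<exists>U V \<psi> Q \<phi> \<kappa>1 s1 \<kappa>2 s2 A.
           open V \<and> q \<in> V \<and> V \<subseteq> W \<and>
           open U \<and> simply_connected U \<and> diffeomorphism_on U V \<psi> \<and>
           curvature_line_surface U (R \<circ> \<psi>) (N \<circ> \<psi>) \<and>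
           smooth_on U \<phi> \<and> (\<forall>p\<in>U. sin (\<phi> p) * cos (\<phi> p) \<noteq> 0) \<and>
           solves_system U \<phi> \<kappa>1 s1 \<and> solves_system U \<phi> \<kappa>2 s2 \<and>
           smooth_on U A \<and> is_potential U \<kappa>1 s1 \<kappa>2 s2 A \<and>
           rotation_matrix Q \<and>
           (\<forall>p\<in>U. Q *v R (\<psi> p) = radius_vector \<kappa>1 s1 \<kappa>2 s2 A p \<and>
                  Q *v N (\<psi> p) = normal_vector \<kappa>1 s1 p)))"
proof (rule conjI, goal_cases)
  case 1
  show ?case
  proof (intro allI impI, elim conjE, goal_cases)
    case (1 D \<phi> \<kappa>1 s1 \<kappa>2 s2 A)
    note parts = representation_properties[OF 1(1,4,5,6,7,8)]
    show ?case
      unfolding Let_def by (rule conjI parts)+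
  qed
next
  case 2
  show ?case
    by (intro allI impI, elim conjE, rule nonumbilic_representation)
qed

end
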